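(* Consider the Koopman-linearizable system, tracking problem, predictive tracking algorithm and constants $P_\infty$, $A_{\mathrm{cl},\infty}$, $\rho_\infty$, $\gamma_\infty$ described in the context. Assume: (1) $f$ is Koopman-linearizable with embedding $(A,B,C,\psi)$, and there is $D_\psi<\infty$ with $\|\psi(r)\|\le D_\psi$ for all $\|r\|\le 1$; (2) with $Q:=C^{\top}Q_zC$, $(A,B)$ is stabilizable, $(Q,A)$ is detectable, $Q_z\succeq 0$, $Q\succeq 0$, $R\succ 0$. Let $\lambda_\infty:=\max\{\rho_\infty,\gamma_\infty\}$. Then there is a stabilizing window $\Delta_{\mathrm{stab}}=\mathcal O\big(\log(1-\rho(A_{\mathrm{cl},\infty}))^{-1}\big)$ (the minimal horizon length for the system to exhibit stability), depending only on $(A,B,Q,R)$ and not on $T$, such that, if the prediction horizon satisfies $W\ge\Delta_{\mathrm{stab}}$, the dynamic regret of the predictive tracking algorithm satisfies $$\mathrm{Reg}_T(\pi^{\mathrm{MPC}})=\mathcal{O}\big(W^2\lambda_\infty^{2W}\,T\big),$$ where the constants hidden in $\mathcal O(\cdot)$ depend only on $(A,B,Q,R,D_\psi)$, and not on $T$ or $W$. Moreover, if $\max\{\rho_\infty,\gamma_\infty\}=\rho_\infty$, the bound can be tightened to $\mathcal{O}(\rho_\infty^{2W}T)$.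
   Context: Notation: $[k]=\{1,\dots,k\}$; $\|x\|_P^2:=x^{\top}Px$ for $P\succeq0$; $\rho(M)$ is the spectral radius; $w_{a:b}$ denotes the sequence (or stacked vector) $w_a,\dots,w_b$. System. $z_{t+1}=f(z_t,u_t)$ with $z_t\in\mathbb{R}^{n_z}$, $u_t\in\mathbb{R}^{n_u}$, initialized at $z_1$. $f$ is Koopman-linearizable with embedding $(A,B,C,\psi)$ if $\psi:\mathbb{R}^{n_z}\to\mathbb{R}^{n_x}$ and $A\in\mathbb{R}^{n_x\times n_x}$, $B\in\mathbb{R}^{n_x\times n_u}$, $C\in\mathbb{R}^{n_z\times n_x}$ satisfy $\psi(f(z,u))=A\psi(z)+Bu$ and $z=C\psi(z)$ for all $z,u$. Cost and regret. For a target trajectory $\mathbf r=r_{1:T}$, $r_t\in\mathbb{R}^{n_z}$, $\|r_t\|\le1$, and $\mathbf u=u_{1:T}$, let $\ell(z,u;r)=\|z-r\|_{Q_z}^2+\|u\|_R^2$, $J_T(\mathbf u;\mathbf r)=\sum_{t=1}^T\ell(z_t,u_t;r_t)$ along $z_{t+1}=f(z_t,u_t)$, $J_T^*=\min_{\mathbf u}J_T(\mathbf u;\mathbf r)$. For a policy $\pi$ producing inputs $\mathbf u$, the dynamic regret is $\mathrm{Reg}_T(\pi)=J_T(\mathbf u;\mathbf r)-J_T^*$. Predictive tracking algorithm with prediction horizon $W$. For $t\in[T-W]$: observe $z_t$ and $r_{t:t+W-1}$, solve a $W$-step problem, and apply the first control of its optimal sequence. At $t=T-W+1$: observe $z_t$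 and $r_{t:T}$, solve the same $W$-step problem and apply its whole optimal sequence over the last $W$ steps. The $W$-step problem at time $t$ is any one of the following (they yield identical controls, and $\pi^{\mathrm{MPC}}$ denotes the resulting common policy): - (N-MPC) $\min_{u_{1:W|t}}\sum_{i=1}^W\ell(z_{i|t},u_{i|t};r_{t+i-1})$ s.t. $z_{i+1|t}=f(z_{i|t},u_{i|t})$, $z_{1|t}=z_t$; - (L-MPC) $\min_{u_{1:W|t}}\sum_{i=1}^W\big(\|x_{i|t}-\psi(r_{t+i-1})\|_Q^2+\|u_{i|t}\|_R^2\big)$ s.t. $x_{i+1|t}=Ax_{i|t}+Bu_{i|t}$, $x_{1|t}=\psi(z_t)$; - (DDPC) $\min_{u_{1:W|t},z_{1:W|t},g}\sum_{i=1}^W\big(\|z_{i|t}-r_{t+i-1}\|_{Q_z}^2+\|u_{i|t}\|_R^2\big)$ s.t. $H_{\mathrm d}\,g=[u_{t-T_{\mathrm{ini}}:t-1}^{\top},u_{1:W|t}^{\top},z_{t-T_{\mathrm{ini}}:t-1}^{\top},z_{1:W|t}^{\top}]^{\top}$, where the most recent length-$T_{\mathrm{ini}}$ input-state trajectory of the system (assumed available also at the initial times) has $T_{\mathrm{ini}}\ge n_x$, and $H_{\mathrm d}$ is built from an offline trajectory $(\bar u_{1:n_{\mathrm d}},\bar z_{1:n_{\mathrm d}})$ of the system: with $L=T_{\mathrm{ini}}+W$ and $l=n_{\mathrm d}-L+1$, its $i$-th column is $[\bar u_{i:i+L-1}^{\top},\bar z_{i:i+L-1}^{\top}]^{\top}$,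 $i\in[l]$; $H_{\mathrm d}$ is required to provide lifted excitation of order $L$, i.e. the matrix with columns $[\bar u_{i:i+L-1}^{\top},\psi(\bar z_i)^{\top}]^{\top}$, $i\in[l]$, has full row rank $n_uL+n_x$. Riccati quantities. $P_T=Q$, and for $t\in[T-1]$: $\Sigma_t=R+B^{\top}P_{t+1}B$, $K_t=\Sigma_t^{-1}B^{\top}P_{t+1}A$, $P_t=Q+A^{\top}P_{t+1}A-A^{\top}P_{t+1}B\Sigma_t^{-1}B^{\top}P_{t+1}A$. $P_\infty\succeq0$ is the unique positive semidefinite solution of $P=Q+A^{\top}PA-A^{\top}PB(R+B^{\top}PB)^{-1}B^{\top}PA$; $K_\infty=(R+B^{\top}P_\infty B)^{-1}B^{\top}P_\infty A$; $A_{\mathrm{cl},\infty}=A-BK_\infty$ (which has $\rho(A_{\mathrm{cl},\infty})<1$). $\rho_\infty\in(0,1)$ is a constant depending only on $(A,B,Q,R)$ that is an exponential convergence rate of the Riccati recursion: $\|P_t-P_\infty\|=\mathcal O(\rho_\infty^{T-t})$ and $\|K_t-K_\infty\|=\mathcal O(\rho_\infty^{T-t})$ with hidden constants depending only on $(A,B,Q,R)$ and not on $T$. $\gamma_\infty:=\tfrac12(1+\rho(A_{\mathrm{cl},\infty}))$.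
   Formalization: The regret bounds carry an extra factor 1+‖ψ(z_1)‖², since constants depending only on (A,B,Q,R,D_ψ) fail for large z_1; the bound on Δ_stab uses 1+log(1/(1-ρ(A_cl,∞))), since the logarithm alone is 0 when ρ(A_cl,∞)=0. *)

theory Defs
  imports "HOL-Analysis.Analysis"
begin

section \<open>Matrices\<close>

definition psd :: "real^'n^'n \<Rightarrow> bool" where
  "psd P \<longleftrightarrow> transpose P = P \<and> (\<forall>x. 0 \<le> x \<bullet> (P *v x))"

definition posdef :: "real^'n^'n \<Rightarrow> bool" where
  "posdef P \<longleftrightarrow> transpose P = P \<and> (\<forall>x. x \<noteq> 0 \<longrightarrow> 0 < x \<bullet> (P *v x))"

text \<open>The squared weighted norm of \<open>x\<close> with weight \<open>P\<close>.\<close>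

definition wnorm2 :: "real^'n^'n \<Rightarrow> real^'n \<Rightarrow> real" where
  "wnorm2 P x = x \<bullet> (P *v x)"

text \<open>Eigenvalues are taken over the complex numbers.\<close>

definition spectral_radius :: "real^'n^'n \<Rightarrow> real" where
  "spectral_radius M =
     Max {cmod \<mu> | \<mu>. \<exists>v::complex^'n. v \<noteq> 0 \<and> map_matrix complex_of_real M *v v = \<mu> *s v}"

definition stabilizable :: "real^'n^'n \<Rightarrow> real^'m^'n \<Rightarrow> bool" where
  "stabilizable A B \<longleftrightarrow> (\<exists>K::real^'n^'m. spectral_radius (A - B ** K) < 1)"

definition detectable :: "real^'n^'p \<Rightarrow> real^'n^'n \<Rightarrow> bool" where
  "detectable Q A \<longleftrightarrow> (\<exists>L::real^'p^'n. spectral_radius (A - L ** Q) < 1)"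

text \<open>For a matrix with finite row index set, full row rank means linearly independent rows.\<close>

definition full_row_rank :: "'r set \<Rightarrow> 'c set \<Rightarrow> ('r \<Rightarrow> 'c \<Rightarrow> real) \<Rightarrow> bool" where
  "full_row_rank I J M \<longleftrightarrow>
     (\<forall>a. (\<forall>j\<in>J. (\<Sum>i\<in>I. a i * M i j) = 0) \<longrightarrow> (\<forall>i\<in>I. a i = 0))"


section \<open>Riccati quantities\<close>

definition riccati_gain ::
  "real^'n^'n \<Rightarrow> real^'m^'n \<Rightarrow> real^'m^'m \<Rightarrow> real^'n^'n \<Rightarrow> real^'n^'m" where
  "riccati_gain A B R P =
     matrix_inv (R + transpose B ** P ** B) ** transpose B ** P ** A"

definition riccati_map ::
  "real^'n^'n \<Rightarrow> real^'m^'n \<Rightarrow> real^'n^'n \<Rightarrow> real^'m^'m \<Rightarrow> real^'n^'n \<Rightarrow> real^'n^'n" where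
  "riccati_map A B Q R P =
     Q + transpose A ** P ** A
       - transpose A ** P ** B ** matrix_inv (R + transpose B ** P ** B) ** transpose B ** P ** A"

text \<open>The backward recursion started from \<open>Q\<close> at time \<open>T\<close>.\<close>

definition riccati_P ::
  "real^'n^'n \<Rightarrow> real^'m^'n \<Rightarrow> real^'n^'n \<Rightarrow> real^'m^'m \<Rightarrow> nat \<Rightarrow> nat \<Rightarrow> real^'n^'n" where
  "riccati_P A B Q R T t = (riccati_map A B Q R ^^ (T - t)) Q"

definition riccati_K ::
  "real^'n^'n \<Rightarrow> real^'m^'n \<Rightarrow> real^'n^'n \<Rightarrow> real^'m^'m \<Rightarrow> nat \<Rightarrow> nat \<Rightarrow> real^'n^'m" where
  "riccati_K A B Q R T t = riccati_gain A B R (riccati_P A B Q R T (t + 1))"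

definition P_inf ::
  "real^'n^'n \<Rightarrow> real^'m^'n \<Rightarrow> real^'n^'n \<Rightarrow> real^'m^'m \<Rightarrow> real^'n^'n" where
  "P_inf A B Q R = (THE P. psd P \<and> P = riccati_map A B Q R P)"

definition K_inf ::
  "real^'n^'n \<Rightarrow> real^'m^'n \<Rightarrow> real^'n^'n \<Rightarrow> real^'m^'m \<Rightarrow> real^'n^'m" where
  "K_inf A B Q R = riccati_gain A B R (P_inf A B Q R)"

definition A_cl ::
  "real^'n^'n \<Rightarrow> real^'m^'n \<Rightarrow> real^'n^'n \<Rightarrow> real^'m^'m \<Rightarrow> real^'n^'n" where
  "A_cl A B Q R = A - B ** K_inf A B Q R"

definition gamma_inf ::
  "real^'n^'n \<Rightarrow> real^'m^'n \<Rightarrow> real^'n^'n \<Rightarrow> real^'m^'m \<Rightarrow> real" where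
  "gamma_inf A B Q R = (1 + spectral_radius (A_cl A B Q R)) / 2"

definition riccati_rate_const ::
  "real^'n^'n \<Rightarrow> real^'m^'n \<Rightarrow> real^'n^'n \<Rightarrow> real^'m^'m \<Rightarrow> real \<Rightarrow> real \<Rightarrow> bool" where
  "riccati_rate_const A B Q R \<rho> M \<longleftrightarrow>
     (\<forall>T. (\<forall>t\<in>{1..T}.
              onorm ((*v) (riccati_P A B Q R T t - P_inf A B Q R)) \<le> M * \<rho> ^ (T - t)) \<and>
          (\<forall>t\<in>{1..<T}.
              onorm ((*v) (riccati_K A B Q R T t - K_inf A B Q R)) \<le> M * \<rho> ^ (T - t)))"

definition riccati_rate ::
  "real^'n^'n \<Rightarrow> real^'m^'n \<Rightarrow> real^'n^'n \<Rightarrow> real^'m^'m \<Rightarrow> real \<Rightarrow> bool" where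
  "riccati_rate A B Q R \<rho> \<longleftrightarrow> 0 < \<rho> \<and> \<rho> < 1 \<and> (\<exists>M. riccati_rate_const A B Q R \<rho> M)"

text \<open>The feedback gain that the \<open>W\<close>-step problem applies to the current lifted state. As
  \<open>riccati_map\<close> sends \<open>0\<close> to \<open>Q\<close>, for \<open>W \<ge> 2\<close> this is \<open>riccati_K\<close> with \<open>T - t + 1 = W\<close>. For
  \<open>W = 1\<close> it is \<open>0\<close>, because the optimal last input is \<open>0\<close>.\<close>

definition mpc_gain ::
  "real^'n^'n \<Rightarrow> real^'m^'n \<Rightarrow> real^'n^'n \<Rightarrow> real^'m^'m \<Rightarrow> nat \<Rightarrow> real^'n^'m" where
  "mpc_gain A B Q R W = riccati_gain A B R ((riccati_map A B Q R ^^ (W - 1)) 0)"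

definition stabilizing_window ::
  "real^'n^'n \<Rightarrow> real^'m^'n \<Rightarrow> real^'n^'n \<Rightarrow> real^'m^'m \<Rightarrow> nat \<Rightarrow> bool" where
  "stabilizing_window A B Q R \<Delta> \<longleftrightarrow>
     1 \<le> \<Delta> \<and> (\<forall>W\<ge>\<Delta>. spectral_radius (A - B ** mpc_gain A B Q R W) < 1)"

definition minimal_stabilizing_window ::
  "real^'n^'n \<Rightarrow> real^'m^'n \<Rightarrow> real^'n^'n \<Rightarrow> real^'m^'m \<Rightarrow> nat \<Rightarrow> bool" where
  "minimal_stabilizing_window A B Q R \<Delta> \<longleftrightarrow>
     stabilizing_window A B Q R \<Delta> \<and> (\<forall>N. stabilizing_window A B Q R N \<longrightarrow> \<Delta> \<le> N)"

text \<open>The quantities hidden in the order bound on the stabilizing window. Every \<open>(A, B, Q, R)\<close>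
  admits such an \<open>M\<close>, since \<open>gamma_inf\<close> exceeds the spectral radius of \<open>A_cl\<close>.\<close>

definition window_const ::
  "real^'n^'n \<Rightarrow> real^'m^'n \<Rightarrow> real^'n^'n \<Rightarrow> real^'m^'m \<Rightarrow> real \<Rightarrow> real \<Rightarrow> bool" where
  "window_const A B Q R \<rho> M \<longleftrightarrow>
     riccati_rate_const A B Q R \<rho> M \<and> onorm ((*v) B) \<le> M \<and>
     (\<forall>k. onorm ((*v) (A_cl A B Q R) ^^ k) \<le> M * gamma_inf A B Q R ^ k)"


section \<open>System, cost and regret\<close>

text \<open>Time is an integer, because the data-driven controller uses inputs and states from before
  time \<open>1\<close>. Signals are functions on all integers of which only the relevant values matter.\<close>

definition koopman_embedding ::
  "(real^'z \<Rightarrow> real^'m \<Rightarrow> real^'z) \<Rightarrow> real^'n^'n \<Rightarrow> real^'m^'n \<Rightarrow> real^'n^'z \<Rightarrow>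
   (real^'z \<Rightarrow> real^'n) \<Rightarrow> bool" where
  "koopman_embedding f A B C \<psi> \<longleftrightarrow>
     (\<forall>z u. \<psi> (f z u) = A *v \<psi> z + B *v u) \<and> (\<forall>z. z = C *v \<psi> z)"

definition trajectory ::
  "('s \<Rightarrow> 'i \<Rightarrow> 's) \<Rightarrow> int \<Rightarrow> int \<Rightarrow> (int \<Rightarrow> 's) \<Rightarrow> (int \<Rightarrow> 'i) \<Rightarrow> bool" where
  "trajectory f a b z u \<longleftrightarrow> (\<forall>t. a \<le> t \<and> t < b \<longrightarrow> z (t + 1) = f (z t) (u t))"

text \<open>\<open>rollout f z1 u k\<close> is the state at time \<open>k + 1\<close>.\<close>

primrec rollout :: "('s \<Rightarrow> 'i \<Rightarrow> 's) \<Rightarrow> 's \<Rightarrow> (int \<Rightarrow> 'i) \<Rightarrow> nat \<Rightarrow> 's" where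
  "rollout f z1 u 0 = z1"
| "rollout f z1 u (Suc k) = f (rollout f z1 u k) (u (int k + 1))"

definition stage_cost ::
  "real^'z^'z \<Rightarrow> real^'m^'m \<Rightarrow> real^'z \<Rightarrow> real^'m \<Rightarrow> real^'z \<Rightarrow> real" where
  "stage_cost Qz R z u r = wnorm2 Qz (z - r) + wnorm2 R u"

definition J_cost ::
  "(real^'z \<Rightarrow> real^'m \<Rightarrow> real^'z) \<Rightarrow> real^'z^'z \<Rightarrow> real^'m^'m \<Rightarrow> real^'z \<Rightarrow> nat \<Rightarrow>
   (int \<Rightarrow> real^'m) \<Rightarrow> (int \<Rightarrow> real^'z) \<Rightarrow> real" where
  "J_cost f Qz R z1 T u r =
     (\<Sum>t=1..int T. stage_cost Qz R (rollout f z1 u (nat (t - 1))) (u t) (r t))"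

definition J_opt ::
  "(real^'z \<Rightarrow> real^'m \<Rightarrow> real^'z) \<Rightarrow> real^'z^'z \<Rightarrow> real^'m^'m \<Rightarrow> real^'z \<Rightarrow> nat \<Rightarrow>
   (int \<Rightarrow> real^'z) \<Rightarrow> real" where
  "J_opt f Qz R z1 T r = (INF u. J_cost f Qz R z1 T u r)"

definition dyn_regret ::
  "(real^'z \<Rightarrow> real^'m \<Rightarrow> real^'z) \<Rightarrow> real^'z^'z \<Rightarrow> real^'m^'m \<Rightarrow> real^'z \<Rightarrow> nat \<Rightarrow>
   (int \<Rightarrow> real^'m) \<Rightarrow> (int \<Rightarrow> real^'z) \<Rightarrow> real" where
  "dyn_regret f Qz R z1 T u r = J_cost f Qz R z1 T u r - J_opt f Qz R z1 T r"


section \<open>Predictive tracking algorithm\<close>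

text \<open>Each of the predicates \<open>nmpc_plan\<close>, \<open>lmpc_plan\<close>, \<open>ddpc_plan\<close> says that the input sequence
  \<open>v\<close>, on indices \<open>1, \<dots>, W\<close>, is part of an optimal solution of the \<open>W\<close>-step problem at time \<open>t\<close>.\<close>

definition nmpc_plan ::
  "(real^'z \<Rightarrow> real^'m \<Rightarrow> real^'z) \<Rightarrow> real^'z^'z \<Rightarrow> real^'m^'m \<Rightarrow> nat \<Rightarrow> (int \<Rightarrow> real^'z) \<Rightarrow>
   (int \<Rightarrow> real^'z) \<Rightarrow> int \<Rightarrow> (int \<Rightarrow> real^'m) \<Rightarrow> bool" where
  "nmpc_plan f Qz R W r z t v \<longleftrightarrow>
     (\<exists>y. is_arg_min
        (\<lambda>(v, y). \<Sum>i=1..int W. stage_cost Qz R (y i) (v i) (r (t + i - 1)))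
        (\<lambda>(v, y). y 1 = z t \<and> trajectory f 1 (int W) y v)
        (v, y))"

definition lmpc_plan ::
  "real^'n^'n \<Rightarrow> real^'m^'n \<Rightarrow> (real^'z \<Rightarrow> real^'n) \<Rightarrow> real^'n^'n \<Rightarrow> real^'m^'m \<Rightarrow> nat \<Rightarrow>
   (int \<Rightarrow> real^'z) \<Rightarrow> (int \<Rightarrow> real^'z) \<Rightarrow> int \<Rightarrow> (int \<Rightarrow> real^'m) \<Rightarrow> bool" where
  "lmpc_plan A B \<psi> Q R W r z t v \<longleftrightarrow>
     (\<exists>x. is_arg_min
        (\<lambda>(v, x). \<Sum>i=1..int W. wnorm2 Q (x i - \<psi> (r (t + i - 1))) + wnorm2 R (v i))
        (\<lambda>(v, x). x 1 = \<psi> (z t) \<and> trajectory (\<lambda>x u. A *v x + B *v u) 1 (int W) x v)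
        (v, x))"

text \<open>Block row \<open>k\<close> of the product of the \<open>l\<close>-column Hankel matrix of the signal \<open>s\<close> with the
  vector \<open>g\<close>.\<close>

definition hankel_mult :: "int \<Rightarrow> (int \<Rightarrow> real^'k) \<Rightarrow> (int \<Rightarrow> real) \<Rightarrow> int \<Rightarrow> real^'k" where
  "hankel_mult l s g k = (\<Sum>i=1..l. g i *\<^sub>R s (i + k - 1))"

text \<open>The matrix with columns \<open>(ub i, \<dots>, ub (i + L - 1), \<psi> (zb i))\<close>: row \<open>Inl (k, a)\<close> is
  component \<open>a\<close> of the \<open>k\<close>-th input block, row \<open>Inr b\<close> is component \<open>b\<close> of the lifted state.\<close>

fun excitation_matrix ::
  "(real^'z \<Rightarrow> real^'n) \<Rightarrow> (int \<Rightarrow> real^'m) \<Rightarrow> (int \<Rightarrow> real^'z) \<Rightarrow>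
   (int \<times> 'm) + 'n \<Rightarrow> int \<Rightarrow> real" where
  "excitation_matrix \<psi> ub zb (Inl (k, a)) i = ub (i + k - 1) $ a"
| "excitation_matrix \<psi> ub zb (Inr b) i = \<psi> (zb i) $ b"

definition lifted_excitation ::
  "(real^'z \<Rightarrow> real^'n) \<Rightarrow> nat \<Rightarrow> nat \<Rightarrow> (int \<Rightarrow> real^'m) \<Rightarrow> (int \<Rightarrow> real^'z) \<Rightarrow> bool" where
  "lifted_excitation \<psi> L nd ub zb \<longleftrightarrow>
     full_row_rank (({1..int L} \<times> UNIV) <+> UNIV) {1..int nd - int L + 1}
       (excitation_matrix \<psi> ub zb)"

definition ddpc_data ::
  "(real^'z \<Rightarrow> real^'m \<Rightarrow> real^'z) \<Rightarrow> (real^'z \<Rightarrow> real^'n) \<Rightarrow> nat \<Rightarrow> nat \<Rightarrow> nat \<Rightarrow>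
   (int \<Rightarrow> real^'m) \<Rightarrow> (int \<Rightarrow> real^'z) \<Rightarrow> bool" where
  "ddpc_data f \<psi> Tini W nd ub zb \<longleftrightarrow>
     CARD('n) \<le> Tini \<and> Tini + W \<le> nd \<and> trajectory f 1 (int nd) zb ub \<and>
     lifted_excitation \<psi> (Tini + W) nd ub zb"

definition ddpc_plan ::
  "real^'z^'z \<Rightarrow> real^'m^'m \<Rightarrow> nat \<Rightarrow> nat \<Rightarrow> nat \<Rightarrow> (int \<Rightarrow> real^'m) \<Rightarrow> (int \<Rightarrow> real^'z) \<Rightarrow>
   (int \<Rightarrow> real^'z) \<Rightarrow> (int \<Rightarrow> real^'z) \<Rightarrow> (int \<Rightarrow> real^'m) \<Rightarrow> int \<Rightarrow> (int \<Rightarrow> real^'m) \<Rightarrow> bool" where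
  "ddpc_plan Qz R Tini W nd ub zb r z u t v \<longleftrightarrow>
     (let l = int nd - int (Tini + W) + 1 in
      \<exists>y g. is_arg_min
        (\<lambda>(v, y, g). \<Sum>i=1..int W. wnorm2 Qz (y i - r (t + i - 1)) + wnorm2 R (v i))
        (\<lambda>(v, y, g).
           (\<forall>k\<in>{1..int Tini}.
              hankel_mult l ub g k = u (t - int Tini + k - 1) \<and>
              hankel_mult l zb g k = z (t - int Tini + k - 1)) \<and>
           (\<forall>k\<in>{1..int W}.
              hankel_mult l ub g (int Tini + k) = v k \<and>
              hankel_mult l zb g (int Tini + k) = y k))
        (v, y, g))"

text \<open>Closed loop of a planner: the first planned input is applied up to time \<open>T - W\<close>, and the
  whole plan computed at time \<open>T - W + 1\<close> is applied afterwards.\<close>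

definition predictive_run ::
  "('s \<Rightarrow> 'i \<Rightarrow> 's) \<Rightarrow> nat \<Rightarrow> nat \<Rightarrow> (int \<Rightarrow> (int \<Rightarrow> 'i) \<Rightarrow> bool) \<Rightarrow>
   (int \<Rightarrow> 's) \<Rightarrow> (int \<Rightarrow> 'i) \<Rightarrow> bool" where
  "predictive_run f T W plan z u \<longleftrightarrow>
     trajectory f 1 (int T) z u \<and>
     (\<forall>t\<in>{1..int T - int W}. \<exists>v. plan t v \<and> u t = v 1) \<and>
     (\<exists>v. plan (int T - int W + 1) v \<and> (\<forall>i\<in>{1..int W}. u (int T - int W + i) = v i))"

definition mpc_run ::
  "(real^'z \<Rightarrow> real^'m \<Rightarrow> real^'z) \<Rightarrow> real^'n^'n \<Rightarrow> real^'m^'n \<Rightarrow> (real^'z \<Rightarrow> real^'n) \<Rightarrow>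
   real^'n^'n \<Rightarrow> real^'z^'z \<Rightarrow> real^'m^'m \<Rightarrow> nat \<Rightarrow> nat \<Rightarrow> (int \<Rightarrow> real^'z) \<Rightarrow>
   (int \<Rightarrow> real^'z) \<Rightarrow> (int \<Rightarrow> real^'m) \<Rightarrow> bool" where
  "mpc_run f A B \<psi> Q Qz R T W r z u \<longleftrightarrow>
     predictive_run f T W (nmpc_plan f Qz R W r z) z u \<or>
     predictive_run f T W (lmpc_plan A B \<psi> Q R W r z) z u \<or>
     (\<exists>Tini nd ub zb. ddpc_data f \<psi> Tini W nd ub zb \<and>
        trajectory f (1 - int Tini) 1 z u \<and>
        predictive_run f T W (ddpc_plan Qz R Tini W nd ub zb r z u) z u)"

end

theory Submission
  imports Defs "HOL-Computational_Algebra.Fundamental_Theorem_Algebra"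
begin

text \<open>
  In the lifted coordinates \<open>x = \<psi> z\<close> the system is linear and, because \<open>Q = C\<^sup>T Qz C\<close> and
  \<open>z = C \<psi> z\<close>, the tracking cost is the quadratic cost with weights \<open>Q\<close>, \<open>R\<close> and targets
  \<open>s t = \<psi> (r t)\<close>. So everything reduces to finite-horizon linear-quadratic tracking.

  Dynamic programming gives the optimal input with \<open>k\<close> steps left after the current one:
  an affine feedback \<open>opt_input\<close> whose linear part is \<open>gain k\<close> and whose offset comes from the backward
  recursion \<open>costate\<close> through the future targets. Completing the square at every step
  (\<open>opt_value_step\<close>) turns the cost of any trajectory into the optimal value plus a sum of squared
  deviations of the applied inputs from the optimal ones (\<open>tracking_cost_eq\<close>). Two things follow.
  Minimizers of a \<open>W\<close>-step problem are unique and equal to \<open>opt_input\<close>, so all three planners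
  realize the same feedback (\<open>mpc_run_feedback\<close>). And the regret is at most the sum over \<open>t\<close> of the
  squared differences between the horizon-\<open>W\<close> input and the full-horizon input at the same state;
  the last \<open>W\<close> steps contribute nothing.

  Each difference is of order \<open>lam ^ W\<close> (\<open>opt_input_estimates\<close>). Gains and
  quadratic value matrices for horizons beyond \<open>W\<close> differ by \<open>O(\<rho> ^ W)\<close> by the assumed
  Riccati rate. The difference of two costates obeys a recursion that contracts, in a norm adapted
  to the limiting closed loop, with a factor tending to some \<open>g < \<gamma>\<close>, and that is driven by terms
  \<open>O(\<rho> ^ k)\<close>. Since \<open>g\<close> can be taken strictly below \<open>\<gamma>\<close>, dividing by \<open>lam ^ k\<close> still leaves a
  contraction, so no polynomial factor in \<open>W\<close> appears. This is why the bound with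
  \<open>lam ^ (2 * W)\<close> alone is reached, from which both bounds of the theorem follow.
  It remains to bound the closed-loop states uniformly in \<open>W\<close>
  (\<open>uniform_bounded_response\<close>): for large \<open>W\<close> the closed loop is a small perturbation of the
  limiting one, and below that there are finitely many stable matrices.

  The window bound is the same perturbation argument with the constants kept explicit
  (\<open>stable_of_long_window\<close>). Both uses need that the limiting closed loop is stable
  (\<open>spectral_radius_A_cl\<close>), which follows from detectability and a Lyapunov identity, and that
  powers of a matrix decay at any rate above its spectral radius
  (\<open>power_bound_of_spectral_radius\<close>).
\<close>

section \<open>Growth of matrix powers and the spectral radius\<close>

text \<open>Transposes are kept as matrices acting from the left, the form in which
  \<open>inner_transpose\<close> below moves them across an inner product.\<close>

declare transpose_matrix_vector [simp del]

text \<open>One vector more than the dimension is always dependent. Indexing by numbers rather than by a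
  set keeps the statement meaningful when some of the vectors coincide.\<close>

lemma linear_relation_exists:
  fixes w :: "nat \<Rightarrow> 'a::euclidean_space"
  obtains c :: "nat \<Rightarrow> real" and j where "j \<le> DIM('a)" "c j \<noteq> 0"
    "(\<Sum>i\<le>DIM('a). c i *\<^sub>R w i) = 0"
proof (cases "inj_on w {..DIM('a)}")
  case True
  let ?S = "w ` {..DIM('a)}"
  have "card ?S = Suc DIM('a)"
    using True by (simp add: card_image)
  then have "dependent ?S"
    by (intro dependent_biggerset) auto
  then obtain u v where u: "v \<in> ?S" "u v \<noteq> 0" "(\<Sum>v\<in>?S. u v *\<^sub>R v) = 0"
    using dependent_finite[of ?S] by auto
  then obtain j where j: "j \<le> DIM('a)" "u (w j) \<noteq> 0"
    by auto
  have "(\<Sum>i\<le>DIM('a). u (w i) *\<^sub>R w i) = 0"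
    using u(3) True by (simp add: sum.reindex)
  with j show ?thesis
    by (rule that[of j "\<lambda>i. u (w i)"])
next
  case False
  then obtain i j where ij: "i \<le> DIM('a)" "j \<le> DIM('a)" "i \<noteq> j" "w i = w j"
    by (auto simp: inj_on_def)
  let ?c = "\<lambda>k. (if k = i then 1 else 0) - (if k = j then 1 else (0::real))"
  have "(\<Sum>k\<le>DIM('a). ?c k *\<^sub>R w k) =
        (\<Sum>k\<le>DIM('a). (if k = i then w k else 0)) - (\<Sum>k\<le>DIM('a). (if k = j then w k else 0))"
    unfolding sum_subtractf[symmetric] by (rule sum.cong) auto
  also have "\<dots> = 0"
    using ij by (simp add: sum.delta)
  finally show ?thesis
    using ij by (intro that[of i ?c]) auto
qed

text \<open>The operator \<open>p F\<close> obtained by substituting \<open>F\<close> into the polynomial \<open>p\<close>.\<close>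

definition op_poly :: "(complex^'n \<Rightarrow> complex^'n) \<Rightarrow> complex poly \<Rightarrow> complex^'n \<Rightarrow> complex^'n" where
  "op_poly F p v = (\<Sum>i\<le>degree p. coeff p i *s (F ^^ i) v)"

lemma op_poly_altdef:
  assumes "degree p \<le> n"
  shows "op_poly F p v = (\<Sum>i\<le>n. coeff p i *s (F ^^ i) v)"
  unfolding op_poly_def
  by (rule sum.mono_neutral_left) (use assms in \<open>auto simp: coeff_eq_0\<close>)

lemma op_poly_0 [simp]: "op_poly F 0 v = 0"
  by (simp add: op_poly_def)

lemma op_poly_pCons: "op_poly F (pCons a p) v = a *s v + op_poly F p (F v)"
proof -
  have "op_poly F (pCons a p) v = (\<Sum>i\<le>Suc (degree p). coeff (pCons a p) i *s (F ^^ i) v)"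
    by (rule op_poly_altdef) (rule degree_pCons_le)
  also have "\<dots> = a *s v + op_poly F p (F v)"
    unfolding sum.atMost_Suc_shift op_poly_def by (simp add: funpow_swap1)
  finally show ?thesis .
qed

lemma op_poly_diff: "op_poly F (p - q) v = op_poly F p v - op_poly F q v"
proof -
  let ?n = "max (degree p) (degree q)"
  have "op_poly F (p - q) v = (\<Sum>i\<le>?n. coeff (p - q) i *s (F ^^ i) v)"
    by (rule op_poly_altdef) (rule degree_diff_le_max)
  also have "\<dots> = (\<Sum>i\<le>?n. coeff p i *s (F ^^ i) v) - (\<Sum>i\<le>?n. coeff q i *s (F ^^ i) v)"
    by (simp add: vec.scale_left_diff_distrib sum_subtractf)
  also have "\<dots> = op_poly F p v - op_poly F q v"
    by (simp add: op_poly_altdef[of p ?n] op_poly_altdef[of q ?n])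
  finally show ?thesis .
qed

lemma op_poly_smult: "op_poly F (smult a p) v = a *s op_poly F p v"
proof -
  have "op_poly F (smult a p) v = (\<Sum>i\<le>degree p. coeff (smult a p) i *s (F ^^ i) v)"
    by (rule op_poly_altdef) (rule degree_smult_le)
  then show ?thesis
    by (simp add: op_poly_def vec.scale_sum_right)
qed

lemma norm_scalar_mult: "norm (c *s (v :: complex^'n)) = cmod c * norm v"
  by (simp add: norm_vec_def norm_mult L2_set_right_distrib)

definition cmat :: "real^'n^'m \<Rightarrow> complex^'n^'m" where
  "cmat M = map_matrix complex_of_real M"

definition eigenvalues :: "real^'n^'n \<Rightarrow> complex set" where
  "eigenvalues M = {\<mu>. \<exists>v. v \<noteq> 0 \<and> cmat M *v v = \<mu> *s v}"

lemma spectral_radius_eq: "spectral_radius M = Max (cmod ` eigenvalues M)"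
  unfolding spectral_radius_def eigenvalues_def cmat_def
  by (rule arg_cong[where f = Max]) auto

lemma funpow_matrix_diff:
  "((*v) M ^^ k) (v - w) = ((*v) M ^^ k) v - ((*v) M ^^ k) w" for M :: "'a::comm_ring_1^'n^'n"
  by (induction k) (auto simp: matrix_vector_mult_diff_distrib)

lemma funpow_matrix_scale:
  "((*v) M ^^ k) (c *s v) = c *s ((*v) M ^^ k) v" for M :: "'a::field^'n^'n"
  by (induction k) (auto simp: vector_scalar_commute)

lemma op_poly_linear_diff:
  "op_poly ((*v) M) p (v - w) = op_poly ((*v) M) p v - op_poly ((*v) M) p w"
  by (simp add: op_poly_def funpow_matrix_diff vec.scale_right_diff_distrib sum_subtractf)

lemma op_poly_linear_scale: "op_poly ((*v) M) p (c *s v) = c *s op_poly ((*v) M) p v"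
  by (simp add: op_poly_def funpow_matrix_scale vec.scale_sum_right mult.commute)

lemma op_poly_commute: "op_poly ((*v) M) p (M *v v) = M *v op_poly ((*v) M) p v"
proof (induction p arbitrary: v)
  case (pCons a p)
  then show ?case
    by (simp add: op_poly_pCons matrix_vector_right_distrib vector_scalar_commute)
qed simp

text \<open>A linear factor can be split off on either side because polynomials in one operator commute:
  the first form feeds a shifted vector to \<open>p\<close>, the second makes a nonzero value of \<open>p\<close> an eigenvector
  whenever the product vanishes.\<close>

lemma op_poly_linear_factor:
  "op_poly ((*v) M) ([:-r, 1:] * p) v = op_poly ((*v) M) p (M *v v - r *s v)"
  "op_poly ((*v) M) ([:-r, 1:] * p) v = M *v op_poly ((*v) M) p v - r *s op_poly ((*v) M) p v"
proof -
  have "[:-r, 1:] * p = pCons 0 p - smult r p"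
    by simp
  then have *: "op_poly ((*v) M) ([:-r, 1:] * p) v =
      op_poly ((*v) M) p (M *v v) - r *s op_poly ((*v) M) p v"
    by (simp add: op_poly_diff op_poly_smult op_poly_pCons del: mult_pCons_left)
  show "op_poly ((*v) M) ([:-r, 1:] * p) v = op_poly ((*v) M) p (M *v v - r *s v)"
    unfolding * by (simp add: op_poly_linear_diff op_poly_linear_scale)
  show "op_poly ((*v) M) ([:-r, 1:] * p) v =
      M *v op_poly ((*v) M) p v - r *s op_poly ((*v) M) p v"
    unfolding * by (simp add: op_poly_commute)
qed

lemma funpow_matrix_vector: "((**) M ^^ i) (mat 1) *v v = ((*v) M ^^ i) v" for M :: "'a::comm_ring_1^'n^'n"
  by (induction i) (auto simp flip: matrix_vector_mul_assoc)

text \<open>The powers of a matrix live in a finite-dimensional space, so they satisfy a linear relation.\<close>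

lemma annihilating_poly_exists:
  fixes M :: "complex^'n^'n"
  obtains p where "p \<noteq> 0" "\<And>v. op_poly ((*v) M) p v = 0"
proof -
  let ?d = "DIM(complex^'n^'n)"
  obtain c j where c: "j \<le> ?d" "c j \<noteq> 0"
    "(\<Sum>i\<le>?d. c i *\<^sub>R ((**) M ^^ i) (mat 1)) = 0"
    by (rule linear_relation_exists[of "\<lambda>i. ((**) M ^^ i) (mat 1)"])
  define p where "p = (\<Sum>i\<le>?d. monom (complex_of_real (c i)) i)"
  have coeff_p: "coeff p i = (if i \<le> ?d then complex_of_real (c i) else 0)" for i
    by (simp add: p_def coeff_sum)
  have deg: "degree p \<le> ?d"
    by (rule degree_le) (simp add: coeff_p)
  have scale: "complex_of_real a *s v = a *\<^sub>R v" for a and v :: "complex^'n"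
    by (simp add: vec_eq_iff) (simp add: scaleR_conv_of_real)
  have scale': "(a *\<^sub>R N) *v v = a *\<^sub>R (N *v v)" for a and v :: "complex^'n" and N :: "complex^'n^'n"
    by (simp add: vec_eq_iff matrix_vector_mult_def scaleR_sum_right)
  have sum_mv: "(\<Sum>i\<in>I. N i) *v v = (\<Sum>i\<in>I. N i *v v)"
    if "finite I" for I :: "nat set" and N and v :: "complex^'n"
    using that by induction (simp_all add: matrix_vector_mult_add_rdistrib)
  show ?thesis
  proof
    have "coeff p j \<noteq> 0"
      using c by (simp add: coeff_p)
    then show "p \<noteq> 0"
      by auto
    fix v
    have "op_poly ((*v) M) p v = (\<Sum>i\<le>?d. c i *\<^sub>R (((**) M ^^ i) (mat 1) *v v))"
      by (simp add: op_poly_altdef[OF deg] coeff_p scale funpow_matrix_vector)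
    also have "\<dots> = (\<Sum>i\<le>?d. c i *\<^sub>R ((**) M ^^ i) (mat 1)) *v v"
      by (simp add: sum_mv scale')
    finally show "op_poly ((*v) M) p v = 0"
      unfolding c(3) by simp
  qed
qed

lemma poly_linear_factor_exists:
  fixes p :: "complex poly"
  assumes "degree p = Suc n"
  obtains r q where "p = [:-r, 1:] * q" "degree q = n"
proof -
  have "\<not> constant (poly p)"
    using assms by (simp add: constant_degree)
  then obtain r where "poly p r = 0"
    using fundamental_theorem_of_algebra by blast
  then obtain q where q: "p = [:-r, 1:] * q"
    by (metis dvdE poly_eq_0_iff_dvd)
  with assms have "q \<noteq> 0"
    by auto
  then have "degree p = Suc (degree q)"
    unfolding q by (subst degree_mult_eq) auto
  with q assms show ?thesis
    using that by simp
qed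

text \<open>Split the annihilating polynomial into linear factors; the first factor that sends a nonzero
  vector to zero yields an eigenvector.\<close>

lemma eigenvalue_of_annihilating_poly:
  fixes M :: "real^'n^'n"
  assumes "op_poly ((*v) (cmat M)) p v = 0" "v \<noteq> 0" "p \<noteq> 0"
  shows "eigenvalues M \<noteq> {}"
  using assms
proof (induction "degree p" arbitrary: p v)
  case 0
  then obtain a where "p = [:a:]" "a \<noteq> 0"
    by (metis degree_eq_zeroE pCons_0_0)
  with 0 show ?case
    by (simp add: op_poly_pCons)
next
  case (Suc n)
  from Suc.hyps(2)[symmetric] obtain r q where q: "p = [:-r, 1:] * q" "degree q = n"
    by (rule poly_linear_factor_exists)
  with Suc.prems have "q \<noteq> 0"
    by auto
  show ?case
  proof (cases "cmat M *v v = r *s v")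
    case True
    with \<open>v \<noteq> 0\<close> show ?thesis
      unfolding eigenvalues_def by blast
  next
    case False
    with Suc.prems(1) show ?thesis
      unfolding q(1) op_poly_linear_factor(1)
      by (intro Suc.hyps(1)[of q]) (use q \<open>q \<noteq> 0\<close> in auto)
  qed
qed

lemma eigenvalues_nonempty: "eigenvalues (M :: real^'n^'n) \<noteq> {}"
proof -
  obtain p where "p \<noteq> 0" "\<And>v. op_poly ((*v) (cmat M)) p v = 0"
    using annihilating_poly_exists[of "cmat M"] by blast
  moreover have "(1 :: complex^'n) \<noteq> 0"
    by simp
  ultimately show ?thesis
    using eigenvalue_of_annihilating_poly by blast
qed

lemma funpow_eigenvector:
  assumes "N *v v = \<mu> *s v"
  shows "((*v) N ^^ i) v = \<mu> ^ i *s (v :: complex^'n)"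
  by (induction i) (auto simp: assms vector_scalar_commute mult.commute)

text \<open>Every eigenvalue is a root of an annihilating polynomial.\<close>

lemma finite_eigenvalues: "finite (eigenvalues M)"
proof -
  obtain p where p: "p \<noteq> 0" "\<And>v. op_poly ((*v) (cmat M)) p v = 0"
    using annihilating_poly_exists[of "cmat M"] by blast
  have "eigenvalues M \<subseteq> {\<mu>. poly p \<mu> = 0}"
  proof
    fix \<mu> assume "\<mu> \<in> eigenvalues M"
    then obtain v where v: "v \<noteq> 0" "cmat M *v v = \<mu> *s v"
      unfolding eigenvalues_def by blast
    have "op_poly ((*v) (cmat M)) p v = poly p \<mu> *s v"
      by (simp add: op_poly_def funpow_eigenvector[OF v(2)] poly_altdef vec.scale_sum_left)
    with p v show "\<mu> \<in> {\<mu>. poly p \<mu> = 0}"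
      by simp
  qed
  then show ?thesis
    using p(1) poly_roots_finite finite_subset by blast
qed

lemma spectral_radius_less_iff: "spectral_radius M < g \<longleftrightarrow> (\<forall>\<mu>\<in>eigenvalues M. cmod \<mu> < g)"
  unfolding spectral_radius_eq using finite_eigenvalues[of M] eigenvalues_nonempty[of M]
  by (subst Max_less_iff) auto

lemma spectral_radius_nonneg: "0 \<le> spectral_radius M"
  using spectral_radius_less_iff[of M 0] eigenvalues_nonempty[of M]
  by (metis ex_in_conv norm_ge_zero not_le)

text \<open>Induction over the linear factors of a polynomial that annihilates \<open>v\<close>. A root \<open>r\<close> with
  \<open>cmod r < g\<close> gives \<open>M\<^sup>k\<^sup>+\<^sup>1 v = r M\<^sup>k v + M\<^sup>k w\<close> with \<open>w = M v - r v\<close>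
  annihilated by the smaller polynomial, and the scalar recursion with ratio \<open>cmod r\<close> keeps the rate
  \<open>g\<close> because the inequality is strict. Any other root is not an eigenvalue and its factor is injective,
  so it can be cancelled.\<close>

lemma complex_growth_bound:
  fixes M :: "real^'n^'n"
  assumes "\<And>\<mu>. \<mu> \<in> eigenvalues M \<Longrightarrow> cmod \<mu> < g"
    and "op_poly ((*v) (cmat M)) p v = 0" "p \<noteq> 0"
  shows "\<exists>C\<ge>0. \<forall>k. norm (((*v) (cmat M) ^^ k) v) \<le> C * g ^ k"
  using assms(2,3)
proof (induction "degree p" arbitrary: p v)
  case 0
  then obtain a where "p = [:a:]" "a \<noteq> 0"
    by (metis degree_eq_zeroE pCons_0_0)
  with 0 have "v = 0"
    by (simp add: op_poly_pCons)
  then have "((*v) (cmat M) ^^ k) v = 0" for k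
    by (induction k) auto
  then show ?case
    by (intro exI[of _ 0]) auto
next
  case (Suc n)
  from Suc.hyps(2)[symmetric] obtain r q where q: "p = [:-r, 1:] * q" "degree q = n"
    by (rule poly_linear_factor_exists)
  with Suc.prems have "q \<noteq> 0"
    by auto
  show ?case
  proof (cases "cmod r < g")
    case True
    let ?w = "cmat M *v v - r *s v" and ?x = "\<lambda>k. ((*v) (cmat M) ^^ k) v"
    have "op_poly ((*v) (cmat M)) q ?w = 0"
      using Suc.prems(1) unfolding q(1) op_poly_linear_factor(1) .
    with Suc.hyps(1)[of q ?w] q \<open>q \<noteq> 0\<close>
    obtain C where C: "C \<ge> 0" "\<And>k. norm (((*v) (cmat M) ^^ k) ?w) \<le> C * g ^ k"
      by auto
    have g: "g > 0"
      using True norm_ge_zero[of r] by linarith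
    define C' where "C' = max (norm v) (C / (g - cmod r))"
    have "norm (?x k) \<le> C' * g ^ k" for k
    proof (induction k)
      case 0
      then show ?case
        by (simp add: C'_def)
    next
      case (Suc k)
      have "?x (Suc k) = r *s ?x k + ((*v) (cmat M) ^^ k) ?w"
        by (simp add: funpow_matrix_diff funpow_matrix_scale funpow_swap1)
      then have "norm (?x (Suc k)) \<le> cmod r * norm (?x k) + C * g ^ k"
        using norm_triangle_ineq[of "r *s ?x k" "((*v) (cmat M) ^^ k) ?w"] C(2)[of k]
        by (simp add: norm_scalar_mult)
      also have "\<dots> \<le> cmod r * (C' * g ^ k) + C' * (g - cmod r) * g ^ k"
      proof (intro add_mono mult_left_mono mult_right_mono)
        have "C / (g - cmod r) \<le> C'"
          by (simp add: C'_def)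
        then show "C \<le> C' * (g - cmod r)"
          using True by (simp add: divide_le_eq)
      qed (use Suc g in auto)
      also have "\<dots> = C' * g ^ Suc k"
        by (simp add: algebra_simps)
      finally show ?case .
    qed
    moreover have "C' \<ge> 0"
      by (simp add: C'_def le_max_iff_disj)
    ultimately show ?thesis
      by blast
  next
    case False
    have "op_poly ((*v) (cmat M)) q v = 0"
    proof (rule ccontr)
      assume "op_poly ((*v) (cmat M)) q v \<noteq> 0"
      moreover have "cmat M *v op_poly ((*v) (cmat M)) q v = r *s op_poly ((*v) (cmat M)) q v"
        using Suc.prems unfolding q(1) op_poly_linear_factor(2) by simp
      ultimately have "r \<in> eigenvalues M"
        unfolding eigenvalues_def by blast
      with assms(1) False show False
        by blast
    qed
    then show ?thesis
      using Suc.hyps(1) q(2) \<open>q \<noteq> 0\<close> by blast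
  qed
qed

definition complex_vec :: "real^'n \<Rightarrow> real^'n \<Rightarrow> complex^'n" where
  "complex_vec x y = (\<chi> i. Complex (x $ i) (y $ i))"

text \<open>Real and imaginary parts let facts about complex eigenvectors be read off the action on
  real vectors.\<close>

lemma complex_vec_cases:
  obtains x y where "v = complex_vec x y"
proof
  show "v = complex_vec (\<chi> i. Re (v $ i)) (\<chi> i. Im (v $ i))"
    by (simp add: complex_vec_def vec_eq_iff)
qed

lemma complex_vec_eq_iff [simp]: "complex_vec x y = complex_vec x' y' \<longleftrightarrow> x = x' \<and> y = y'"
  by (auto simp: complex_vec_def vec_eq_iff)

lemma complex_vec_eq_0_iff [simp]: "complex_vec x y = 0 \<longleftrightarrow> x = 0 \<and> y = 0"
  by (auto simp: complex_vec_def vec_eq_iff complex_eq_iff)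

lemma cmat_mult_complex_vec: "cmat M *v complex_vec x y = complex_vec (M *v x) (M *v y)"
  by (simp add: cmat_def complex_vec_def vec_eq_iff matrix_vector_mult_def complex_eq_iff
      Re_sum Im_sum)

lemma scale_complex_vec:
  "\<mu> *s complex_vec x y =
    complex_vec (Re \<mu> *\<^sub>R x - Im \<mu> *\<^sub>R y) (Re \<mu> *\<^sub>R y + Im \<mu> *\<^sub>R x)"
  by (simp add: complex_vec_def vec_eq_iff complex_eq_iff)

lemma funpow_cmat_complex_vec:
  "((*v) (cmat M) ^^ k) (complex_vec x y) = complex_vec (((*v) M ^^ k) x) (((*v) M ^^ k) y)"
  for M :: "real^'n^'n"
  by (induction k) (auto simp: cmat_mult_complex_vec)

lemma norm_le_complex_vec: "norm x \<le> norm (complex_vec x y)"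
  unfolding norm_vec_def
  by (rule L2_set_mono) (auto simp: complex_vec_def cmod_def real_le_rsqrt)

lemma norm_complex_vec_le: "norm (complex_vec x y) \<le> norm x + norm y"
proof -
  have "norm (complex_vec x y) \<le> L2_set (\<lambda>i. norm (x $ i) + norm (y $ i)) UNIV"
    unfolding norm_vec_def
    by (rule L2_set_mono) (auto simp: complex_vec_def intro: order_trans[OF cmod_le])
  also have "\<dots> \<le> norm x + norm y"
    unfolding norm_vec_def by (rule L2_set_triangle_ineq)
  finally show ?thesis .
qed

lemma eigenvalue_iff:
  "\<mu> \<in> eigenvalues M \<longleftrightarrow>
    (\<exists>x y. (x \<noteq> 0 \<or> y \<noteq> 0) \<and> M *v x = Re \<mu> *\<^sub>R x - Im \<mu> *\<^sub>R y \<and> M *v y = Re \<mu> *\<^sub>R y + Im \<mu> *\<^sub>R x)"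
  unfolding eigenvalues_def mem_Collect_eq
proof (intro iffI; elim exE conjE)
  fix v assume v: "v \<noteq> 0" "cmat M *v v = \<mu> *s v"
  obtain x y where "v = complex_vec x y"
    by (rule complex_vec_cases)
  with v show "\<exists>x y. (x \<noteq> 0 \<or> y \<noteq> 0) \<and> M *v x = Re \<mu> *\<^sub>R x - Im \<mu> *\<^sub>R y \<and>
      M *v y = Re \<mu> *\<^sub>R y + Im \<mu> *\<^sub>R x"
    by (auto simp: cmat_mult_complex_vec scale_complex_vec)
next
  fix x y
  assume "x \<noteq> 0 \<or> y \<noteq> 0" "M *v x = Re \<mu> *\<^sub>R x - Im \<mu> *\<^sub>R y" "M *v y = Re \<mu> *\<^sub>R y + Im \<mu> *\<^sub>R x"
  then show "\<exists>v. v \<noteq> 0 \<and> cmat M *v v = \<mu> *s v"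
    by (intro exI[of _ "complex_vec x y"]) (auto simp: cmat_mult_complex_vec scale_complex_vec)
qed

lemma funpow_matrix_linear: "linear ((*v) M ^^ k)" for M :: "real^'n^'n"
  by (induction k) (auto intro: linearI linear_compose[OF _ matrix_vector_mul_linear, unfolded o_def])

text \<open>The strict gap between spectral radius and \<open>g\<close> absorbs the polynomial factors that Jordan blocks
  cause. Bounds at the vectors of a basis give a bound uniform in \<open>x\<close> by linearity.\<close>

lemma power_bound_of_spectral_radius:
  fixes M :: "real^'n^'n"
  assumes "spectral_radius M < g"
  obtains C where "C \<ge> 1" "\<And>k x. norm (((*v) M ^^ k) x) \<le> C * g ^ k * norm x"
proof -
  have g: "g > 0"
    using assms spectral_radius_nonneg[of M] by linarith
  obtain p where p: "p \<noteq> 0" "\<And>v. op_poly ((*v) (cmat M)) p v = 0"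
    using annihilating_poly_exists[of "cmat M"] by blast
  have "\<exists>C\<ge>0. \<forall>k. norm (((*v) M ^^ k) x) \<le> C * g ^ k" for x
  proof -
    obtain C where "C \<ge> 0" "\<And>k. norm (((*v) (cmat M) ^^ k) (complex_vec x 0)) \<le> C * g ^ k"
      using complex_growth_bound[of M g p "complex_vec x 0"] p assms
      by (auto simp: spectral_radius_less_iff)
    then show ?thesis
      unfolding funpow_cmat_complex_vec using norm_le_complex_vec order_trans by blast
  qed
  then obtain C where C: "\<And>x. C x \<ge> 0" "\<And>x k. norm (((*v) M ^^ k) x) \<le> C x * g ^ k"
    by metis
  define C' where "C' = 1 + (\<Sum>b\<in>Basis. C (b :: real^'n))"
  have C'1: "C' \<ge> 1"
    unfolding C'_def using C(1) by (simp add: sum_nonneg)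
  have "norm (((*v) M ^^ k) x) \<le> C' * g ^ k * norm x" for k x
  proof -
    interpret linear "(*v) M ^^ k"
      by (rule funpow_matrix_linear)
    have "((*v) M ^^ k) x = (\<Sum>b\<in>Basis. (x \<bullet> b) *\<^sub>R ((*v) M ^^ k) b)"
      by (subst (1) euclidean_representation[symmetric]) (simp only: sum scale)
    then have "norm (((*v) M ^^ k) x) \<le> (\<Sum>b\<in>Basis. norm x * (C b * g ^ k))"
      by (auto intro!: sum_norm_le mult_mono C Basis_le_norm)
    also have "\<dots> \<le> C' * g ^ k * norm x"
      using g by (simp add: C'_def sum_distrib_left sum_distrib_right algebra_simps)
    finally show ?thesis .
  qed
  with C'1 show ?thesis
    using that by blast
qed

text \<open>On an eigenvector the powers grow like \<open>cmod \<mu> ^ k\<close>, which decay of the real powers forces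
  to zero.\<close>

lemma spectral_radius_less_1_of_power_bound:
  fixes M :: "real^'n^'n"
  assumes bound: "\<And>k x. norm (((*v) M ^^ k) x) \<le> C * \<theta> ^ k * norm x" and "0 \<le> \<theta>" "\<theta> < 1"
  shows "spectral_radius M < 1"
  unfolding spectral_radius_less_iff
proof
  fix \<mu> assume "\<mu> \<in> eigenvalues M"
  then obtain v where v: "v \<noteq> 0" "cmat M *v v = \<mu> *s v"
    unfolding eigenvalues_def by blast
  obtain x y where xy: "v = complex_vec x y"
    by (rule complex_vec_cases)
  have le: "cmod \<mu> ^ k * norm v \<le> C * (norm x + norm y) * \<theta> ^ k" for k
  proof -
    have "cmod \<mu> ^ k * norm v = norm (((*v) (cmat M) ^^ k) v)"
      by (simp add: funpow_eigenvector[OF v(2)] norm_scalar_mult norm_power)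
    also have "\<dots> \<le> norm (((*v) M ^^ k) x) + norm (((*v) M ^^ k) y)"
      unfolding xy funpow_cmat_complex_vec by (rule norm_complex_vec_le)
    also have "\<dots> \<le> C * (norm x + norm y) * \<theta> ^ k"
      using bound[of k x] bound[of k y] by (simp add: algebra_simps)
    finally show ?thesis .
  qed
  show "cmod \<mu> < 1"
  proof (rule ccontr)
    assume "\<not> cmod \<mu> < 1"
    then have "norm v \<le> C * (norm x + norm y) * \<theta> ^ k" for k
      using le[of k] mult_right_mono[of 1 "cmod \<mu> ^ k" "norm v"] by simp
    moreover have "(\<lambda>k. C * (norm x + norm y) * \<theta> ^ k) \<longlonglongrightarrow> C * (norm x + norm y) * 0"
      using assms(2,3) by (intro tendsto_intros LIMSEQ_power_zero) auto
    ultimately have "norm v \<le> 0"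
      by (intro LIMSEQ_le_const) auto
    with v(1) show False
      by simp
  qed
qed

section \<open>Adapted norms, perturbed recursions and matrix facts\<close>

text \<open>The norm \<open>N x = sup\<^sub>k |F\<^sup>k x| / g\<^sup>k\<close> turns the asymptotic rate \<open>g\<close> into a
  one-step contraction. It is comparable to the original norm with the very constant \<open>M\<close> of the power
  bound, which the explicit window estimate relies on.\<close>

lemma adapted_norm_exists:
  fixes F :: "'a::real_normed_vector \<Rightarrow> 'a"
  assumes F: "linear F" and g: "g > 0"
    and bound: "\<And>k x. norm ((F ^^ k) x) \<le> M * g ^ k * norm x"
  obtains N :: "'a \<Rightarrow> real" where "\<And>x. norm x \<le> N x" "\<And>x. N x \<le> M * norm x"
    "\<And>x y. N (x + y) \<le> N x + N y" "\<And>x. N (F x) \<le> g * N x"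
proof
  define N where "N = (\<lambda>x. SUP k. norm ((F ^^ k) x) / g ^ k)"
  have le: "norm ((F ^^ k) x) / g ^ k \<le> M * norm x" for k x
    using bound[of k x] g by (simp add: divide_le_eq mult_ac)
  then have bdd: "bdd_above (range (\<lambda>k. norm ((F ^^ k) x) / g ^ k))" for x
    by (intro bdd_aboveI[of _ "M * norm x"]) auto
  have upper: "norm ((F ^^ k) x) / g ^ k \<le> N x" for k x
    unfolding N_def by (rule cSUP_upper[OF _ bdd]) simp
  show "norm x \<le> N x" for x
    using upper[of 0 x] by simp
  show "N x \<le> M * norm x" for x
    unfolding N_def by (rule cSUP_least) (use le in auto)
  have add: "(F ^^ k) (x + y) = (F ^^ k) x + (F ^^ k) y" for k x y
    by (induction k) (auto simp: linear_add[OF F])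
  show "N (x + y) \<le> N x + N y" for x y
    unfolding N_def[of, THEN fun_cong, of "x + y"]
  proof (rule cSUP_least)
    fix k
    have "norm ((F ^^ k) (x + y)) / g ^ k \<le> norm ((F ^^ k) x) / g ^ k + norm ((F ^^ k) y) / g ^ k"
      unfolding add add_divide_distrib[symmetric]
      using g by (intro divide_right_mono norm_triangle_ineq) auto
    also have "\<dots> \<le> N x + N y"
      by (intro add_mono upper)
    finally show "norm ((F ^^ k) (x + y)) / g ^ k \<le> N x + N y" .
  qed simp
  show "N (F x) \<le> g * N x" for x
    unfolding N_def[of, THEN fun_cong, of "F x"]
  proof (rule cSUP_least)
    fix k
    have "norm ((F ^^ k) (F x)) / g ^ k = g * (norm ((F ^^ Suc k) x) / g ^ Suc k)"
      using g by (simp add: funpow_swap1)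
    also have "\<dots> \<le> g * N x"
      using g by (intro mult_left_mono upper) auto
    finally show "norm ((F ^^ k) (F x)) / g ^ k \<le> g * N x" .
  qed simp
qed

text \<open>Linear dependence on initial state and disturbance with one constant \<open>c\<close>; a predicate, so that
  the same \<open>c\<close> can be asked of a whole family of systems.\<close>

definition bounded_response :: "('a::real_normed_vector \<Rightarrow> 'a) \<Rightarrow> real \<Rightarrow> bool" where
  "bounded_response F c \<longleftrightarrow>
     (\<forall>x b \<beta> n. 0 \<le> \<beta> \<and> (\<forall>i<n. x (Suc i) = F (x i) + b i \<and> norm (b i) \<le> \<beta>) \<longrightarrow>
        norm (x n) \<le> c * (norm (x (0::nat)) + \<beta>))"

lemma bounded_response_mono:
  assumes "bounded_response F c" "c \<le> c'"
  shows "bounded_response F c'"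
  unfolding bounded_response_def
proof (intro allI impI)
  fix x b \<beta> n
  assume *: "0 \<le> \<beta> \<and> (\<forall>i<n. x (Suc i) = F (x i) + b i \<and> norm (b i) \<le> \<beta>)"
  then have "norm (x n) \<le> c * (norm (x 0) + \<beta>)"
    using assms(1) unfolding bounded_response_def by blast
  also have "\<dots> \<le> c' * (norm (x 0) + \<beta>)"
    using * assms(2) by (intro mult_right_mono) auto
  finally show "norm (x n) \<le> c' * (norm (x 0) + \<beta>)" .
qed

text \<open>A perturbation of size \<open>\<epsilon>\<close> costs at most \<open>M * \<epsilon>\<close> in the contraction factor.\<close>

lemma perturbed_adapted_norm:
  fixes M0 E :: "real^'n^'n"
  assumes bound: "\<And>k x. norm (((*v) M0 ^^ k) x) \<le> M * g ^ k * norm x" and g: "g > 0"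
    and E: "\<And>x. norm (E *v x) \<le> \<epsilon> * norm x" and M: "M \<ge> 0"
  obtains N :: "real^'n \<Rightarrow> real" where "\<And>x. norm x \<le> N x" "\<And>x. N x \<le> M * norm x"
    "\<And>x y. N (x + y) \<le> N x + N y" "\<And>x. N ((M0 + E) *v x) \<le> (g + M * \<epsilon>) * N x"
proof -
  obtain N where N: "\<And>x. norm x \<le> N x" "\<And>x. N x \<le> M * norm x"
    "\<And>x y. N (x + y) \<le> N x + N y" "\<And>x. N (M0 *v x) \<le> g * N x"
    using adapted_norm_exists[OF matrix_vector_mul_linear g bound] by metis
  have \<epsilon>: "\<epsilon> \<ge> 0"
    using order_trans[OF norm_ge_zero E[of 1]] by (simp add: zero_le_mult_iff)
  have "N ((M0 + E) *v x) \<le> (g + M * \<epsilon>) * N x" for x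
  proof -
    have "N ((M0 + E) *v x) \<le> N (M0 *v x) + N (E *v x)"
      unfolding matrix_vector_mult_add_rdistrib by (rule N)
    also have "N (E *v x) \<le> M * (\<epsilon> * norm x)"
      by (rule order_trans[OF N(2) mult_left_mono[OF E M]])
    also have "M * (\<epsilon> * norm x) \<le> M * (\<epsilon> * N x)"
      using M \<epsilon> by (intro mult_left_mono N) auto
    finally show ?thesis
      using N(4)[of x] by (simp add: algebra_simps)
  qed
  with N show ?thesis
    by (intro that[of N]) auto
qed

lemma bounded_response_perturbed:
  fixes M0 E :: "real^'n^'n"
  assumes bound: "\<And>k x. norm (((*v) M0 ^^ k) x) \<le> M * g ^ k * norm x" and g: "g > 0"
    and E: "\<And>x. norm (E *v x) \<le> \<epsilon> * norm x" and M: "M \<ge> 0"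
    and \<theta>: "g + M * \<epsilon> \<le> \<theta>" "\<theta> < 1"
  shows "bounded_response ((*v) (M0 + E)) (M / (1 - \<theta>))"
proof -
  obtain N where N: "\<And>x. norm x \<le> N x" "\<And>x. N x \<le> M * norm x"
    "\<And>x y. N (x + y) \<le> N x + N y" "\<And>x. N ((M0 + E) *v x) \<le> (g + M * \<epsilon>) * N x"
    using perturbed_adapted_norm[OF bound g E M] by metis
  have N0: "0 \<le> N x" for x
    by (rule order_trans[OF norm_ge_zero N(1)])
  have N\<theta>: "N ((M0 + E) *v x) \<le> \<theta> * N x" for x
    by (rule order_trans[OF N(4) mult_right_mono[OF \<theta>(1) N0]])
  have \<theta>0: "\<theta> \<ge> 0"
    using E[of 1] N\<theta>[of 1] N0 N(1)[of 1] norm_ge_zero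
    by (smt (verit) mult_neg_pos norm_eq_zero one_neq_zero)
  show ?thesis
    unfolding bounded_response_def
  proof (intro allI impI)
    fix x b \<beta> n
    assume *: "0 \<le> \<beta> \<and> (\<forall>i<n. x (Suc i) = (M0 + E) *v x i + b i \<and> norm (b i) \<le> \<beta>)"
    have "N (x i) \<le> N (x 0) + M * \<beta> / (1 - \<theta>)" if "i \<le> n" for i
      using that
    proof (induction i)
      case 0
      then show ?case
        using * M \<theta> by simp
    next
      case (Suc i)
      have "N (x (Suc i)) \<le> \<theta> * N (x i) + M * \<beta>"
        using * Suc.prems N(3)[of "(M0 + E) *v x i" "b i"] N\<theta>[of "x i"] N(2)[of "b i"]
          mult_left_mono[of "norm (b i)" \<beta> M] M
        by fastforce
      also have "\<dots> \<le> \<theta> * (N (x 0) + M * \<beta> / (1 - \<theta>)) + M * \<beta>"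
        using Suc \<theta>0 by simp (intro mult_left_mono; simp)
      also have "\<dots> = \<theta> * N (x 0) + M * \<beta> / (1 - \<theta>)"
        using \<theta>(2) by (simp add: field_simps)
      also have "\<dots> \<le> N (x 0) + M * \<beta> / (1 - \<theta>)"
        using \<theta>(2) N0[of "x 0"] mult_right_mono[of \<theta> 1 "N (x 0)"] by simp
      finally show ?case .
    qed
    then have "norm (x n) \<le> M * norm (x 0) + M * \<beta> / (1 - \<theta>)"
      using N(1)[of "x n"] N(2)[of "x 0"] by fastforce
    also have "M * norm (x 0) \<le> M / (1 - \<theta>) * norm (x 0)"
      using M \<theta>(2) \<theta>0 by (intro mult_right_mono) (auto simp: le_divide_eq mult_left_le)
    finally show "norm (x n) \<le> M / (1 - \<theta>) * (norm (x 0) + \<beta>)"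
      by (simp add: algebra_simps add_divide_distrib)
  qed
qed

lemma spectral_radius_perturbed:
  fixes M0 E :: "real^'n^'n"
  assumes bound: "\<And>k x. norm (((*v) M0 ^^ k) x) \<le> M * g ^ k * norm x" and g: "g > 0"
    and E: "\<And>x. norm (E *v x) \<le> \<epsilon> * norm x" and M: "M \<ge> 0" and \<theta>: "g + M * \<epsilon> < 1" "\<epsilon> \<ge> 0"
  shows "spectral_radius (M0 + E) < 1"
proof -
  obtain N where N: "\<And>x. norm x \<le> N x" "\<And>x. N x \<le> M * norm x"
    "\<And>x y. N (x + y) \<le> N x + N y" "\<And>x. N ((M0 + E) *v x) \<le> (g + M * \<epsilon>) * N x"
    using perturbed_adapted_norm[OF bound g E M] by metis
  let ?\<theta> = "g + M * \<epsilon>"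
  have \<theta>0: "?\<theta> \<ge> 0"
    using g M \<theta> by simp
  have "norm (((*v) (M0 + E) ^^ k) x) \<le> M * ?\<theta> ^ k * norm x" for k x
  proof -
    have "N (((*v) (M0 + E) ^^ k) x) \<le> ?\<theta> ^ k * N x"
    proof (induction k)
      case (Suc k)
      have "N (((*v) (M0 + E) ^^ Suc k) x) \<le> ?\<theta> * N (((*v) (M0 + E) ^^ k) x)"
        using N(4) by simp
      also have "\<dots> \<le> ?\<theta> * (?\<theta> ^ k * N x)"
        by (rule mult_left_mono[OF Suc \<theta>0])
      finally show ?case
        by (simp add: mult_ac)
    qed simp
    also have "\<dots> \<le> ?\<theta> ^ k * (M * norm x)"
      using \<theta>0 by (intro mult_left_mono N) auto
    finally show ?thesis
      using N(1) order_trans by (fastforce simp: mult_ac)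
  qed
  then show ?thesis
    using \<theta> \<theta>0 by (intro spectral_radius_less_1_of_power_bound)
qed

text \<open>Affine recursions with time-varying factors are bounded as soon as the factors tend to a limit
  below 1: finitely many early factors may exceed 1. The solution \<open>m\<close> serves as a majorant for families
  of recursions that share the factors.\<close>

lemma bounded_recursion:
  fixes \<theta> :: "nat \<Rightarrow> real"
  assumes \<theta>: "\<And>k. \<theta> k \<ge> 0" "\<theta> \<longlonglongrightarrow> L" "L < 1" and c: "c \<ge> 0"
  obtains m C where "m 0 = \<beta>" "\<And>k. m (Suc k) = \<theta> k * m k + c" "\<And>k. m k \<le> C" "C \<ge> 0"
proof -
  define m where "m = rec_nat \<beta> (\<lambda>k x. \<theta> k * x + c)"
  have m: "m 0 = \<beta>" "m (Suc k) = \<theta> k * m k + c" for k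
    by (simp_all add: m_def)
  have "\<forall>\<^sub>F k in sequentially. \<theta> k < (1 + L) / 2"
    using \<theta>(3) by (intro order_tendstoD(2)[OF \<theta>(2)]) simp
  then obtain K where K: "\<And>k. k \<ge> K \<Longrightarrow> \<theta> k < (1 + L) / 2"
    unfolding eventually_sequentially by blast
  define \<eta> where "\<eta> = (1 + L) / 2"
  have \<eta>: "\<eta> < 1"
    using \<theta>(3) by (simp add: \<eta>_def)
  define C where "C = max (Max (m ` {..K})) (c / (1 - \<eta>))"
  have C: "c / (1 - \<eta>) \<le> C" and Cm: "k \<le> K \<Longrightarrow> m k \<le> C" for k
    by (auto simp: C_def le_max_iff_disj)
  have C0: "C \<ge> 0"
    using C c \<eta> by (meson diff_gt_0_iff_gt divide_nonneg_pos order_trans)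
  have "m k \<le> C" if "k \<ge> K" for k
    using that
  proof (induction k rule: dec_induct)
    case base
    then show ?case by (simp add: Cm)
  next
    case (step k)
    have "m (Suc k) \<le> \<theta> k * C + c"
      unfolding m using step.IH \<theta>(1) by (intro add_mono mult_left_mono) auto
    also have "\<dots> \<le> \<eta> * C + (1 - \<eta>) * C"
      using K[of k] step.hyps C0 C \<eta>
      by (intro add_mono mult_right_mono) (auto simp: \<eta>_def[symmetric] divide_le_eq mult.commute)
    finally show ?case
      by (simp add: algebra_simps)
  qed
  with Cm have "m k \<le> C" for k
    by (cases "k \<le> K") auto
  with m C0 show ?thesis
    using that by blast
qed

lemma inner_transpose: "x \<bullet> (transpose M *v y) = (M *v x) \<bullet> y" for M :: "real^'n^'m"
  by (metis dot_lmul_matrix inner_commute transpose_matrix_vector)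

lemma matrix_bound_exists:
  fixes M :: "real^'n^'m"
  obtains c where "c \<ge> 0" "\<And>x. norm (M *v x) \<le> c * norm x"
  using onorm[OF matrix_vector_mul_bounded_linear, of M] onorm_pos_le[OF matrix_vector_mul_bounded_linear, of M]
  by blast

lemma adjoint_bound:
  fixes F :: "'a::real_inner \<Rightarrow> 'b::real_inner"
  assumes adj: "\<And>x. x \<bullet> G y = F x \<bullet> y" and F: "\<And>x. norm (F x) \<le> c * norm x" and c: "c \<ge> 0"
  shows "norm (G y) \<le> c * norm y"
proof (cases "G y = 0")
  case False
  have "norm (G y) * norm (G y) = F (G y) \<bullet> y"
    by (simp add: dot_square_norm power2_eq_square flip: adj)
  also have "\<dots> \<le> norm (F (G y)) * norm y"
    by (rule norm_cauchy_schwarz)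
  also have "\<dots> \<le> c * norm (G y) * norm y"
    by (intro mult_right_mono F) auto
  finally have "norm (G y) * norm (G y) \<le> norm (G y) * (c * norm y)"
    by (simp add: mult_ac)
  with False show ?thesis
    by (simp add: mult_le_cancel_left)
qed (use c in simp)

lemma transpose_bound:
  fixes M :: "real^'n^'m"
  assumes "\<And>x. norm (M *v x) \<le> c * norm x" "c \<ge> 0"
  shows "norm (transpose M *v y) \<le> c * norm y"
  by (rule adjoint_bound[OF inner_transpose assms])

lemma transpose_power_bound:
  fixes M :: "real^'n^'n"
  assumes "\<And>x. norm (((*v) M ^^ k) x) \<le> c * norm x" "c \<ge> 0"
  shows "norm (((*v) (transpose M) ^^ k) y) \<le> c * norm y"
proof (rule adjoint_bound[OF _ assms])
  show "x \<bullet> ((*v) (transpose M) ^^ k) y = ((*v) M ^^ k) x \<bullet> y" for x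
    by (induction k arbitrary: x) (auto simp: inner_transpose funpow_swap1[of "(*v) M"])
qed

text \<open>Otherwise moving from \<open>x\<close> a short way against \<open>Q x\<close> would make the form negative.\<close>

lemma psd_form_zero:
  assumes Q: "psd Q" and x: "x \<bullet> (Q *v x) = 0"
  shows "Q *v x = 0"
proof -
  let ?y = "Q *v x"
  have sym: "x \<bullet> (Q *v ?y) = ?y \<bullet> ?y"
    using inner_transpose[of x Q ?y] Q by (simp add: psd_def)
  define a where "a = ?y \<bullet> (Q *v ?y)"
  have a: "a \<ge> 0"
    using Q by (simp add: a_def psd_def)
  have *: "0 \<le> 2 * t * (?y \<bullet> ?y) + t\<^sup>2 * a" for t
  proof -
    have "0 \<le> (x + t *\<^sub>R ?y) \<bullet> (Q *v (x + t *\<^sub>R ?y))"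
      using Q unfolding psd_def by blast
    also have "\<dots> = 2 * t * (?y \<bullet> ?y) + t\<^sup>2 * a"
      using x sym
      by (simp add: a_def matrix_vector_right_distrib matrix_vector_mult_scaleR inner_add_left
          inner_add_right power2_eq_square algebra_simps)
    finally show ?thesis .
  qed
  have "?y \<bullet> ?y = 0"
  proof (rule ccontr)
    assume "?y \<bullet> ?y \<noteq> 0"
    then have b: "?y \<bullet> ?y > 0"
      by simp
    define s where "s = (?y \<bullet> ?y) / (a + 1)"
    have s: "s > 0" "s * (a + 1) = ?y \<bullet> ?y"
      using a b by (simp_all add: s_def)
    have "s\<^sup>2 * a \<le> s * (s * (a + 1))"
      by (simp add: power2_eq_square algebra_simps)
    then have "s\<^sup>2 * a \<le> s * (?y \<bullet> ?y)"
      unfolding s(2) .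
    moreover have "s * (?y \<bullet> ?y) > 0"
      using s b by simp
    ultimately show False
      using *[of "- s"] by simp
  qed
  then show ?thesis
    by simp
qed

text \<open>The form attains a positive minimum on the compact unit sphere.\<close>

lemma posdef_lower_bound:
  fixes R :: "real^'n^'n"
  assumes "posdef R"
  obtains r where "r > 0" "\<And>x. r * (norm x)\<^sup>2 \<le> x \<bullet> (R *v x)"
proof -
  have "continuous_on (sphere 0 1) (\<lambda>x. x \<bullet> (R *v x))"
    by (intro continuous_intros matrix_vector_mult_linear_continuous_on)
  moreover have "sphere (0::real^'n) 1 \<noteq> {}"
    by simp
  ultimately obtain x0 where x0: "x0 \<in> sphere 0 1"
    "\<And>x. x \<in> sphere 0 1 \<Longrightarrow> x0 \<bullet> (R *v x0) \<le> x \<bullet> (R *v x)"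
    using continuous_attains_inf[OF compact_sphere] by blast
  show ?thesis
  proof
    show "0 < x0 \<bullet> (R *v x0)"
      using assms x0(1) by (metis norm_zero posdef_def mem_sphere_0 zero_neq_one)
    fix x
    show "x0 \<bullet> (R *v x0) * (norm x)\<^sup>2 \<le> x \<bullet> (R *v x)"
    proof (cases "x = 0")
      case False
      then have "x0 \<bullet> (R *v x0) \<le> (x /\<^sub>R norm x) \<bullet> (R *v (x /\<^sub>R norm x))"
        by (intro x0) simp
      also have "\<dots> = (x \<bullet> (R *v x)) / (norm x)\<^sup>2"
        by (simp add: matrix_vector_mult_scaleR power2_eq_square field_simps)
      finally show ?thesis
        using False by (simp add: le_divide_eq)
    qed simp
  qed
qed

lemma matrix_vector_inv:
  fixes S :: "real^'n^'n"
  assumes "\<And>x. S *v x = 0 \<Longrightarrow> x = 0"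
  shows "S *v (matrix_inv S *v x) = x" "matrix_inv S *v (S *v x) = x"
proof -
  have "invertible S"
    using assms matrix_left_invertible_ker[of S] invertible_left_inverse by blast
  then have "S ** matrix_inv S = mat 1 \<and> matrix_inv S ** S = mat 1"
    unfolding invertible_def matrix_inv_def by (rule someI_ex)
  then show "S *v (matrix_inv S *v x) = x" "matrix_inv S *v (S *v x) = x"
    by (simp_all add: matrix_vector_mul_assoc)
qed

text \<open>Gaussian elimination: a row of a full-rank matrix has a nonzero entry; eliminating that column
  leaves a full-rank matrix with one row less whose solutions do not constrain the pivot variable.\<close>

lemma full_row_rank_solvable:
  fixes M :: "'r \<Rightarrow> 'c \<Rightarrow> real"
  assumes "finite I" "finite J" "full_row_rank I J M"
  shows "\<exists>g. \<forall>i\<in>I. (\<Sum>j\<in>J. g j * M i j) = b i"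
  using assms(1,3)
proof (induction I arbitrary: M b)
  case (insert p I)
  have "\<exists>j\<in>J. M p j \<noteq> 0"
  proof (rule ccontr)
    assume "\<not> (\<exists>j\<in>J. M p j \<noteq> 0)"
    then have "\<forall>j\<in>J. (\<Sum>i\<in>insert p I. (if i = p then 1 else 0) * M i j) = 0"
      using insert.hyps by (simp add: if_distrib[of "\<lambda>x. x * _"] sum.delta cong: if_cong)
    then have "(if p = p then 1 else 0) = (0::real)"
      using insert.prems unfolding full_row_rank_def
      by (elim allE[of _ "\<lambda>i. if i = p then 1 else 0"]) auto
    then show False
      by simp
  qed
  then obtain c where c: "c \<in> J" "M p c \<noteq> 0"
    by blast
  define w where "w i = M i c / M p c" for i
  define M' where "M' i j = M i j - w i * M p j" for i j
  have M'c: "M' i c = 0" for i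
    using c by (simp add: M'_def w_def)
  have "full_row_rank I J M'"
    unfolding full_row_rank_def
  proof (intro allI impI)
    fix a assume a: "\<forall>j\<in>J. (\<Sum>i\<in>I. a i * M' i j) = 0"
    define a' where "a' i = (if i = p then - (\<Sum>i\<in>I. a i * w i) else a i)" for i
    have "(\<Sum>i\<in>insert p I. a' i * M i j) = 0" if "j \<in> J" for j
    proof -
      have "(\<Sum>i\<in>I. a' i * M i j) = (\<Sum>i\<in>I. a i * M i j)"
        using insert.hyps by (intro sum.cong) (auto simp: a'_def)
      then have "(\<Sum>i\<in>insert p I. a' i * M i j) = (\<Sum>i\<in>I. a i * M' i j)"
        using insert.hyps
        by (simp add: a'_def M'_def sum_subtractf sum_distrib_left right_diff_distrib mult_ac)
      with a that show ?thesis
        by simp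
    qed
    then have "\<forall>i\<in>insert p I. a' i = 0"
      using insert.prems unfolding full_row_rank_def by blast
    then show "\<forall>i\<in>I. a i = 0"
      using insert.hyps by (auto simp: a'_def split: if_splits)
  qed
  then obtain g where g: "\<And>i. i \<in> I \<Longrightarrow> (\<Sum>j\<in>J. g j * M' i j) = b i - w i * b p"
    using insert.IH[of M' "\<lambda>i. b i - w i * b p"] by blast
  define \<delta> where "\<delta> = (b p - (\<Sum>j\<in>J. g j * M p j)) / M p c"
  define g' where "g' j = g j + (if j = c then \<delta> else 0)" for j
  have g': "(\<Sum>j\<in>J. g' j * m j) = (\<Sum>j\<in>J. g j * m j) + \<delta> * m c" for m
    using c assms(2)
    by (simp add: g'_def distrib_right sum.distrib if_distrib[of "\<lambda>x. x * _"] sum.delta cong: if_cong)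
  have p: "(\<Sum>j\<in>J. g' j * M p j) = b p"
    using c by (simp add: g' \<delta>_def)
  have "(\<Sum>j\<in>J. g' j * M i j) = b i" if "i \<in> I" for i
  proof -
    have "(\<Sum>j\<in>J. g' j * M i j) = (\<Sum>j\<in>J. g' j * M' i j) + w i * (\<Sum>j\<in>J. g' j * M p j)"
      by (simp add: M'_def algebra_simps sum_subtractf sum_distrib_left)
    also have "(\<Sum>j\<in>J. g' j * M' i j) = b i - w i * b p"
      using g[OF that] M'c by (simp add: g')
    finally show ?thesis
      by (simp add: p)
  qed
  with p show ?case
    by blast
qed simp

text \<open>Some iterate \<open>A\<^sup>m e\<close> with \<open>m \<le> CARD('n)\<close> is a combination of the earlier ones, so an output
  invisible for \<open>CARD('n)\<close> steps stays invisible.\<close>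

lemma unobservable_forever:
  fixes A :: "real^'n^'n" and C :: "real^'n^'p"
  assumes "\<And>j. j < CARD('n) \<Longrightarrow> C *v (((*v) A ^^ j) e) = 0"
  shows "C *v (((*v) A ^^ j) e) = 0"
proof -
  let ?w = "\<lambda>j. ((*v) A ^^ j) e"
  obtain c j0 where c: "j0 \<le> DIM(real^'n)" "c j0 \<noteq> 0" "(\<Sum>i\<le>DIM(real^'n). c i *\<^sub>R ?w i) = 0"
    by (rule linear_relation_exists[of ?w])
  define m where "m = Max {i. i \<le> CARD('n) \<and> c i \<noteq> 0}"
  have fin: "finite {i. i \<le> CARD('n) \<and> c i \<noteq> 0}"
    by (rule finite_subset[of _ "{..CARD('n)}"]) auto
  have "m \<in> {i. i \<le> CARD('n) \<and> c i \<noteq> 0}"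
    unfolding m_def using c by (intro Max_in fin) auto
  then have m: "m \<le> CARD('n)" "c m \<noteq> 0"
    by auto
  have above: "c i = 0" if "m < i" "i \<le> CARD('n)" for i
    using Max_ge[OF fin, of i] that unfolding m_def[symmetric] by auto
  have "(\<Sum>i\<le>CARD('n). c i *\<^sub>R ?w i) = (\<Sum>i\<le>m. c i *\<^sub>R ?w i)"
    by (rule sum.mono_neutral_right) (use m above in auto)
  also have "\<dots> = (\<Sum>i<m. c i *\<^sub>R ?w i) + c m *\<^sub>R ?w m"
    by (simp add: lessThan_Suc_atMost[symmetric])
  finally have rel: "c m *\<^sub>R ?w m = - (\<Sum>i<m. c i *\<^sub>R ?w i)"
    using c(3) by (simp add: eq_neg_iff_add_eq_0 add.commute)
  show ?thesis
  proof (induction j rule: less_induct)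
    case (less j)
    show ?case
    proof (cases "j < m")
      case True
      then show ?thesis
        using m by (intro assms) simp
    next
      case False
      define d where "d = j - m"
      have j: "j = d + m"
        using False by (simp add: d_def)
      interpret lin: linear "\<lambda>x. C *v (((*v) A ^^ d) x)"
        by (rule linear_compose[OF funpow_matrix_linear matrix_vector_mul_linear, unfolded o_def])
      have *: "((*v) A ^^ d) (?w i) = ?w (d + i)" for i
        by (simp add: funpow_add)
      have "c m *\<^sub>R (C *v ?w j) = C *v (((*v) A ^^ d) (c m *\<^sub>R ?w m))"
        by (simp add: lin.scale * j)
      also have "\<dots> = - (\<Sum>i<m. c i *\<^sub>R (C *v ?w (d + i)))"
        unfolding rel by (simp add: lin.neg lin.sum lin.scale *)
      also have "\<dots> = 0"
        using less j by simp
      finally show ?thesis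
        using m by simp
    qed
  qed
qed

section \<open>Finite-horizon linear-quadratic tracking\<close>

lemma symmetric_iff: "transpose M = M \<longleftrightarrow> (\<forall>x y. x \<bullet> (M *v y) = (M *v x) \<bullet> y)"
  for M :: "real^'n^'n"
proof
  assume "transpose M = M"
  then show "\<forall>x y. x \<bullet> (M *v y) = (M *v x) \<bullet> y"
    using inner_transpose[of _ M] by simp
next
  assume *: "\<forall>x y. x \<bullet> (M *v y) = (M *v x) \<bullet> y"
  have "x \<bullet> (transpose M *v y - M *v y) = 0" for x y
    using * by (simp add: inner_diff_right inner_transpose)
  then have "transpose M *v y - M *v y = 0" for y
    using inner_eq_zero_iff by blast
  then show "transpose M = M"
    by (simp add: matrix_eq)
qed

lemma psd_symmetric: "psd P \<Longrightarrow> x \<bullet> (P *v y) = (P *v x) \<bullet> y"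
  by (simp add: psd_def symmetric_iff)

lemma psd_nonneg: "psd P \<Longrightarrow> 0 \<le> x \<bullet> (P *v x)"
  by (simp add: psd_def)

abbreviation linear_system :: "real^'n^'n \<Rightarrow> real^'m^'n \<Rightarrow> real^'n \<Rightarrow> real^'m \<Rightarrow> real^'n" where
  "linear_system A B \<equiv> \<lambda>x u. A *v x + B *v u"

locale lq_problem =
  fixes A :: "real^'n^'n" and B :: "real^'m^'n" and Q :: "real^'n^'n" and R :: "real^'m^'m"
  assumes psd_Q: "psd Q" and posdef_R: "posdef R"
begin

text \<open>The Hessian in the current input when the remaining cost is the quadratic form of \<open>P\<close>.\<close>

definition input_weight :: "real^'n^'n \<Rightarrow> real^'m^'m" where
  "input_weight P = R + transpose B ** P ** B"

lemma input_weight_mult: "input_weight P *v u = R *v u + transpose B *v (P *v (B *v u))"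
  by (simp add: input_weight_def matrix_vector_mult_add_rdistrib flip: matrix_vector_mul_assoc)

lemma R_symmetric: "x \<bullet> (R *v y) = (R *v x) \<bullet> y"
  using posdef_R by (simp add: posdef_def symmetric_iff)

lemma R_nonneg: "0 \<le> u \<bullet> (R *v u)"
  using posdef_R by (cases "u = 0") (auto simp: posdef_def less_imp_le)

lemma input_weight_form: "u \<bullet> (input_weight P *v u) = u \<bullet> (R *v u) + (B *v u) \<bullet> (P *v (B *v u))"
  by (simp add: input_weight_mult inner_add_right inner_transpose)

lemma input_weight_symmetric:
  assumes "psd P"
  shows "u \<bullet> (input_weight P *v v) = (input_weight P *v u) \<bullet> v"
proof -
  have "u \<bullet> (transpose B *v (P *v (B *v v))) = (transpose B *v (P *v (B *v u))) \<bullet> v"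
    using assms psd_symmetric inner_transpose by (metis inner_commute)
  then show ?thesis
    by (simp add: input_weight_mult inner_add_right inner_add_left R_symmetric)
qed

lemma R_le_input_weight:
  assumes "psd P"
  shows "u \<bullet> (R *v u) \<le> u \<bullet> (input_weight P *v u)"
  using psd_nonneg[OF assms] by (simp add: input_weight_form)

lemma input_weight_pos:
  assumes "psd P" "u \<noteq> 0"
  shows "0 < u \<bullet> (input_weight P *v u)"
  using posdef_R assms(2) R_le_input_weight[OF assms(1), of u] unfolding posdef_def
  by (meson less_le_trans)

lemma input_weight_inv:
  assumes "psd P"
  shows "input_weight P *v (matrix_inv (input_weight P) *v u) = u"
    "matrix_inv (input_weight P) *v (input_weight P *v u) = u"
proof -
  have "input_weight P *v x = 0 \<Longrightarrow> x = 0" for x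
    using input_weight_pos[OF assms, of x] by auto
  then show "input_weight P *v (matrix_inv (input_weight P) *v u) = u"
    "matrix_inv (input_weight P) *v (input_weight P *v u) = u"
    using matrix_vector_inv[of "input_weight P"] by blast+
qed

lemma input_weight_inv_symmetric:
  assumes "psd P"
  shows "u \<bullet> (matrix_inv (input_weight P) *v v) = (matrix_inv (input_weight P) *v u) \<bullet> v"
  using assms input_weight_inv(1) input_weight_symmetric by metis

lemma riccati_gain_mult:
  "riccati_gain A B R P *v x = matrix_inv (input_weight P) *v (transpose B *v (P *v (A *v x)))"
  by (simp add: riccati_gain_def input_weight_def flip: matrix_vector_mul_assoc)

lemma riccati_map_mult:
  "riccati_map A B Q R P *v x = Q *v x + transpose A *v (P *v (A *v x))
     - transpose A *v (P *v (B *v (matrix_inv (input_weight P) *v (transpose B *v (P *v (A *v x))))))"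
  by (simp add: riccati_map_def input_weight_def matrix_vector_mult_add_rdistrib
      matrix_vector_mult_diff_rdistrib flip: matrix_vector_mul_assoc)

lemma riccati_map_inner:
  assumes "psd P"
  shows "y \<bullet> (riccati_map A B Q R P *v x) = y \<bullet> (Q *v x) + (A *v y) \<bullet> (P *v (A *v x))
    - (transpose B *v (P *v (A *v y))) \<bullet>
      (matrix_inv (input_weight P) *v (transpose B *v (P *v (A *v x))))"
proof -
  have "(A *v y) \<bullet> (P *v (B *v v)) = (transpose B *v (P *v (A *v y))) \<bullet> v" for v
    using psd_symmetric[OF assms] inner_transpose[of v B] by (metis inner_commute)
  then show ?thesis
    by (simp add: riccati_map_mult inner_add_right inner_diff_right inner_transpose)
qed

text \<open>The one-step Bellman computation. The cost after the step has linear part \<open>x \<mapsto> - 2 * (h \<bullet> x)\<close>, and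
  \<open>w\<close> is the deviation of \<open>u\<close> from the minimizing input.\<close>

lemma complete_square:
  fixes h :: "real^'n" and x :: "real^'n" and u :: "real^'m"
  assumes P: "psd P"
  defines "G \<equiv> matrix_inv (input_weight P)"
  defines "w \<equiv> u - (G *v (transpose B *v h) - riccati_gain A B R P *v x)"
  shows "u \<bullet> (R *v u) + (A *v x + B *v u) \<bullet> (P *v (A *v x + B *v u)) - 2 * (h \<bullet> (A *v x + B *v u)) =
    x \<bullet> (riccati_map A B Q R P *v x) - x \<bullet> (Q *v x)
    - 2 * ((transpose (A - B ** riccati_gain A B R P) *v h) \<bullet> x)
    - (transpose B *v h) \<bullet> (G *v (transpose B *v h)) + w \<bullet> (input_weight P *v w)"
proof -
  define a where "a = A *v x"
  define p where "p = transpose B *v (P *v a)"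
  define c where "c = transpose B *v h"
  let ?S = "input_weight P"
  have K: "riccati_gain A B R P *v x = G *v p"
    by (simp add: riccati_gain_mult p_def a_def G_def)
  have w: "w = u + G *v (p - c)"
    by (simp add: w_def K c_def matrix_vector_mult_diff_distrib)
  have SG: "?S *v (G *v v) = v" for v
    unfolding G_def by (rule input_weight_inv[OF P])
  have "w \<bullet> (?S *v w) = u \<bullet> (?S *v u) + 2 * (u \<bullet> (p - c)) + (p - c) \<bullet> (G *v (p - c))"
    using input_weight_symmetric[OF P, of "G *v (p - c)" u]
    by (simp only: w matrix_vector_right_distrib SG inner_add_left inner_add_right)
      (simp add: inner_commute)
  also have "(p - c) \<bullet> (G *v (p - c)) = p \<bullet> (G *v p) - 2 * (c \<bullet> (G *v p)) + c \<bullet> (G *v c)"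
    using input_weight_inv_symmetric[OF P, of p c, folded G_def]
    by (simp add: matrix_vector_mult_diff_distrib inner_diff_left inner_diff_right inner_commute)
  also have "u \<bullet> (?S *v u) = u \<bullet> (R *v u) + (B *v u) \<bullet> (P *v (B *v u))"
    by (rule input_weight_form)
  finally have w2: "w \<bullet> (?S *v w) = u \<bullet> (R *v u) + (B *v u) \<bullet> (P *v (B *v u)) + 2 * (u \<bullet> (p - c))
      + (p \<bullet> (G *v p) - 2 * (c \<bullet> (G *v p)) + c \<bullet> (G *v c))" .
  have up: "u \<bullet> p = a \<bullet> (P *v (B *v u))" "u \<bullet> c = h \<bullet> (B *v u)"
    using psd_symmetric[OF P, of a "B *v u"]
    by (simp_all add: p_def c_def inner_transpose inner_commute)
  have "(transpose (A - B ** riccati_gain A B R P) *v h) \<bullet> x =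
      h \<bullet> (a - B *v (G *v p))"
    by (simp add: inner_commute[of _ x] inner_transpose matrix_vector_mult_diff_rdistrib K a_def
        inner_commute flip: matrix_vector_mul_assoc)
  also have "\<dots> = h \<bullet> a - c \<bullet> (G *v p)"
    using inner_transpose[of "G *v p" B h] by (simp add: inner_diff_right c_def inner_commute)
  finally have cl: "(transpose (A - B ** riccati_gain A B R P) *v h) \<bullet> x = h \<bullet> a - c \<bullet> (G *v p)" .
  have sym: "(B *v u) \<bullet> (P *v a) = a \<bullet> (P *v (B *v u))"
    using psd_symmetric[OF P, of a "B *v u"] by (simp add: inner_commute)
  show ?thesis
    unfolding w2 cl riccati_map_inner[OF P] p_def[symmetric] a_def[symmetric] c_def[symmetric]
      G_def[symmetric]
    by (simp add: matrix_vector_right_distrib inner_add_left inner_add_right inner_diff_right up sym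
        algebra_simps)
qed

text \<open>This form of the Riccati map shows positivity, and unlike the definition it involves no inverse
  besides the gain, so it passes to the limit once values and gains converge.\<close>

lemma riccati_map_joseph:
  assumes P: "psd P"
  defines "K \<equiv> riccati_gain A B R P"
  shows "x \<bullet> (riccati_map A B Q R P *v x) = x \<bullet> (Q *v x) + (K *v x) \<bullet> (R *v (K *v x))
    + ((A - B ** K) *v x) \<bullet> (P *v ((A - B ** K) *v x))"
proof -
  have "(A - B ** K) *v x = A *v x + B *v (- (K *v x))"
    by (simp add: matrix_vector_mult_diff_rdistrib linear_neg[OF matrix_vector_mul_linear]
        flip: matrix_vector_mul_assoc)
  then show ?thesis
    using complete_square[OF P, of "- (K *v x)" x 0]
    by (simp add: K_def linear_neg[OF matrix_vector_mul_linear] linear_0[OF matrix_vector_mul_linear])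
qed

lemma psd_riccati_map:
  assumes P: "psd P"
  shows "psd (riccati_map A B Q R P)"
  unfolding psd_def
proof (intro conjI allI)
  show "transpose (riccati_map A B Q R P) = riccati_map A B Q R P"
    unfolding symmetric_iff
  proof (intro allI)
    fix x y
    show "x \<bullet> (riccati_map A B Q R P *v y) = (riccati_map A B Q R P *v x) \<bullet> y"
      unfolding inner_commute[of _ y] riccati_map_inner[OF P]
      using psd_symmetric[OF P] psd_symmetric[OF psd_Q] input_weight_inv_symmetric[OF P]
      by (simp add: inner_commute)
  qed
  fix x
  show "0 \<le> x \<bullet> (riccati_map A B Q R P *v x)"
    unfolding riccati_map_joseph[OF P] by (intro add_nonneg_nonneg psd_nonneg psd_Q P R_nonneg)
qed

text \<open>Starting from \<open>0\<close> instead of \<open>Q\<close> makes the index the number of remaining steps, with the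
  final step treated like the others.\<close>

definition cost_to_go :: "nat \<Rightarrow> real^'n^'n" where
  "cost_to_go k = (riccati_map A B Q R ^^ k) 0"

lemma cost_to_go_0 [simp]: "cost_to_go 0 = 0"
  by (simp add: cost_to_go_def)

lemma cost_to_go_Suc: "cost_to_go (Suc k) = riccati_map A B Q R (cost_to_go k)"
  by (simp add: cost_to_go_def)

lemma psd_0: "psd (0 :: real^'k^'k)"
  by (simp add: psd_def transpose_def vec_eq_iff)

lemma psd_cost_to_go: "psd (cost_to_go k)"
  by (induction k) (auto simp: cost_to_go_Suc psd_0 psd_riccati_map)

text \<open>The index counts the steps that remain after the current one.\<close>

definition gain :: "nat \<Rightarrow> real^'n^'m" where
  "gain k = riccati_gain A B R (cost_to_go k)"

definition weight :: "nat \<Rightarrow> real^'m^'m" where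
  "weight k = input_weight (cost_to_go k)"

text \<open>Half the linear coefficient of the optimal value, with opposite sign: it propagates the future
  targets backwards through the optimal closed loop.\<close>

primrec costate :: "(int \<Rightarrow> real^'n) \<Rightarrow> nat \<Rightarrow> int \<Rightarrow> real^'n" where
  "costate s 0 t = 0"
| "costate s (Suc k) t = Q *v s t + transpose (A - B ** gain k) *v costate s k (t + 1)"

definition opt_input :: "(int \<Rightarrow> real^'n) \<Rightarrow> nat \<Rightarrow> int \<Rightarrow> real^'n \<Rightarrow> real^'m" where
  "opt_input s k t x =
     matrix_inv (weight k) *v (transpose B *v costate s k (t + 1)) - gain k *v x"

primrec value_const :: "(int \<Rightarrow> real^'n) \<Rightarrow> nat \<Rightarrow> int \<Rightarrow> real" where
  "value_const s 0 t = 0"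
| "value_const s (Suc k) t = wnorm2 Q (s t) + value_const s k (t + 1)
     - wnorm2 (matrix_inv (weight k)) (transpose B *v costate s k (t + 1))"

definition opt_value :: "(int \<Rightarrow> real^'n) \<Rightarrow> nat \<Rightarrow> int \<Rightarrow> real^'n \<Rightarrow> real" where
  "opt_value s k t x = wnorm2 (cost_to_go k) x - 2 * (costate s k t \<bullet> x) + value_const s k t"

definition tracking_cost :: "(int \<Rightarrow> real^'n) \<Rightarrow> int \<Rightarrow> int \<Rightarrow> (int \<Rightarrow> real^'n) \<Rightarrow> (int \<Rightarrow> real^'m) \<Rightarrow> real" where
  "tracking_cost s a b x u = (\<Sum>i=a..b. wnorm2 Q (x i - s i) + wnorm2 R (u i))"

lemma opt_value_0 [simp]: "opt_value s 0 t x = 0"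
  by (simp add: opt_value_def wnorm2_def)

lemma opt_value_step:
  "wnorm2 Q (x - s t) + wnorm2 R u + opt_value s k (t + 1) (A *v x + B *v u) =
   opt_value s (Suc k) t x + wnorm2 (weight k) (u - opt_input s k t x)"
proof -
  have "wnorm2 Q (x - s t) = x \<bullet> (Q *v x) - 2 * ((Q *v s t) \<bullet> x) + s t \<bullet> (Q *v s t)"
    using psd_symmetric[OF psd_Q, of "s t" x]
    by (simp add: wnorm2_def matrix_vector_mult_diff_distrib inner_diff_left inner_diff_right inner_commute)
  then show ?thesis
    using complete_square[OF psd_cost_to_go[of k], of u x "costate s k (t + 1)"]
    by (simp add: opt_value_def opt_input_def wnorm2_def weight_def gain_def cost_to_go_Suc
        inner_add_left)
qed

text \<open>Summing the one-step identity, the optimal values telescope. The value with no step left is zero,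
  so the identity holds whatever state follows the last step.\<close>

lemma tracking_cost_eq:
  assumes "trajectory (linear_system A B) t e x u" "e + 1 - t = int k"
  shows "tracking_cost s t e x u = opt_value s k t (x t) +
    (\<Sum>i=t..e. wnorm2 (weight (nat (e - i))) (u i - opt_input s (nat (e - i)) i (x i)))"
  using assms
proof (induction k arbitrary: t)
  case 0
  then show ?case
    by (simp add: tracking_cost_def)
next
  case (Suc k)
  then have te: "t \<le> e" and k: "nat (e - t) = k"
    by auto
  have split: "{t..e} = insert t {t + 1..e}"
    using te by auto
  have IH: "tracking_cost s (t + 1) e x u = opt_value s k (t + 1) (x (t + 1)) +
    (\<Sum>i=t + 1..e. wnorm2 (weight (nat (e - i))) (u i - opt_input s (nat (e - i)) i (x i)))"
    using Suc.prems by (intro Suc.IH) (auto simp: trajectory_def)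
  have V: "opt_value s k (t + 1) (x (t + 1)) = opt_value s k (t + 1) (A *v x t + B *v u t)"
  proof (cases "t = e")
    case True
    then show ?thesis
      using k by simp
  next
    case False
    then show ?thesis
      using Suc.prems te by (simp add: trajectory_def)
  qed
  have "tracking_cost s t e x u =
      wnorm2 Q (x t - s t) + wnorm2 R (u t) + tracking_cost s (t + 1) e x u"
    unfolding tracking_cost_def split by simp
  with IH V opt_value_step[of "x t" s t "u t" k] show ?case
    unfolding split by (simp add: k)
qed

lemma weight_form_nonneg: "0 \<le> wnorm2 (weight k) u"
  unfolding wnorm2_def weight_def
  using input_weight_pos[OF psd_cost_to_go] by (cases "u = 0") (auto simp: less_imp_le)

lemma weight_form_pos: "u \<noteq> 0 \<Longrightarrow> 0 < wnorm2 (weight k) u"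
  unfolding wnorm2_def weight_def by (rule input_weight_pos[OF psd_cost_to_go])

lemma tracking_cost_ge:
  assumes "trajectory (linear_system A B) t e x u" "e + 1 - t = int k"
  shows "opt_value s k t (x t) \<le> tracking_cost s t e x u"
  unfolding tracking_cost_eq[OF assms] by (simp add: sum_nonneg weight_form_nonneg)

lemma tracking_cost_optimal_policy:
  assumes "trajectory (linear_system A B) t e x u" "e + 1 - t = int k"
    and "\<And>i. i \<in> {t..e} \<Longrightarrow> u i = opt_input s (nat (e - i)) i (x i)"
  shows "tracking_cost s t e x u = opt_value s k t (x t)"
  unfolding tracking_cost_eq[OF assms(1,2)] using assms(3) by (simp add: wnorm2_def)

lemma optimal_input_unique:
  assumes "trajectory (linear_system A B) t e x u" "e + 1 - t = int k"
    and "tracking_cost s t e x u \<le> opt_value s k t (x t)" "i \<in> {t..e}"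
  shows "u i = opt_input s (nat (e - i)) i (x i)"
proof (rule ccontr)
  let ?gap = "\<lambda>i. wnorm2 (weight (nat (e - i))) (u i - opt_input s (nat (e - i)) i (x i))"
  assume "u i \<noteq> opt_input s (nat (e - i)) i (x i)"
  then have "0 < ?gap i"
    by (intro weight_form_pos) simp
  also have "?gap i \<le> sum ?gap {t..e}"
    using assms(4) by (intro member_le_sum weight_form_nonneg) auto
  finally show False
    using assms(3) unfolding tracking_cost_eq[OF assms(1,2)] by simp
qed

lemma costate_shift: "costate (\<lambda>i. s (i + d)) k t = costate s k (t + d)"
  by (induction k arbitrary: t) (auto simp: algebra_simps)

lemma opt_input_shift: "opt_input (\<lambda>i. s (i + d)) k t x = opt_input s k (t + d) x"
  by (simp add: opt_input_def costate_shift algebra_simps)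

text \<open>The closed loop that all planners produce: a receding horizon of \<open>W\<close> steps, and finally the
  shrinking horizon of the plan computed \<open>W\<close> steps before the end.\<close>

definition predictive_feedback ::
  "(int \<Rightarrow> real^'n) \<Rightarrow> nat \<Rightarrow> nat \<Rightarrow> (int \<Rightarrow> real^'n) \<Rightarrow> (int \<Rightarrow> real^'m) \<Rightarrow> bool" where
  "predictive_feedback s T W x u \<longleftrightarrow>
     trajectory (linear_system A B) 1 (int T) x u \<and>
     (\<forall>t\<in>{1..int T - int W}. u t = opt_input s (W - 1) t (x t)) \<and>
     (\<forall>t\<in>{int T - int W + 1..int T}. u t = opt_input s (nat (int T - t)) t (x t))"

end

text \<open>Following a state feedback defines a trajectory; it supplies the optimal competitor in the
  minimality arguments below.\<close>

lemma policy_trajectory_exists: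
  fixes f :: "'s \<Rightarrow> 'i \<Rightarrow> 's" and \<pi> :: "int \<Rightarrow> 's \<Rightarrow> 'i"
  obtains x u where "x 1 = x1" "\<forall>e. trajectory f 1 e x u" "\<forall>i\<ge>1. u i = \<pi> i (x i)"
proof -
  define y where "y = rec_nat x1 (\<lambda>k s. f s (\<pi> (int k + 1) s))"
  let ?x = "\<lambda>i. y (nat (i - 1))"
  have "?x 1 = x1"
    by (simp add: y_def)
  moreover have "\<forall>e. trajectory f 1 e ?x (\<lambda>i. \<pi> i (?x i))"
    unfolding trajectory_def
  proof (intro allI impI)
    fix e t :: int assume t: "1 \<le> t \<and> t < e"
    then have "nat (t + 1 - 1) = Suc (nat (t - 1))" "int (nat (t - 1)) + 1 = t"
      by arith+
    then show "?x (t + 1) = f (?x t) (\<pi> t (?x t))"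
      by (simp add: y_def)
  qed
  ultimately show ?thesis
    by (intro that[of ?x "\<lambda>i. \<pi> i (?x i)"]) auto
qed

section \<open>The limiting closed loop and the stabilizing window\<close>

lemma matrix_vector_mult_uminus: "(- M) *v x = - (M *v x)" for M :: "real^'n^'m"
  using matrix_vector_mult_diff_rdistrib[of 0 M x] by simp

lemma (in lq_problem) riccati_map_0: "riccati_map A B Q R 0 = Q"
  by (simp add: matrix_eq riccati_map_mult)

lemma (in lq_problem) mpc_gain_eq: "mpc_gain A B Q R W = gain (W - 1)"
  by (simp add: mpc_gain_def gain_def cost_to_go_def)

lemma (in lq_problem) riccati_P_eq: "riccati_P A B Q R T t = cost_to_go (Suc (T - t))"
  unfolding riccati_P_def cost_to_go_def funpow_Suc_right o_apply riccati_map_0 ..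

locale convergent_lq_problem = lq_problem A B Q R
  for A :: "real^'n^'n" and B :: "real^'m^'n" and Q :: "real^'n^'n" and R :: "real^'m^'m" +
  fixes \<rho> :: real
  assumes detect: "detectable Q A" and rate: "riccati_rate A B Q R \<rho>"
begin

abbreviation Pinf where "Pinf \<equiv> P_inf A B Q R"
abbreviation Kinf where "Kinf \<equiv> K_inf A B Q R"
abbreviation Acl where "Acl \<equiv> A_cl A B Q R"
abbreviation \<gamma> where "\<gamma> \<equiv> gamma_inf A B Q R"

lemma \<rho>_bounds: "0 < \<rho>" "\<rho> < 1"
  using rate by (auto simp: riccati_rate_def)

lemma gain_rate:
  assumes "riccati_rate_const A B Q R \<rho> M" "1 \<le> j"
  shows "norm ((gain j - Kinf) *v x) \<le> M * \<rho> ^ j * norm x"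
proof -
  have "riccati_K A B Q R (j + 1) 1 = gain j"
    using assms(2) by (simp add: riccati_K_def riccati_P_eq gain_def Suc_diff_le)
  moreover have "onorm ((*v) (riccati_K A B Q R (j + 1) 1 - Kinf)) \<le> M * \<rho> ^ (j + 1 - 1)"
    using assms unfolding riccati_rate_const_def by fastforce
  ultimately have "onorm ((*v) (gain j - Kinf)) \<le> M * \<rho> ^ j"
    by simp
  with onorm[OF matrix_vector_mul_bounded_linear, of "gain j - Kinf" x] show ?thesis
    by (meson mult_right_mono norm_ge_zero order_trans)
qed

lemma cost_to_go_rate:
  assumes "riccati_rate_const A B Q R \<rho> M"
  shows "norm ((cost_to_go (Suc j) - Pinf) *v x) \<le> M * \<rho> ^ j * norm x"
proof -
  have "onorm ((*v) (riccati_P A B Q R (j + 1) 1 - Pinf)) \<le> M * \<rho> ^ (j + 1 - 1)"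
    using assms unfolding riccati_rate_const_def by fastforce
  then have "onorm ((*v) (cost_to_go (Suc j) - Pinf)) \<le> M * \<rho> ^ j"
    by (simp add: riccati_P_eq)
  with onorm[OF matrix_vector_mul_bounded_linear, of "cost_to_go (Suc j) - Pinf" x] show ?thesis
    by (meson mult_right_mono norm_ge_zero order_trans)
qed

lemma exponential_rates:
  obtains M where "M \<ge> 0"
    "\<And>k x. norm ((cost_to_go k - Pinf) *v x) \<le> M * \<rho> ^ k * norm x"
    "\<And>k x. norm ((gain k - Kinf) *v x) \<le> M * \<rho> ^ k * norm x"
proof -
  obtain M0 where M0: "riccati_rate_const A B Q R \<rho> M0"
    using rate by (auto simp: riccati_rate_def)
  obtain p where p: "p \<ge> 0" "\<And>x. norm ((cost_to_go 0 - Pinf) *v x) \<le> p * norm x"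
    using matrix_bound_exists[of "cost_to_go 0 - Pinf"] by blast
  obtain g where g: "g \<ge> 0" "\<And>x. norm ((gain 0 - Kinf) *v x) \<le> g * norm x"
    using matrix_bound_exists[of "gain 0 - Kinf"] by blast
  define M where "M = p + g + \<bar>M0\<bar> + \<bar>M0\<bar> / \<rho>"
  have M: "p \<le> M" "g \<le> M" "M0 \<le> M" "M0 / \<rho> \<le> M" "M \<ge> 0"
  proof -
    have "\<bar>M0\<bar> / \<rho> \<ge> 0" "M0 / \<rho> \<le> \<bar>M0\<bar> / \<rho>"
      using \<rho>_bounds by (auto simp: divide_right_mono)
    then show "p \<le> M" "g \<le> M" "M0 \<le> M" "M0 / \<rho> \<le> M" "M \<ge> 0"
      using p(1) g(1) abs_ge_self[of M0] abs_ge_zero[of M0] unfolding M_def by linarith+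
  qed
  have mono: "c * norm x \<le> M * \<rho> ^ k * norm x" if "c \<le> M * \<rho> ^ k" for c k and x :: "real^'k"
    using that by (rule mult_right_mono) simp
  show ?thesis
  proof (rule that[OF M(5)])
    fix k x
    show "norm ((cost_to_go k - Pinf) *v x) \<le> M * \<rho> ^ k * norm x"
    proof (cases k)
      case 0
      then show ?thesis
        using order_trans[OF p(2) mult_right_mono[OF M(1) norm_ge_zero]] by simp
    next
      case (Suc j)
      have "M0 * \<rho> ^ j = M0 / \<rho> * \<rho> ^ k"
        using \<rho>_bounds Suc by simp
      also have "\<dots> \<le> M * \<rho> ^ k"
        using M(4) \<rho>_bounds by (intro mult_right_mono) auto
      finally show ?thesis
        using order_trans[OF cost_to_go_rate[OF M0] mono] Suc by blast
    qed
    show "norm ((gain k - Kinf) *v x) \<le> M * \<rho> ^ k * norm x"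
    proof (cases k)
      case 0
      then show ?thesis
        using order_trans[OF g(2) mult_right_mono[OF M(2) norm_ge_zero]] by simp
    next
      case (Suc j)
      have "M0 * \<rho> ^ k \<le> M * \<rho> ^ k"
        using M(3) \<rho>_bounds by (intro mult_right_mono) auto
      then show ?thesis
        by (intro order_trans[OF gain_rate[OF M0] mono]) (simp_all add: Suc)
    qed
  qed
qed

lemma geometric_limit:
  fixes F :: "nat \<Rightarrow> real^'i^'j"
  assumes "\<And>k x. norm ((F k - L) *v x) \<le> M * \<rho> ^ k * norm x"
  shows "(\<lambda>k. F k *v x) \<longlonglongrightarrow> L *v x"
proof (rule LIM_zero_cancel, rule Lim_null_comparison)
  show "\<forall>\<^sub>F k in sequentially. norm (F k *v x - L *v x) \<le> M * \<rho> ^ k * norm x"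
    using assms[of _ x] by (simp add: matrix_vector_mult_diff_rdistrib)
  have "(\<lambda>k. M * \<rho> ^ k * norm x) \<longlonglongrightarrow> M * 0 * norm x"
    using \<rho>_bounds by (intro tendsto_intros LIMSEQ_power_zero) auto
  then show "(\<lambda>k. M * \<rho> ^ k * norm x) \<longlonglongrightarrow> 0"
    by simp
qed

lemma tendsto_matrix_vector: "(X \<longlongrightarrow> L) F \<Longrightarrow> ((\<lambda>k. M *v X k) \<longlongrightarrow> M *v L) F"
  for M :: "real^'i^'j"
  by (rule bounded_linear.tendsto[OF matrix_vector_mul_bounded_linear])

text \<open>Both hold for the Riccati iterates, by \<open>riccati_map_joseph\<close> and positivity, and pass to the limit
  because values and gains converge.\<close>

lemma limit_joseph:
  "x \<bullet> (Pinf *v x) = x \<bullet> (Q *v x) + (Kinf *v x) \<bullet> (R *v (Kinf *v x)) + (Acl *v x) \<bullet> (Pinf *v (Acl *v x))"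
  and limit_nonneg: "0 \<le> x \<bullet> (Pinf *v x)"
proof -
  obtain M where M: "M \<ge> 0"
    "\<And>k x. norm ((cost_to_go k - Pinf) *v x) \<le> M * \<rho> ^ k * norm x"
    "\<And>k x. norm ((gain k - Kinf) *v x) \<le> M * \<rho> ^ k * norm x"
    using exponential_rates by blast
  note limP = geometric_limit[OF M(2)] and limK = geometric_limit[OF M(3)]
  show "0 \<le> x \<bullet> (Pinf *v x)"
    by (rule LIMSEQ_le_const[OF tendsto_inner[OF tendsto_const limP]])
      (use psd_nonneg[OF psd_cost_to_go] in blast)
  let ?y = "\<lambda>k. (A - B ** gain k) *v x"
  have y: "?y \<longlonglongrightarrow> Acl *v x"
    unfolding A_cl_def matrix_vector_mult_diff_rdistrib matrix_vector_mul_assoc[symmetric]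
    by (intro tendsto_diff tendsto_const tendsto_matrix_vector limK)
  have Py: "(\<lambda>k. cost_to_go k *v ?y k) \<longlonglongrightarrow> Pinf *v (Acl *v x)"
  proof (rule Lim_transform2)
    show "(\<lambda>k. Pinf *v ?y k) \<longlonglongrightarrow> Pinf *v (Acl *v x)"
      by (rule tendsto_matrix_vector[OF y])
    show "(\<lambda>k. Pinf *v ?y k - cost_to_go k *v ?y k) \<longlonglongrightarrow> 0"
    proof (rule Lim_null_comparison)
      show "\<forall>\<^sub>F k in sequentially. norm (Pinf *v ?y k - cost_to_go k *v ?y k) \<le> M * \<rho> ^ k * norm (?y k)"
      proof (intro always_eventually allI)
        fix k
        have "norm (Pinf *v ?y k - cost_to_go k *v ?y k) = norm ((cost_to_go k - Pinf) *v ?y k)"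
          by (simp only: matrix_vector_mult_diff_rdistrib[of "cost_to_go k"] norm_minus_commute)
        also have "\<dots> \<le> M * \<rho> ^ k * norm (?y k)"
          by (rule M(2))
        finally show "norm (Pinf *v ?y k - cost_to_go k *v ?y k) \<le> M * \<rho> ^ k * norm (?y k)" .
      qed
      have "(\<lambda>k. M * \<rho> ^ k * norm (?y k)) \<longlonglongrightarrow> M * 0 * norm (Acl *v x)"
        using \<rho>_bounds by (intro tendsto_intros LIMSEQ_power_zero y) auto
      then show "(\<lambda>k. M * \<rho> ^ k * norm (?y k)) \<longlonglongrightarrow> 0"
        by simp
    qed
  qed
  have "(\<lambda>k. x \<bullet> (cost_to_go (Suc k) *v x)) \<longlonglongrightarrow> x \<bullet> (Pinf *v x)"
    by (rule tendsto_inner[OF tendsto_const LIMSEQ_Suc[OF limP]])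
  moreover have "(\<lambda>k. x \<bullet> (cost_to_go (Suc k) *v x)) \<longlonglongrightarrow>
      x \<bullet> (Q *v x) + (Kinf *v x) \<bullet> (R *v (Kinf *v x)) + (Acl *v x) \<bullet> (Pinf *v (Acl *v x))"
    unfolding cost_to_go_Suc riccati_map_joseph[OF psd_cost_to_go] gain_def[symmetric]
    by (intro tendsto_add tendsto_inner tendsto_const tendsto_matrix_vector limK y Py)
  ultimately show "x \<bullet> (Pinf *v x) = x \<bullet> (Q *v x) + (Kinf *v x) \<bullet> (R *v (Kinf *v x)) +
      (Acl *v x) \<bullet> (Pinf *v (Acl *v x))"
    by (rule LIMSEQ_unique)
qed

text \<open>For an eigenvector of the closed loop with \<open>cmod \<mu> \<ge> 1\<close> the limiting identity forces the stage
  cost to vanish on it. Then \<open>Q\<close> and the feedback annihilate it, so it is an eigenvector of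
  \<open>A - L Q\<close> for every \<open>L\<close> with the same eigenvalue, against detectability.\<close>

lemma spectral_radius_A_cl: "spectral_radius Acl < 1"
  unfolding spectral_radius_less_iff
proof (rule ballI, rule ccontr)
  fix \<mu> assume "\<mu> \<in> eigenvalues Acl" and ge: "\<not> cmod \<mu> < 1"
  then obtain x y where xy: "x \<noteq> 0 \<or> y \<noteq> 0"
    "Acl *v x = Re \<mu> *\<^sub>R x - Im \<mu> *\<^sub>R y" "Acl *v y = Re \<mu> *\<^sub>R y + Im \<mu> *\<^sub>R x"
    unfolding eigenvalue_iff by blast
  define p where "p v = v \<bullet> (Pinf *v v)" for v
  define e where "e v = v \<bullet> (Q *v v) + (Kinf *v v) \<bullet> (R *v (Kinf *v v))" for v
  have e0: "e v \<ge> 0" for v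
    by (simp add: e_def psd_nonneg[OF psd_Q] R_nonneg)
  define c where "c = x \<bullet> (Pinf *v y) + y \<bullet> (Pinf *v x)"
  have pab: "p (a *\<^sub>R v + b *\<^sub>R w) = a * a * p v + a * b * (v \<bullet> (Pinf *v w) + w \<bullet> (Pinf *v v)) + b * b * p w"
    for a b v w
  proof -
    have "p (a *\<^sub>R v + b *\<^sub>R w) = (a *\<^sub>R v + b *\<^sub>R w) \<bullet> (a *\<^sub>R (Pinf *v v) + b *\<^sub>R (Pinf *v w))"
      by (simp only: p_def matrix_vector_right_distrib matrix_vector_mult_scaleR)
    then show ?thesis
      unfolding p_def inner_add_left inner_add_right inner_scaleR_left inner_scaleR_right by algebra
  qed
  \<comment> \<open>The cross terms \<open>c\<close> cancel between real and imaginary part.\<close>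
  have "p (Acl *v x) = Re \<mu> * Re \<mu> * p x - Re \<mu> * Im \<mu> * c + Im \<mu> * Im \<mu> * p y"
    using pab[of "Re \<mu>" x "- Im \<mu>" y] by (simp add: xy c_def)
  moreover have "p (Acl *v y) = Re \<mu> * Re \<mu> * p y + Re \<mu> * Im \<mu> * c + Im \<mu> * Im \<mu> * p x"
    using pab[of "Re \<mu>" y "Im \<mu>" x] by (simp add: xy c_def add.commute)
  ultimately have "p (Acl *v x) + p (Acl *v y) = (cmod \<mu>)\<^sup>2 * (p x + p y)"
    unfolding cmod_power2 by algebra
  moreover have "p x = e x + p (Acl *v x)" "p y = e y + p (Acl *v y)"
    unfolding p_def e_def by (rule limit_joseph)+
  moreover have "1 * (p x + p y) \<le> (cmod \<mu>)\<^sup>2 * (p x + p y)"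
    using ge limit_nonneg by (intro mult_right_mono) (auto simp: p_def one_le_power)
  ultimately have "e x + e y \<le> 0"
    by simp
  then have e: "e x = 0" "e y = 0"
    using e0[of x] e0[of y] by linarith+
  have vanish: "Q *v v = 0" "A *v v = Acl *v v" if "e v = 0" for v
  proof -
    have "v \<bullet> (Q *v v) = 0" "(Kinf *v v) \<bullet> (R *v (Kinf *v v)) = 0"
      using that psd_nonneg[OF psd_Q, of v] R_nonneg[of "Kinf *v v"] unfolding e_def by linarith+
    then show "Q *v v = 0"
      using psd_form_zero[OF psd_Q] by blast
    have "Kinf *v v = 0"
      using posdef_R \<open>(Kinf *v v) \<bullet> (R *v (Kinf *v v)) = 0\<close> unfolding posdef_def
      by (metis less_irrefl)
    then show "A *v v = Acl *v v"
      by (simp add: A_cl_def matrix_vector_mult_diff_rdistrib flip: matrix_vector_mul_assoc)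
  qed
  obtain L where L: "spectral_radius (A - L ** Q) < 1"
    using detect by (auto simp: detectable_def)
  have "(A - L ** Q) *v v = Acl *v v" if "e v = 0" for v
    using vanish[OF that] by (simp add: matrix_vector_mult_diff_rdistrib flip: matrix_vector_mul_assoc)
  with e xy have "\<mu> \<in> eigenvalues (A - L ** Q)"
    unfolding eigenvalue_iff by metis
  with L ge show False
    by (simp add: spectral_radius_less_iff)
qed

lemma \<gamma>_bounds: "spectral_radius Acl < \<gamma>" "\<gamma> < 1" "1 / 2 \<le> \<gamma>"
  using spectral_radius_A_cl spectral_radius_nonneg[of Acl] by (auto simp: gamma_inf_def)

text \<open>Every feedback loop is viewed as a perturbation of the limiting closed loop.\<close>

lemma closed_loop_decomp: "A - B ** K = Acl + - (B ** (K - Kinf))"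
  unfolding A_cl_def
  by (simp add: matrix_eq matrix_vector_mult_diff_rdistrib matrix_vector_mult_add_rdistrib
      matrix_vector_mult_diff_distrib matrix_vector_mult_uminus flip: matrix_vector_mul_assoc)

lemma feedback_perturbation:
  assumes "\<And>x. norm (B *v x) \<le> b * norm x" "b \<ge> 0"
    and "\<And>x. norm ((K - Kinf) *v x) \<le> \<epsilon> * norm x"
  shows "norm (- (B ** (K - Kinf)) *v x) \<le> (b * \<epsilon>) * norm x"
proof -
  have "norm (- (B ** (K - Kinf)) *v x) = norm (B *v ((K - Kinf) *v x))"
    by (simp add: matrix_vector_mult_uminus flip: matrix_vector_mul_assoc)
  also have "\<dots> \<le> b * (\<epsilon> * norm x)"
    by (rule order_trans[OF assms(1) mult_left_mono[OF assms(3,2)]])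
  finally show ?thesis
    by (simp add: mult_ac)
qed

lemma window_const_ge_1:
  assumes "window_const A B Q R \<rho> M"
  shows "M \<ge> 1"
proof -
  have "onorm ((*v) Acl ^^ 0) \<le> M * \<gamma> ^ 0"
    using assms unfolding window_const_def by blast
  moreover have "onorm ((*v) Acl ^^ 0) \<ge> 1"
    using onorm[of "(*v) Acl ^^ 0" 1] bounded_linear_ident by (simp add: id_def)
  ultimately show ?thesis
    by simp
qed

text \<open>The three factors \<open>M\<close> are the power bound, the norm of \<open>B\<close> and the constant of the gain rate.
  For \<open>W \<ge> 2\<close> the gain rate holds with exactly this constant.\<close>

lemma stable_of_long_window:
  assumes M: "window_const A B Q R \<rho> M" and W: "2 \<le> W" and small: "M ^ 3 * \<rho> ^ (W - 1) < 1 - \<gamma>"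
  shows "spectral_radius (A - B ** mpc_gain A B Q R W) < 1"
proof -
  have M1: "M \<ge> 1"
    using window_const_ge_1[OF M] .
  have A: "norm (((*v) Acl ^^ k) x) \<le> M * \<gamma> ^ k * norm x" for k x
  proof -
    have "bounded_linear ((*v) Acl ^^ k)"
      using funpow_matrix_linear linear_conv_bounded_linear by blast
    from onorm[OF this, of x] show ?thesis
      using M unfolding window_const_def by (meson mult_right_mono norm_ge_zero order_trans)
  qed
  have B: "norm (B *v x) \<le> M * norm x" for x
    using onorm[OF matrix_vector_mul_bounded_linear, of B x] M unfolding window_const_def
    by (meson mult_right_mono norm_ge_zero order_trans)
  have K: "norm ((gain (W - 1) - Kinf) *v x) \<le> M * \<rho> ^ (W - 1) * norm x" for x
    using M W by (intro gain_rate) (auto simp: window_const_def)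
  note E = feedback_perturbation[OF B _ K]
  show ?thesis
    unfolding mpc_gain_eq closed_loop_decomp[of "gain (W - 1)"]
  proof (rule spectral_radius_perturbed[OF A _ E])
    show "\<gamma> + M * (M * (M * \<rho> ^ (W - 1))) < 1"
      using small by (simp add: power3_eq_cube mult_ac)
  qed (use M1 \<gamma>_bounds \<rho>_bounds in auto)
qed

lemma window_const_exists: "\<exists>M. window_const A B Q R \<rho> M"
proof -
  obtain M0 where M0: "riccati_rate_const A B Q R \<rho> M0"
    using rate by (auto simp: riccati_rate_def)
  obtain C where C: "C \<ge> 1" "\<And>k x. norm (((*v) Acl ^^ k) x) \<le> C * \<gamma> ^ k * norm x"
    using power_bound_of_spectral_radius[OF \<gamma>_bounds(1)] by blast
  define M where "M = max M0 (max (onorm ((*v) B)) C)"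
  have le: "M0 * \<rho> ^ j \<le> M * \<rho> ^ j" for j
    using \<rho>_bounds by (intro mult_right_mono) (auto simp: M_def)
  have "riccati_rate_const A B Q R \<rho> M"
    using M0 unfolding riccati_rate_const_def by (blast intro: order_trans[OF _ le])
  moreover have "onorm ((*v) Acl ^^ k) \<le> M * \<gamma> ^ k" for k
  proof -
    have "C * \<gamma> ^ k \<le> M * \<gamma> ^ k"
      using \<gamma>_bounds by (intro mult_right_mono) (auto simp: M_def)
    moreover have "onorm ((*v) Acl ^^ k) \<le> C * \<gamma> ^ k"
      by (rule onorm_le) (rule C)
    ultimately show ?thesis
      by linarith
  qed
  ultimately have "window_const A B Q R \<rho> M"
    by (auto simp: window_const_def M_def)
  then show ?thesis ..
qed

text \<open>Solving \<open>M ^ 3 * \<rho> ^ (W - 1) < 1 - \<gamma>\<close> for \<open>W\<close>, where \<open>1 - \<gamma>\<close> is half of one minus the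
  spectral radius.\<close>

lemma minimal_window_exists: "\<exists>\<Delta>. minimal_stabilizing_window A B Q R \<Delta>"
  and minimal_window_le:
    "\<lbrakk>minimal_stabilizing_window A B Q R \<Delta>; window_const A B Q R \<rho> M\<rbrakk> \<Longrightarrow>
      real \<Delta> \<le> (3 + (\<bar>ln (2 * M ^ 3)\<bar> + 1) / ln (1 / \<rho>)) * (1 + ln (1 / (1 - spectral_radius Acl)))"
proof -
  define l where "l = ln (1 / (1 - spectral_radius Acl))"
  have sr: "0 < 1 - spectral_radius Acl" "1 - spectral_radius Acl \<le> 1"
    using spectral_radius_A_cl spectral_radius_nonneg[of Acl] by auto
  then have l: "l \<ge> 0"
    by (simp add: l_def ln_ge_zero_iff)
  have ln\<rho>: "ln (1 / \<rho>) > 0"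
    using \<rho>_bounds by simp
  have window: "\<exists>N. stabilizing_window A B Q R N \<and>
      real N \<le> (3 + (\<bar>ln (2 * M ^ 3)\<bar> + 1) / ln (1 / \<rho>)) * (1 + l)"
    if M: "window_const A B Q R \<rho> M" for M
  proof -
    have M1: "M \<ge> 1"
      by (rule window_const_ge_1[OF M])
    define y where "y = (\<bar>ln (2 * M ^ 3)\<bar> + l) / ln (1 / \<rho>)"
    have y: "y \<ge> 0"
      using l ln\<rho> by (simp add: y_def)
    \<comment> \<open>Windows \<open>W \<ge> N\<close> have \<open>W - 1 > y\<close>, and \<open>y\<close> solves \<open>2 * M ^ 3 * \<rho> powr y \<le> 1 - spectral_radius Acl\<close>.\<close>
    define N where "N = 2 + nat \<lfloor>y\<rfloor>"
    have "stabilizing_window A B Q R N"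
      unfolding stabilizing_window_def
    proof (intro conjI allI impI)
      fix W assume "N \<le> W"
      then have W: "2 \<le> W" "real (W - 1) > y"
        using y by (auto simp: N_def) linarith
      have "ln (2 * M ^ 3 * \<rho> ^ (W - 1)) = ln (2 * M ^ 3) - real (W - 1) * ln (1 / \<rho>)"
        using M1 \<rho>_bounds by (simp add: ln_mult ln_realpow ln_div)
      also have "\<dots> < ln (2 * M ^ 3) - y * ln (1 / \<rho>)"
        using W ln\<rho> by (simp only: diff_strict_left_mono mult_strict_right_mono)
      also have "\<dots> = ln (2 * M ^ 3) - \<bar>ln (2 * M ^ 3)\<bar> - l"
        using ln\<rho> by (simp add: y_def)
      also have "\<dots> \<le> - l"
        by simp
      also have "\<dots> = ln (1 - spectral_radius Acl)"
        using sr by (simp add: l_def ln_div)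
      finally have "2 * M ^ 3 * \<rho> ^ (W - 1) < 1 - spectral_radius Acl"
        using M1 \<rho>_bounds sr by (subst (asm) ln_less_cancel_iff) auto
      then show "spectral_radius (A - B ** mpc_gain A B Q R W) < 1"
        by (intro stable_of_long_window[OF M W(1)]) (simp add: gamma_inf_def field_simps)
    qed (simp add: N_def)
    moreover have "real N \<le> (3 + (\<bar>ln (2 * M ^ 3)\<bar> + 1) / ln (1 / \<rho>)) * (1 + l)"
    proof -
      have "real N \<le> 3 + y"
        using y unfolding N_def by linarith
      also have "y \<le> (\<bar>ln (2 * M ^ 3)\<bar> + 1) / ln (1 / \<rho>) * (1 + l)"
        unfolding y_def times_divide_eq_left using l ln\<rho>
        by (intro divide_right_mono) (auto simp: algebra_simps)
      also have "3 + \<dots> \<le> (3 + (\<bar>ln (2 * M ^ 3)\<bar> + 1) / ln (1 / \<rho>)) * (1 + l)"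
        using l by (simp add: algebra_simps)
      finally show ?thesis
        by simp
    qed
    ultimately show ?thesis
      by blast
  qed
  show "\<exists>\<Delta>. minimal_stabilizing_window A B Q R \<Delta>"
  proof -
    obtain N where "stabilizing_window A B Q R N"
      using window window_const_exists by blast
    then show ?thesis
      unfolding minimal_stabilizing_window_def
      by (intro exI[of _ "LEAST N. stabilizing_window A B Q R N"]) (auto intro: LeastI Least_le)
  qed
  show "real \<Delta> \<le> (3 + (\<bar>ln (2 * M ^ 3)\<bar> + 1) / ln (1 / \<rho>)) * (1 + ln (1 / (1 - spectral_radius Acl)))"
    if \<Delta>: "minimal_stabilizing_window A B Q R \<Delta>" and M: "window_const A B Q R \<rho> M"
  proof -
    obtain N where N: "stabilizing_window A B Q R N"
      "real N \<le> (3 + (\<bar>ln (2 * M ^ 3)\<bar> + 1) / ln (1 / \<rho>)) * (1 + l)"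
      using window[OF M] by blast
    then have "\<Delta> \<le> N"
      using \<Delta> by (simp add: minimal_stabilizing_window_def)
    then have "real \<Delta> \<le> real N"
      by simp
    also note N(2)
    finally show ?thesis
      unfolding l_def .
  qed
qed

end

section \<open>Sensitivity to the horizon and regret of predictive feedback\<close>

context convergent_lq_problem
begin

text \<open>The input weights dominate \<open>R\<close> uniformly.\<close>

lemma weight_inv_bound:
  obtains c where "c > 0" "\<And>k y. norm (matrix_inv (weight k) *v y) \<le> c * norm y"
proof -
  obtain r where r: "r > 0" "\<And>x. r * (norm x)\<^sup>2 \<le> x \<bullet> (R *v x)"
    using posdef_lower_bound[OF posdef_R] by blast
  have "norm (matrix_inv (weight k) *v y) \<le> 1 / r * norm y" for k y
  proof -
    let ?x = "matrix_inv (weight k) *v y"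
    have "r * (norm ?x)\<^sup>2 \<le> ?x \<bullet> (weight k *v ?x)"
      unfolding weight_def by (rule order_trans[OF r(2) R_le_input_weight[OF psd_cost_to_go]])
    also have "weight k *v ?x = y"
      unfolding weight_def by (rule input_weight_inv[OF psd_cost_to_go])
    also have "?x \<bullet> y \<le> norm ?x * norm y"
      by (rule norm_cauchy_schwarz)
    finally have "norm ?x * (r * norm ?x) \<le> norm ?x * norm y"
      by (simp add: power2_eq_square mult_ac)
    then have "r * norm ?x \<le> norm y"
      by (cases "?x = 0") (auto simp: mult_le_cancel_left)
    then show ?thesis
      using r(1) by (simp add: field_simps)
  qed
  with r(1) show ?thesis
    by (intro that[of "1 / r"]) auto
qed

lemma \<rho>_power_le: "\<rho> ^ k \<le> 1"
  using \<rho>_bounds by (simp add: power_le_one)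

lemma weight_bound:
  obtains c where "c \<ge> 0" "\<And>k u. wnorm2 (weight k) u \<le> c * (norm u)\<^sup>2"
proof -
  obtain M where M: "M \<ge> 0" "\<And>k x. norm ((cost_to_go k - Pinf) *v x) \<le> M * \<rho> ^ k * norm x"
    using exponential_rates by metis
  obtain p where p: "p \<ge> 0" "\<And>x. norm (Pinf *v x) \<le> p * norm x"
    using matrix_bound_exists[of Pinf] by blast
  obtain b where b: "b \<ge> 0" "\<And>x. norm (B *v x) \<le> b * norm x"
    using matrix_bound_exists[of B] by blast
  obtain r where r: "r \<ge> 0" "\<And>x. norm (R *v x) \<le> r * norm x"
    using matrix_bound_exists[of R] by blast
  have P: "norm (cost_to_go k *v x) \<le> (M + p) * norm x" for k x
  proof -
    have "norm (cost_to_go k *v x) \<le> norm ((cost_to_go k - Pinf) *v x) + norm (Pinf *v x)"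
      by (simp add: matrix_vector_mult_diff_rdistrib norm_triangle_sub add.commute)
    also have "\<dots> \<le> M * \<rho> ^ k * norm x + p * norm x"
      by (intro add_mono M p)
    also have "M * \<rho> ^ k * norm x \<le> M * 1 * norm x"
      using M(1) \<rho>_power_le by (intro mult_right_mono mult_left_mono) auto
    finally show ?thesis
      by (simp add: algebra_simps)
  qed
  show ?thesis
  proof (rule that[of "r + b * (M + p) * b"])
    show "0 \<le> r + b * (M + p) * b"
      using r b M p by simp
    fix k u
    have "u \<bullet> (R *v u) \<le> norm u * (r * norm u)"
      by (rule order_trans[OF norm_cauchy_schwarz mult_left_mono[OF r(2)]]) simp
    moreover have "(B *v u) \<bullet> (cost_to_go k *v (B *v u)) \<le> (b * norm u) * ((M + p) * (b * norm u))"
    proof (rule order_trans[OF norm_cauchy_schwarz], rule mult_mono)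
      show "norm (cost_to_go k *v (B *v u)) \<le> (M + p) * (b * norm u)"
        using M(1) p(1) by (intro order_trans[OF P mult_left_mono[OF b(2)]]) auto
    qed (use b in auto)
    ultimately show "wnorm2 (weight k) u \<le> (r + b * (M + p) * b) * (norm u)\<^sup>2"
      unfolding wnorm2_def weight_def input_weight_form
      by (simp add: algebra_simps power2_eq_square)
  qed
qed

text \<open>Both estimates run the backward recursion in the norm adapted to the transposed limiting
  closed loop at a rate \<open>g\<close> strictly between its spectral radius and \<open>\<gamma>\<close>. With horizons \<open>k \<le> n\<close> the
  difference satisfies \<open>d\<^sub>k\<^sub>+\<^sub>1 \<le> (g + O(\<rho> ^ k)) d\<^sub>k + O(\<rho> ^ k)\<close>; after division by
  \<open>l ^ k\<close> with \<open>g < l\<close> and \<open>\<rho> \<le> l\<close> this is a recursion of the kind bounded by \<open>bounded_recursion\<close>.\<close>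

lemma costate_estimates:
  assumes D: "D \<ge> 0" and \<rho>l: "\<rho> \<le> l" and \<gamma>l: "\<gamma> \<le> l"
  obtains c where "c \<ge> 0"
    "\<And>s k t. (\<And>i. i \<in> {t..<t + int k} \<Longrightarrow> norm (s i) \<le> D) \<Longrightarrow> norm (costate s k t) \<le> c"
    "\<And>s k n t. \<lbrakk>k \<le> n; \<And>i. i \<in> {t..<t + int n} \<Longrightarrow> norm (s i) \<le> D\<rbrakk> \<Longrightarrow>
       norm (costate s k t - costate s n t) \<le> c * l ^ k"
proof -
  obtain g where g: "spectral_radius Acl < g" "g < \<gamma>"
    using dense[OF \<gamma>_bounds(1)] by blast
  then have g0: "g > 0"
    using spectral_radius_nonneg[of Acl] by linarith
  have l: "l > 0" "g < l"
    using \<gamma>l g \<gamma>_bounds by linarith+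
  obtain a where a: "a \<ge> 1" "\<And>k x. norm (((*v) Acl ^^ k) x) \<le> a * g ^ k * norm x"
    using power_bound_of_spectral_radius[OF g(1)] by blast
  have aT: "norm (((*v) (transpose Acl) ^^ k) x) \<le> a * g ^ k * norm x" for k x
    by (rule transpose_power_bound[OF a(2)]) (use a(1) g0 in simp)
  obtain N where N: "\<And>x. norm x \<le> N x" "\<And>x. N x \<le> a * norm x"
    "\<And>x y. N (x + y) \<le> N x + N y" "\<And>x. N (transpose Acl *v x) \<le> g * N x"
    using adapted_norm_exists[OF matrix_vector_mul_linear g0 aT] by metis
  have N0: "0 \<le> N x" for x
    by (rule order_trans[OF norm_ge_zero N(1)])
  obtain M where M: "M \<ge> 0" "\<And>k x. norm ((gain k - Kinf) *v x) \<le> M * \<rho> ^ k * norm x"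
    using exponential_rates by metis
  obtain b where b: "b \<ge> 0" "\<And>x. norm (B *v x) \<le> b * norm x"
    using matrix_bound_exists[of B] by blast
  obtain q where q: "q \<ge> 0" "\<And>x. norm (Q *v x) \<le> q * norm x"
    using matrix_bound_exists[of Q] by blast
  define T where "T k = transpose (A - B ** gain k)" for k
  define E where "E k = - (B ** (gain k - Kinf))" for k
  have T_eq: "T k *v x = transpose Acl *v x + transpose (E k) *v x" for k x
  proof -
    have "transpose (Acl + E k) = transpose Acl + transpose (E k)"
      by (simp add: transpose_def vec_eq_iff)
    then show ?thesis
      unfolding T_def closed_loop_decomp[of "gain k"] E_def[symmetric]
      by (simp add: matrix_vector_mult_add_rdistrib)
  qed
  have E: "norm (transpose (E k) *v x) \<le> b * (M * \<rho> ^ k) * norm x" for k x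
    using b M \<rho>_bounds unfolding E_def
    by (intro transpose_bound feedback_perturbation) auto
  define \<theta> where "\<theta> k = g + a * b * M * \<rho> ^ k" for k
  have \<theta>0: "\<theta> k \<ge> 0" for k
    using g0 a b M \<rho>_bounds by (simp add: \<theta>_def)
  have \<theta>_lim: "\<theta> \<longlonglongrightarrow> g"
  proof -
    have "(\<lambda>k. g + a * b * M * \<rho> ^ k) \<longlonglongrightarrow> g + a * b * M * 0"
      using \<rho>_bounds by (intro tendsto_intros LIMSEQ_power_zero) auto
    moreover have "\<theta> = (\<lambda>k. g + a * b * M * \<rho> ^ k)"
      by (simp add: fun_eq_iff \<theta>_def)
    ultimately show ?thesis
      by simp
  qed
  have NT: "N (T k *v x) \<le> \<theta> k * N x" for k x
  proof -
    have "N (transpose (E k) *v x) \<le> a * (b * (M * \<rho> ^ k) * norm x)"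
      by (rule order_trans[OF N(2) mult_left_mono[OF E]]) (use a in simp)
    also have "\<dots> \<le> a * (b * (M * \<rho> ^ k) * N x)"
      using a b M \<rho>_bounds by (intro mult_left_mono N) auto
    finally show ?thesis
      using N(3)[of "transpose Acl *v x" "transpose (E k) *v x"] N(4)[of x]
      by (simp add: T_eq \<theta>_def algebra_simps)
  qed
  \<comment> \<open>The factors \<open>\<theta>\<close> tend to \<open>g < 1\<close>, so targets bounded by \<open>D\<close> give bounded costates.\<close>
  have c1: "0 \<le> a * (q * D)"
    using a q D by simp
  obtain m c where m: "m 0 = N 0" "\<And>k. m (Suc k) = \<theta> k * m k + a * (q * D)" "\<And>k. m k \<le> c" "c \<ge> 0"
    using bounded_recursion[OF \<theta>0 \<theta>_lim _ c1, of "N 0"] g \<gamma>_bounds by (metis less_trans)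
  have Nc: "N (costate s k t) \<le> m k" if "\<And>i. i \<in> {t..<t + int k} \<Longrightarrow> norm (s i) \<le> D" for s k t
    using that
  proof (induction k arbitrary: t)
    case (Suc k)
    have "N (Q *v s t) \<le> a * (q * D)"
      using a q Suc.prems[of t]
      by (intro order_trans[OF N(2)] mult_left_mono order_trans[OF q(2)]) auto
    moreover have "N (T k *v costate s k (t + 1)) \<le> \<theta> k * m k"
      using \<theta>0 Suc by (intro order_trans[OF NT] mult_left_mono) auto
    ultimately show ?case
      using N(3)[of "Q *v s t" "T k *v costate s k (t + 1)"] by (simp add: m(2) T_def)
  qed (simp add: m)
  have bound: "norm (costate s k t) \<le> c" if "\<And>i. i \<in> {t..<t + int k} \<Longrightarrow> norm (s i) \<le> D" for s k t
    using Nc[of t k s, OF that] N(1)[of "costate s k t"] m(3)[of k] by linarith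
  \<comment> \<open>The majorant \<open>d\<close> bounds the difference divided by \<open>l ^ k\<close>; the ratio \<open>\<theta> k / l\<close> tends to \<open>g / l < 1\<close>.\<close>
  define e where "e = 2 * a * b * M * c"
  have e: "e \<ge> 0"
    using a b M m(4) by (simp add: e_def)
  have lim': "(\<lambda>k. \<theta> k / l) \<longlonglongrightarrow> g / l"
    using \<theta>_lim l by (intro tendsto_intros) auto
  have "g / l < 1" "0 \<le> e / l" "\<And>k. \<theta> k / l \<ge> 0"
    using l e \<theta>0 by auto
  then obtain d c' where d: "d 0 = a * c" "\<And>k. d (Suc k) = \<theta> k / l * d k + e / l" "\<And>k. d k \<le> c'" "c' \<ge> 0"
    using bounded_recursion[OF _ lim', of "e / l" "a * c"] by metis
  have Nd: "N (costate s k t - costate s n t) \<le> d k * l ^ k"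
    if "k \<le> n" "\<And>i. i \<in> {t..<t + int n} \<Longrightarrow> norm (s i) \<le> D" for s k n t
    using that
  proof (induction k arbitrary: n t)
    case 0
    have "N (- costate s n t) \<le> a * c"
      using a bound[of t n s] 0 by (intro order_trans[OF N(2)] mult_left_mono) auto
    then show ?case
      by (simp add: d)
  next
    case (Suc k)
    then obtain n' where n: "n = Suc n'" "k \<le> n'"
      by (cases n) auto
    let ?x = "costate s k (t + 1)" and ?y = "costate s n' (t + 1)"
    have eq: "costate s (Suc k) t - costate s n t =
        T k *v (?x - ?y) + (transpose (E k) *v ?y + - (transpose (E n') *v ?y))"
      by (simp add: n T_def[symmetric] matrix_vector_mult_diff_distrib)
        (simp add: T_eq)
    have "N (T k *v (?x - ?y)) \<le> \<theta> k * (d k * l ^ k)"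
      using \<theta>0 Suc n by (intro order_trans[OF NT] mult_left_mono Suc.IH) auto
    moreover have "N (transpose (E k) *v ?y + - (transpose (E n') *v ?y)) \<le> e * l ^ k"
    proof -
      have y: "norm ?y \<le> c"
        using Suc.prems n by (intro bound) auto
      have "norm (transpose (E j) *v ?y) \<le> b * M * c * l ^ k" if "k \<le> j" for j
      proof -
        have "\<rho> ^ j \<le> \<rho> ^ k"
          using that \<rho>_bounds by (intro power_decreasing) auto
        also have "\<dots> \<le> l ^ k"
          using \<rho>_bounds \<rho>l by (intro power_mono) auto
        finally have "b * (M * \<rho> ^ j) * norm ?y \<le> b * (M * l ^ k) * c"
          using b M y l \<rho>_bounds by (intro mult_mono) auto
        then show ?thesis
          using E[of j ?y] by (simp add: mult_ac)
      qed
      from this[of k] this[of n'] n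
      have "norm (transpose (E k) *v ?y + - (transpose (E n') *v ?y)) \<le> 2 * b * M * c * l ^ k"
        using norm_triangle_ineq4[of "transpose (E k) *v ?y" "transpose (E n') *v ?y"] by simp
      then have "N (transpose (E k) *v ?y + - (transpose (E n') *v ?y)) \<le> a * (2 * b * M * c * l ^ k)"
        using a by (intro order_trans[OF N(2)] mult_left_mono) auto
      then show ?thesis
        by (simp add: e_def mult_ac)
    qed
    moreover have "\<theta> k * (d k * l ^ k) + e * l ^ k = d (Suc k) * l ^ Suc k"
      using l by (simp add: d field_simps)
    ultimately show ?case
      unfolding eq
      using N(3)[of "T k *v (?x - ?y)" "transpose (E k) *v ?y + - (transpose (E n') *v ?y)"]
      by linarith
  qed
  show ?thesis
  proof (rule that[of "max c c'"])
    show "0 \<le> max c c'"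
      using m(4) by simp
    show "norm (costate s k t) \<le> max c c'"
      if "\<And>i. i \<in> {t..<t + int k} \<Longrightarrow> norm (s i) \<le> D" for s k t
      using bound[OF that] by (simp add: le_max_iff_disj)
    show "norm (costate s k t - costate s n t) \<le> max c c' * l ^ k"
      if "k \<le> n" "\<And>i. i \<in> {t..<t + int n} \<Longrightarrow> norm (s i) \<le> D" for s k n t
    proof -
      have "d k * l ^ k \<le> max c c' * l ^ k"
        using d(3)[of k] l by (intro mult_right_mono) (auto simp: le_max_iff_disj)
      moreover have "N (costate s k t - costate s n t) \<le> d k * l ^ k"
        using that by (rule Nd)
      ultimately show ?thesis
        using N(1)[of "costate s k t - costate s n t"] by linarith
    qed
  qed
qed

text \<open>Three sources of dependence on the horizon, each of order \<open>l ^ k\<close>: the costate, the inverse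
  input weight and the gain.\<close>

lemma opt_input_estimates:
  assumes D: "D \<ge> 0" and \<rho>l: "\<rho> \<le> l" and \<gamma>l: "\<gamma> \<le> l"
  obtains c where "c \<ge> 0"
    "\<And>s k t. (\<And>i. i \<in> {t<..t + int k} \<Longrightarrow> norm (s i) \<le> D) \<Longrightarrow> norm (opt_input s k t 0) \<le> c"
    "\<And>s k n t x. \<lbrakk>k \<le> n; \<And>i. i \<in> {t<..t + int n} \<Longrightarrow> norm (s i) \<le> D\<rbrakk> \<Longrightarrow>
       norm (opt_input s k t x - opt_input s n t x) \<le> c * l ^ k * (1 + norm x)"
proof -
  obtain h where h: "h \<ge> 0"
    "\<And>s k t. (\<And>i. i \<in> {t..<t + int k} \<Longrightarrow> norm (s i) \<le> D) \<Longrightarrow> norm (costate s k t) \<le> h"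
    "\<And>s k n t. \<lbrakk>k \<le> n; \<And>i. i \<in> {t..<t + int n} \<Longrightarrow> norm (s i) \<le> D\<rbrakk> \<Longrightarrow>
       norm (costate s k t - costate s n t) \<le> h * l ^ k"
    using costate_estimates[OF assms] by metis
  obtain M where M: "M \<ge> 0"
    "\<And>k x. norm ((cost_to_go k - Pinf) *v x) \<le> M * \<rho> ^ k * norm x"
    "\<And>k x. norm ((gain k - Kinf) *v x) \<le> M * \<rho> ^ k * norm x"
    using exponential_rates by blast
  obtain b where b: "b \<ge> 0" "\<And>x. norm (B *v x) \<le> b * norm x"
    using matrix_bound_exists[of B] by blast
  have bT: "norm (transpose B *v y) \<le> b * norm y" for y
    by (rule transpose_bound[OF b(2,1)])
  obtain w where w: "w > 0" "\<And>k y. norm (matrix_inv (weight k) *v y) \<le> w * norm y"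
    using weight_inv_bound by blast
  have l: "l > 0"
    using \<rho>l \<rho>_bounds by linarith
  have \<rho>j: "\<rho> ^ j \<le> l ^ k" if "k \<le> j" for j k
  proof -
    have "\<rho> ^ j \<le> \<rho> ^ k"
      using that \<rho>_bounds by (intro power_decreasing) auto
    also have "\<dots> \<le> l ^ k"
      using \<rho>_bounds \<rho>l by (intro power_mono) auto
    finally show ?thesis .
  qed
  have close: "norm ((F j - F k) *v x) \<le> 2 * M * l ^ k * norm x"
    if F: "\<And>k x. norm ((F k - L) *v x) \<le> M * \<rho> ^ k * norm x" and "k \<le> j"
    for F :: "nat \<Rightarrow> real^'p^'q" and L j k x
  proof -
    have "(F j - F k) *v x = (F j - L) *v x - (F k - L) *v x"
      by (simp add: matrix_vector_mult_diff_rdistrib)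
    then have "norm ((F j - F k) *v x) \<le> norm ((F j - L) *v x) + norm ((F k - L) *v x)"
      by (simp add: norm_triangle_ineq4)
    also have "\<dots> \<le> M * \<rho> ^ j * norm x + M * \<rho> ^ k * norm x"
      by (intro add_mono F)
    also have "\<dots> \<le> M * l ^ k * norm x + M * l ^ k * norm x"
      using M(1) \<open>k \<le> j\<close> by (intro add_mono mult_right_mono mult_left_mono \<rho>j) auto
    finally show ?thesis
      by (simp add: mult_ac)
  qed
  define C where "C = w * b * h + w * (b * (2 * M) * b) * w * (b * h) + 2 * M"
  have C: "C \<ge> 0"
    using w b h M by (simp add: C_def)
  show ?thesis
  proof (rule that[of "max (w * (b * h)) C"])
    show "0 \<le> max (w * (b * h)) C"
      using C by simp
    show "norm (opt_input s k t 0) \<le> max (w * (b * h)) C"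
      if "\<And>i. i \<in> {t<..t + int k} \<Longrightarrow> norm (s i) \<le> D" for s k t
    proof -
      have "norm (costate s k (t + 1)) \<le> h"
        using that by (intro h(2)) auto
      then have "norm (opt_input s k t 0) \<le> w * (b * h)"
        unfolding opt_input_def using w b h
        by (auto intro!: order_trans[OF w(2)] mult_left_mono order_trans[OF bT])
      then show ?thesis
        by simp
    qed
    fix s :: "int \<Rightarrow> real^'n" and k n t x
    assume kn: "k \<le> n" and s: "\<And>i. i \<in> {t<..t + int n} \<Longrightarrow> norm (s i) \<le> D"
    define cn where "cn = costate s n (t + 1)"
    define dc where "dc = costate s k (t + 1) - cn"
    define G where "G j = matrix_inv (weight j)" for j
    have cn: "norm cn \<le> h"
      unfolding cn_def using s by (intro h(2)) auto
    have dc: "norm dc \<le> h * l ^ k"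
      unfolding dc_def cn_def using s kn by (intro h(3)) auto
    define v where "v = G n *v (transpose B *v cn)"
    have Wn: "weight n *v v = transpose B *v cn"
      unfolding v_def G_def weight_def by (rule input_weight_inv[OF psd_cost_to_go])
    have "G k *v (weight k *v v) = v"
      unfolding G_def weight_def by (rule input_weight_inv[OF psd_cost_to_go])
    then have "G k *v (transpose B *v cn) - v = G k *v ((weight n - weight k) *v v)"
      unfolding matrix_vector_mult_diff_rdistrib matrix_vector_mult_diff_distrib Wn by simp
    also have "(weight n - weight k) *v v = transpose B *v ((cost_to_go n - cost_to_go k) *v (B *v v))"
      by (simp add: weight_def input_weight_mult matrix_vector_mult_diff_rdistrib
          matrix_vector_mult_diff_distrib)
    finally have Gdiff: "G k *v (transpose B *v cn) - v =
        G k *v (transpose B *v ((cost_to_go n - cost_to_go k) *v (B *v v)))" .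
    have eq: "opt_input s k t x - opt_input s n t x =
        G k *v (transpose B *v dc) + (G k *v (transpose B *v cn) - v) + (gain n - gain k) *v x"
      by (simp add: opt_input_def dc_def v_def cn_def G_def matrix_vector_mult_diff_rdistrib
          matrix_vector_mult_diff_distrib)
    have "norm (G k *v (transpose B *v dc)) \<le> w * b * h * l ^ k"
    proof -
      have "norm (G k *v (transpose B *v dc)) \<le> w * (b * (h * l ^ k))"
        unfolding G_def using w b dc
        by (intro order_trans[OF w(2)] mult_left_mono order_trans[OF bT]) auto
      then show ?thesis
        by (simp add: mult_ac)
    qed
    moreover have "norm (G k *v (transpose B *v cn) - v) \<le> w * (b * (2 * M) * b) * w * (b * h) * l ^ k"
    proof -
      have v: "norm v \<le> w * (b * h)"
        unfolding v_def G_def using w b cn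
        by (intro order_trans[OF w(2)] mult_left_mono order_trans[OF bT]) auto
      have "norm ((cost_to_go n - cost_to_go k) *v (B *v v)) \<le> 2 * M * l ^ k * (b * (w * (b * h)))"
        using M(1) l b v
        by (intro order_trans[OF close[OF M(2) kn]] mult_left_mono order_trans[OF b(2)]) auto
      then have "norm (G k *v (transpose B *v cn) - v) \<le> w * (b * (2 * M * l ^ k * (b * (w * (b * h)))))"
        unfolding Gdiff unfolding G_def using w b
        by (intro order_trans[OF w(2)] mult_left_mono order_trans[OF bT]) auto
      then show ?thesis
        by (simp add: mult_ac)
    qed
    moreover have "norm ((gain n - gain k) *v x) \<le> 2 * M * l ^ k * norm x"
      by (rule close[OF M(3) kn])
    ultimately have "norm (opt_input s k t x - opt_input s n t x) \<le>
        w * b * h * l ^ k + w * (b * (2 * M) * b) * w * (b * h) * l ^ k + 2 * M * l ^ k * norm x"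
      unfolding eq by (intro norm_triangle_mono)
    also have "\<dots> \<le> C * l ^ k * (1 + norm x)"
    proof -
      have "0 \<le> (w * b * h + w * (b * (2 * M) * b) * w * (b * h)) * l ^ k * norm x + 2 * M * l ^ k"
        using w b h M l by (intro add_nonneg_nonneg mult_nonneg_nonneg) auto
      then show ?thesis
        unfolding C_def by (simp add: algebra_simps)
    qed
    also have "\<dots> \<le> max (w * (b * h)) C * l ^ k * (1 + norm x)"
      using l by (intro mult_right_mono) auto
    finally show "norm (opt_input s k t x - opt_input s n t x) \<le>
        max (w * (b * h)) C * l ^ k * (1 + norm x)" .
  qed
qed

text \<open>Long windows are uniformly close to the limiting closed loop; the remaining windows are finitely
  many, each with a stable loop, so their constants can be added up.\<close>

lemma uniform_bounded_response:
  assumes \<Delta>: "stabilizing_window A B Q R \<Delta>"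
  obtains c where "c \<ge> 0" "\<And>W. \<Delta> \<le> W \<Longrightarrow> bounded_response ((*v) (A - B ** mpc_gain A B Q R W)) c"
proof -
  obtain M where M: "M \<ge> 0" "\<And>k x. norm ((gain k - Kinf) *v x) \<le> M * \<rho> ^ k * norm x"
    using exponential_rates by metis
  obtain b where b: "b \<ge> 0" "\<And>x. norm (B *v x) \<le> b * norm x"
    using matrix_bound_exists[of B] by blast
  obtain a where a: "a \<ge> 1" "\<And>k x. norm (((*v) Acl ^^ k) x) \<le> a * \<gamma> ^ k * norm x"
    using power_bound_of_spectral_radius[OF \<gamma>_bounds(1)] by blast
  have "(\<lambda>k. \<gamma> + a * (b * (M * \<rho> ^ k))) \<longlonglongrightarrow> \<gamma> + a * (b * (M * 0))"
    using \<rho>_bounds by (intro tendsto_intros LIMSEQ_power_zero) auto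
  then have "\<forall>\<^sub>F k in sequentially. \<gamma> + a * (b * (M * \<rho> ^ k)) < (1 + \<gamma>) / 2"
    using \<gamma>_bounds by (intro order_tendstoD(2)) auto
  then obtain k0 where k0: "\<And>k. k \<ge> k0 \<Longrightarrow> \<gamma> + a * (b * (M * \<rho> ^ k)) < (1 + \<gamma>) / 2"
    unfolding eventually_sequentially by blast
  define c0 where "c0 = a / (1 - (1 + \<gamma>) / 2)"
  have large: "bounded_response ((*v) (A - B ** mpc_gain A B Q R W)) c0" if "W > k0" for W
  proof -
    have "\<gamma> + a * (b * (M * \<rho> ^ (W - 1))) \<le> (1 + \<gamma>) / 2"
      using that by (intro less_imp_le[OF k0]) simp
    then show ?thesis
      unfolding mpc_gain_eq closed_loop_decomp[of "gain (W - 1)"] c0_def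
      using a(1) \<gamma>_bounds
      by (intro bounded_response_perturbed[OF a(2) _ feedback_perturbation[OF b(2,1) M(2)]])
        (auto simp: field_simps)
  qed
  have "\<exists>c\<ge>0. bounded_response ((*v) (A - B ** mpc_gain A B Q R W)) c" if "\<Delta> \<le> W" for W
  proof -
    let ?F = "A - B ** mpc_gain A B Q R W"
    have "spectral_radius ?F < 1"
      using \<Delta> that by (simp add: stabilizing_window_def)
    then obtain g where g: "spectral_radius ?F < g" "g < 1"
      using dense by blast
    obtain a' where a': "a' \<ge> 1" "\<And>k x. norm (((*v) ?F ^^ k) x) \<le> a' * g ^ k * norm x"
      using power_bound_of_spectral_radius[OF g(1)] by blast
    have "bounded_response ((*v) (?F + 0)) (a' / (1 - g))"
      using g a' spectral_radius_nonneg[of ?F]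
      by (intro bounded_response_perturbed[OF a'(2), where \<epsilon> = 0]) auto
    then show ?thesis
      using a' g by (intro exI[of _ "a' / (1 - g)"]) auto
  qed
  then obtain cs where cs: "\<And>W. \<Delta> \<le> W \<Longrightarrow> cs W \<ge> 0 \<and> bounded_response ((*v) (A - B ** mpc_gain A B Q R W)) (cs W)"
    by metis
  define c where "c = c0 + (\<Sum>W\<in>{\<Delta>..k0}. cs W)"
  have c0: "c0 \<ge> 0"
    using a \<gamma>_bounds by (simp add: c0_def)
  have sum: "0 \<le> (\<Sum>W\<in>{\<Delta>..k0}. cs W)"
    using cs by (intro sum_nonneg) auto
  show ?thesis
  proof (rule that[of c])
    show "c \<ge> 0"
      using c0 sum by (simp add: c_def)
    fix W assume W: "\<Delta> \<le> W"
    show "bounded_response ((*v) (A - B ** mpc_gain A B Q R W)) c"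
    proof (cases "W > k0")
      case True
      then show ?thesis
        using bounded_response_mono[OF large] sum by (simp add: c_def)
    next
      case False
      then have "cs W \<le> (\<Sum>W\<in>{\<Delta>..k0}. cs W)"
        using W cs by (intro member_le_sum) auto
      then have "cs W \<le> c"
        using c0 by (simp add: c_def)
      then show ?thesis
        using bounded_response_mono cs[OF W] by blast
    qed
  qed
qed

text \<open>The regret is the sum of the squared deviations in \<open>tracking_cost_eq\<close>. Up to time
  \<open>T - W\<close> they compare remaining horizons \<open>W - 1\<close> and \<open>T - t \<ge> W\<close> at a state of bounded size;
  afterwards they vanish.\<close>

theorem lq_regret_bound:
  assumes \<Delta>: "stabilizing_window A B Q R \<Delta>" and D: "D \<ge> 0"
  defines "l \<equiv> max \<rho> \<gamma>"
  obtains c where "c \<ge> 0"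
    "\<forall>s T W x u. \<Delta> \<le> W \<and> W \<le> T \<and> (\<forall>i\<in>{1..int T}. norm (s i) \<le> D) \<and>
       predictive_feedback s T W x u \<longrightarrow>
       tracking_cost s 1 (int T) x u - opt_value s T 1 (x 1)
        \<le> c * (1 + (norm (x 1))\<^sup>2) * l ^ (2 * W) * real T"
proof -
  have l: "\<rho> \<le> l" "\<gamma> \<le> l" "l > 0"
    using \<rho>_bounds by (auto simp: l_def)
  obtain h where h: "h \<ge> 0"
    "\<And>s k t. (\<And>i. i \<in> {t<..t + int k} \<Longrightarrow> norm (s i) \<le> D) \<Longrightarrow> norm (opt_input s k t 0) \<le> h"
    "\<And>s k n t x. \<lbrakk>k \<le> n; \<And>i. i \<in> {t<..t + int n} \<Longrightarrow> norm (s i) \<le> D\<rbrakk> \<Longrightarrow>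
       norm (opt_input s k t x - opt_input s n t x) \<le> h * l ^ k * (1 + norm x)"
    using opt_input_estimates[OF D l(1,2)] by metis
  obtain a where a: "a \<ge> 0" "\<And>W. \<Delta> \<le> W \<Longrightarrow> bounded_response ((*v) (A - B ** mpc_gain A B Q R W)) a"
    using uniform_bounded_response[OF \<Delta>] by blast
  obtain b where b: "b \<ge> 0" "\<And>x. norm (B *v x) \<le> b * norm x"
    using matrix_bound_exists[of B] by blast
  obtain w where w: "w \<ge> 0" "\<And>k u. wnorm2 (weight k) u \<le> w * (norm u)\<^sup>2"
    using weight_bound by blast
  \<comment> \<open>The states satisfy \<open>1 + norm (x t) \<le> p + a * norm (x 1)\<close>. The division by \<open>l\<^sup>2\<close> in \<open>c\<close> converts
    the rate \<open>l ^ (W - 1)\<close> of the input differences, which counts the steps after the current one, into \<open>l ^ W\<close>.\<close>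
  define p where "p = 1 + a * (b * h)"
  have p: "p \<ge> 0"
    using a b h by (simp add: p_def)
  define c where "c = w * h\<^sup>2 * (2 * (p\<^sup>2 + a\<^sup>2)) / l\<^sup>2"
  have c: "c \<ge> 0"
    using w by (simp add: c_def)
  show ?thesis
  proof (rule that[OF c], intro allI impI, elim conjE)
    fix s T W x u
    assume W: "\<Delta> \<le> W" "W \<le> T" and s_bound: "\<forall>i\<in>{1..int T}. norm (s i) \<le> D"
      and "predictive_feedback s T W x u"
    then have traj: "trajectory (linear_system A B) 1 (int T) x u"
      and u1: "\<And>t. t \<in> {1..int T - int W} \<Longrightarrow> u t = opt_input s (W - 1) t (x t)"
      and u2: "\<And>t. t \<in> {int T - int W + 1..int T} \<Longrightarrow> u t = opt_input s (nat (int T - t)) t (x t)"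
      by (auto simp: predictive_feedback_def)
    have s: "norm (s i) \<le> D" if "i \<in> {1..int T}" for i
      using s_bound that by blast
    have W1: "1 \<le> W"
      using \<Delta> W by (simp add: stabilizing_window_def)
    let ?gap = "\<lambda>t. wnorm2 (weight (nat (int T - t))) (u t - opt_input s (nat (int T - t)) t (x t))"
    let ?F = "A - B ** mpc_gain A B Q R W"
    have state: "norm (x t) \<le> a * (norm (x 1) + b * h)" if "t \<in> {1..int T - int W}" for t
    proof -
      define y where "y i = x (int i + 1)" for i
      define v where "v i = B *v opt_input s (W - 1) (int i + 1) 0" for i :: nat
      define n where "n = nat (t - 1)"
      have "y (Suc i) = ?F *v y i + v i \<and> norm (v i) \<le> b * h" if "i < n" for i
      proof
        have i: "int i + 1 \<in> {1..int T - int W}" "int i + 1 < int T"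
          using that \<open>t \<in> _\<close> by (auto simp: n_def)
        have "x (int i + 1 + 1) = A *v x (int i + 1) + B *v u (int i + 1)"
          using traj[unfolded trajectory_def, rule_format, of "int i + 1"] i by simp
        also have "u (int i + 1) = opt_input s (W - 1) (int i + 1) 0 - gain (W - 1) *v x (int i + 1)"
          unfolding u1[OF i(1)] by (simp add: opt_input_def)
        finally show "y (Suc i) = ?F *v y i + v i"
          by (simp add: y_def v_def mpc_gain_eq matrix_vector_mult_diff_rdistrib
              matrix_vector_mult_diff_distrib algebra_simps flip: matrix_vector_mul_assoc)
        have "norm (opt_input s (W - 1) (int i + 1) 0) \<le> h"
          using i W1 by (intro h(2) s) auto
        then show "norm (v i) \<le> b * h"
          unfolding v_def using b by (intro order_trans[OF b(2)] mult_left_mono) auto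
      qed
      moreover have "0 \<le> b * h"
        using b h by simp
      ultimately have "norm (y n) \<le> a * (norm (y 0) + b * h)"
        using a(2)[OF W(1)] unfolding bounded_response_def by blast
      then show ?thesis
        using that by (simp add: y_def n_def)
    qed
    have gap: "?gap t \<le> c * (1 + (norm (x 1))\<^sup>2) * l ^ (2 * W)" if t: "t \<in> {1..int T}" for t
    proof (cases "t \<le> int T - int W")
      case True
      then have tW: "t \<in> {1..int T - int W}"
        using t by simp
      have "norm (u t - opt_input s (nat (int T - t)) t (x t)) \<le> h * l ^ (W - 1) * (1 + norm (x t))"
        unfolding u1[OF tW] using tW W1 by (intro h(3) s) auto
      also have "\<dots> \<le> h * l ^ (W - 1) * (p + a * norm (x 1))"
        using state[OF tW] h l by (intro mult_left_mono) (auto simp: p_def algebra_simps)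
      finally have "(norm (u t - opt_input s (nat (int T - t)) t (x t)))\<^sup>2 \<le>
          (h * l ^ (W - 1) * (p + a * norm (x 1)))\<^sup>2"
        by (intro power_mono) auto
      also have "\<dots> = h\<^sup>2 * (l ^ (2 * W) / l\<^sup>2) * (p + a * norm (x 1))\<^sup>2"
      proof -
        have "l ^ (2 * W) = (l ^ (W - 1))\<^sup>2 * l\<^sup>2"
          unfolding power_mult_distrib[symmetric]
          using W1 power_minus_mult[of W l] by (simp add: power_even_eq)
        then show ?thesis
          using l by (simp add: power_mult_distrib)
      qed
      also have "\<dots> \<le> h\<^sup>2 * (l ^ (2 * W) / l\<^sup>2) * (2 * (p\<^sup>2 + a\<^sup>2) * (1 + (norm (x 1))\<^sup>2))"
      proof (intro mult_left_mono)
        have "(p + a * norm (x 1))\<^sup>2 \<le> 2 * p\<^sup>2 + 2 * (a * norm (x 1))\<^sup>2"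
          using sum_squares_bound[of p "a * norm (x 1)"] by (simp add: power2_sum)
        also have "\<dots> \<le> 2 * (p\<^sup>2 + a\<^sup>2) * (1 + (norm (x 1))\<^sup>2)"
          by (simp add: power_mult_distrib algebra_simps)
        finally show "(p + a * norm (x 1))\<^sup>2 \<le> 2 * (p\<^sup>2 + a\<^sup>2) * (1 + (norm (x 1))\<^sup>2)" .
      qed (use l in auto)
      finally have "?gap t \<le> w * (h\<^sup>2 * (l ^ (2 * W) / l\<^sup>2) * (2 * (p\<^sup>2 + a\<^sup>2) * (1 + (norm (x 1))\<^sup>2)))"
        using w(1) by (intro order_trans[OF w(2)] mult_left_mono)
      then show ?thesis
        by (simp add: c_def mult_ac)
    next
      case False
      then have "?gap t = 0"
        using u2[of t] t by (simp add: wnorm2_def)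
      also have "0 \<le> c * (1 + (norm (x 1))\<^sup>2) * l ^ (2 * W)"
        using c l by (intro mult_nonneg_nonneg) auto
      finally show ?thesis .
    qed
    have "tracking_cost s 1 (int T) x u - opt_value s T 1 (x 1) = sum ?gap {1..int T}"
      using tracking_cost_eq[OF traj, of T s] by simp
    also have "\<dots> \<le> (\<Sum>t\<in>{1..int T}. c * (1 + (norm (x 1))\<^sup>2) * l ^ (2 * W))"
      by (intro sum_mono gap)
    also have "\<dots> = c * (1 + (norm (x 1))\<^sup>2) * l ^ (2 * W) * real T"
      by simp
    finally show "tracking_cost s 1 (int T) x u - opt_value s T 1 (x 1) \<le>
        c * (1 + (norm (x 1))\<^sup>2) * l ^ (2 * W) * real T" .
  qed
qed

end

section \<open>Predictive planners in lifted coordinates\<close>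

locale koopman_tracking = lq_problem A B Q R
  for A :: "real^'n^'n" and B :: "real^'m^'n" and Q :: "real^'n^'n" and R :: "real^'m^'m" +
  fixes f :: "real^'z \<Rightarrow> real^'m \<Rightarrow> real^'z" and C :: "real^'n^'z" and \<psi> :: "real^'z \<Rightarrow> real^'n"
    and Qz :: "real^'z^'z"
  assumes koopman: "koopman_embedding f A B C \<psi>" and Q_eq: "Q = transpose C ** Qz ** C"
begin

lemma lift_step: "\<psi> (f z u) = A *v \<psi> z + B *v u"
  using koopman by (simp add: koopman_embedding_def)

lemma unlift: "C *v \<psi> z = z"
  using koopman by (simp add: koopman_embedding_def)

text \<open>The identity behind the equivalence of the nonlinear and the lifted problem.\<close>

lemma output_weight: "wnorm2 Qz (C *v x - z) = wnorm2 Q (x - \<psi> z)"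
proof -
  have "wnorm2 Q v = wnorm2 Qz (C *v v)" for v
    unfolding Q_eq wnorm2_def by (simp add: inner_transpose flip: matrix_vector_mul_assoc)
  then show ?thesis
    by (simp add: matrix_vector_mult_diff_distrib unlift)
qed

lemma stage_cost_lifted: "stage_cost Qz R z u r = wnorm2 Q (\<psi> z - \<psi> r) + wnorm2 R u"
  using output_weight[of "\<psi> z" r] by (simp add: stage_cost_def unlift)

lemma trajectory_lifted:
  "trajectory f a b z u \<Longrightarrow> trajectory (linear_system A B) a b (\<lambda>i. \<psi> (z i)) u"
  by (simp add: trajectory_def lift_step)

text \<open>Local time starts at 1 in every plan, so targets are passed shifted.\<close>

definition optimal_plan :: "(int \<Rightarrow> real^'n) \<Rightarrow> nat \<Rightarrow> real^'n \<Rightarrow> (int \<Rightarrow> real^'m) \<Rightarrow> bool" where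
  "optimal_plan s W x1 v \<longleftrightarrow> (\<exists>x. x 1 = x1 \<and> trajectory (linear_system A B) 1 (int W) x v \<and>
     (\<forall>i\<in>{1..int W}. v i = opt_input s (nat (int W - i)) i (x i)))"

lemma optimal_plan_of_cost_le:
  assumes "x 1 = x1" "trajectory (linear_system A B) 1 (int W) x v"
    and "tracking_cost s 1 (int W) x v \<le> opt_value s W 1 x1"
  shows "optimal_plan s W x1 v"
  unfolding optimal_plan_def
  using assms optimal_input_unique[of 1 "int W" x v W s] by auto

lemma optimal_linear_trajectory:
  obtains x v where "x 1 = x1" "trajectory (linear_system A B) 1 (int W) x v"
    "tracking_cost s 1 (int W) x v = opt_value s W 1 x1"
proof -
  obtain x v where xv: "x 1 = x1" "\<forall>e. trajectory (linear_system A B) 1 e x v"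
    "\<forall>i\<ge>1. v i = opt_input s (nat (int W - i)) i (x i)"
    by (rule policy_trajectory_exists)
  then have "tracking_cost s 1 (int W) x v = opt_value s W 1 (x 1)"
    by (intro tracking_cost_optimal_policy) auto
  with xv show ?thesis
    using that by blast
qed

lemma lmpc_plan_optimal:
  assumes "lmpc_plan A B \<psi> Q R W r z t v"
  shows "optimal_plan (\<lambda>i. \<psi> (r (i + (t - 1)))) W (\<psi> (z t)) v"
proof -
  let ?s = "\<lambda>i. \<psi> (r (i + (t - 1)))"
  obtain x where x: "x 1 = \<psi> (z t)" "trajectory (linear_system A B) 1 (int W) x v"
    and le: "\<And>v' x'. \<lbrakk>x' 1 = \<psi> (z t); trajectory (linear_system A B) 1 (int W) x' v'\<rbrakk> \<Longrightarrow>
      tracking_cost ?s 1 (int W) x v \<le> tracking_cost ?s 1 (int W) x' v'"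
    using assms unfolding lmpc_plan_def is_arg_min_def tracking_cost_def
    by (auto simp: algebra_simps not_less)
  obtain x' v' where "x' 1 = \<psi> (z t)" "trajectory (linear_system A B) 1 (int W) x' v'"
    "tracking_cost ?s 1 (int W) x' v' = opt_value ?s W 1 (\<psi> (z t))"
    by (rule optimal_linear_trajectory)
  with x le[of x' v'] show ?thesis
    by (intro optimal_plan_of_cost_le) auto
qed

lemma nmpc_plan_optimal:
  assumes "nmpc_plan f Qz R W r z t v"
  shows "optimal_plan (\<lambda>i. \<psi> (r (i + (t - 1)))) W (\<psi> (z t)) v"
proof -
  let ?s = "\<lambda>i. \<psi> (r (i + (t - 1)))"
  obtain y where y: "y 1 = z t" "trajectory f 1 (int W) y v"
    and le: "\<And>v' y'. \<lbrakk>y' 1 = z t; trajectory f 1 (int W) y' v'\<rbrakk> \<Longrightarrow>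
      tracking_cost ?s 1 (int W) (\<lambda>i. \<psi> (y i)) v \<le> tracking_cost ?s 1 (int W) (\<lambda>i. \<psi> (y' i)) v'"
    using assms unfolding nmpc_plan_def is_arg_min_def tracking_cost_def stage_cost_lifted
    by (auto simp: algebra_simps not_less)
  obtain y' v' where y': "y' 1 = z t" "\<forall>e. trajectory f 1 e y' v'"
    "\<forall>i\<ge>1. v' i = opt_input ?s (nat (int W - i)) i (\<psi> (y' i))"
    by (rule policy_trajectory_exists)
  have "tracking_cost ?s 1 (int W) (\<lambda>i. \<psi> (y' i)) v' = opt_value ?s W 1 (\<psi> (y' 1))"
    using y' by (intro tracking_cost_optimal_policy trajectory_lifted) auto
  with y y' le[of y' v'] show ?thesis
    by (intro optimal_plan_of_cost_le[where x = "\<lambda>i. \<psi> (y i)"] trajectory_lifted) auto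
qed

text \<open>Combinations of lifted data windows are again trajectories of the linear system, although
  combinations of the states \<open>zb\<close> need not be trajectories of \<open>f\<close>.\<close>

lemma hankel_state_step:
  assumes "trajectory f 1 (int nd) zb ub" "1 \<le> k" "l + k \<le> int nd"
  shows "hankel_mult l (\<lambda>i. \<psi> (zb i)) g (k + 1) =
    A *v hankel_mult l (\<lambda>i. \<psi> (zb i)) g k + B *v hankel_mult l ub g k"
proof -
  have "g i *\<^sub>R \<psi> (zb (i + (k + 1) - 1)) =
      A *v (g i *\<^sub>R \<psi> (zb (i + k - 1))) + B *v (g i *\<^sub>R ub (i + k - 1))" if "i \<in> {1..l}" for i
  proof -
    have "zb (i + k - 1 + 1) = f (zb (i + k - 1)) (ub (i + k - 1))"
      using assms(1)[unfolded trajectory_def, rule_format, of "i + k - 1"] assms(2,3) that by simp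
    then show ?thesis
      by (simp add: lift_step matrix_vector_mult_scaleR scaleR_add_right)
  qed
  then have "hankel_mult l (\<lambda>i. \<psi> (zb i)) g (k + 1) =
      (\<Sum>i=1..l. A *v (g i *\<^sub>R \<psi> (zb (i + k - 1))) + B *v (g i *\<^sub>R ub (i + k - 1)))"
    unfolding hankel_mult_def by (intro sum.cong) auto
  then show ?thesis
    unfolding hankel_mult_def sum.distrib
    by (simp add: linear_sum[OF matrix_vector_mul_linear])
qed

lemma hankel_output: "C *v hankel_mult l (\<lambda>i. \<psi> (zb i)) g k = hankel_mult l zb g k"
  unfolding hankel_mult_def
  by (simp add: linear_sum[OF matrix_vector_mul_linear] matrix_vector_mult_scaleR unlift)

lemma linear_trajectory_unique:
  assumes "\<And>k. \<lbrakk>a \<le> k; k < b\<rbrakk> \<Longrightarrow> x (k + 1) = A *v x k + B *v u k"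
    and "\<And>k. \<lbrakk>a \<le> k; k < b\<rbrakk> \<Longrightarrow> y (k + 1) = A *v y k + B *v u k"
    and "a \<le> k" "k \<le> b"
  shows "x k - y k = ((*v) A ^^ nat (k - a)) (x a - y a)"
  using assms(3,4)
proof (induction k rule: int_ge_induct)
  case (step k)
  then have "nat (k + 1 - a) = Suc (nat (k - a))"
    by simp
  with step assms(1,2)[of k] show ?case
    by (simp flip: matrix_vector_mult_diff_distrib)
qed simp

text \<open>A feasible \<open>g\<close> describes a trajectory of the linear system that agrees with the true past in inputs
  and outputs. Its lifted initial state may differ from the true one by some \<open>e\<close>, but \<open>e\<close> is invisible
  for \<open>Tini \<ge> CARD('n)\<close> steps, hence forever, so the predicted outputs are those of the true system.
  Conversely, full row rank realizes every input sequence from the true lifted initial state, in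
  particular the optimal one. Hence a data-driven minimizer is a minimizer of the linear problem.\<close>

lemma ddpc_plan_optimal:
  assumes W1: "1 \<le> W" and data: "ddpc_data f \<psi> Tini W nd ub zb"
    and past: "trajectory f (t - int Tini) t z u"
    and plan: "ddpc_plan Qz R Tini W nd ub zb r z u t v"
  shows "optimal_plan (\<lambda>i. \<psi> (r (i + (t - 1)))) W (\<psi> (z t)) v"
proof -
  define l where "l = int nd - int (Tini + W) + 1"
  let ?s = "\<lambda>i. \<psi> (r (i + (t - 1)))"
  let ?X = "\<lambda>g. hankel_mult l (\<lambda>i. \<psi> (zb i)) g"
  let ?U = "\<lambda>g. hankel_mult l ub g" and ?Z = "\<lambda>g. hankel_mult l zb g"
  let ?x = "\<lambda>k. \<psi> (z (t - int Tini + k - 1))" and ?u = "\<lambda>k. u (t - int Tini + k - 1)"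
  define feasible where "feasible v y g \<longleftrightarrow>
     (\<forall>k\<in>{1..int Tini}. ?U g k = ?u k \<and> ?Z g k = z (t - int Tini + k - 1)) \<and>
     (\<forall>k\<in>{1..int W}. ?U g (int Tini + k) = v k \<and> ?Z g (int Tini + k) = y k)" for v y g
  define cost where "cost v y = (\<Sum>i=1..int W. wnorm2 Qz (y i - r (t + i - 1)) + wnorm2 R (v i))"
    for v y
  have "\<exists>y g. is_arg_min (\<lambda>(v, y, g). cost v y) (\<lambda>(v, y, g). feasible v y g) (v, y, g)"
    using plan unfolding ddpc_plan_def Let_def feasible_def cost_def l_def .
  then obtain y g where yg: "feasible v y g"
    and le: "\<forall>v' y' g'. feasible v' y' g' \<longrightarrow> cost v y \<le> cost v' y'"
    unfolding is_arg_min_def by (fastforce simp: not_less)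
  have n: "CARD('n) \<le> Tini" and W: "Tini + W \<le> nd" and zb: "trajectory f 1 (int nd) zb ub"
    and rank: "lifted_excitation \<psi> (Tini + W) nd ub zb"
    using data by (auto simp: ddpc_data_def)
  have X_step: "?X g (k + 1) = A *v ?X g k + B *v ?U g k" if "1 \<le> k" "k < int Tini + int W" for g k
    using that W by (intro hankel_state_step[OF zb]) (auto simp: l_def)
  have x_step: "?x (k + 1) = A *v ?x k + B *v ?u k" if "1 \<le> k" "k < int Tini + 1" for k
  proof -
    have "z (t - int Tini + k - 1 + 1) = f (z (t - int Tini + k - 1)) (?u k)"
      by (rule past[unfolded trajectory_def, rule_format]) (use that in simp)
    moreover have "t - int Tini + (k + 1) - 1 = t - int Tini + k - 1 + 1"
      by simp
    ultimately show ?thesis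
      by (simp only: lift_step)
  qed
  have cost_eq: "cost v y = tracking_cost ?s 1 (int W) x v"
    if "\<And>k. k \<in> {1..int W} \<Longrightarrow> y k = C *v x k" for v y x
    unfolding cost_def tracking_cost_def
    by (intro sum.cong) (auto simp: that output_weight algebra_simps)
  \<comment> \<open>every feasible point predicts the outputs of the true system\<close>
  define x where "x k = rollout (linear_system A B) (\<psi> (z t)) v (nat (k - 1))" for k
  have x1: "x 1 = \<psi> (z t)"
    by (simp add: x_def)
  have x_traj: "x (k + 1) = A *v x k + B *v v k" if "1 \<le> k" for k
  proof -
    have "nat (k + 1 - 1) = Suc (nat (k - 1))" "int (nat (k - 1)) + 1 = k"
      using that by arith+
    then show ?thesis
      unfolding x_def by simp
  qed
  have y: "y k = C *v x k" if k: "k \<in> {1..int W}" for k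
  proof -
    let ?e = "?X g 1 - ?x 1"
    have pre: "?X g j - ?x j = ((*v) A ^^ nat (j - 1)) ?e" if "1 \<le> j" "j \<le> int Tini + 1" for j
    proof (rule linear_trajectory_unique[where b = "int Tini + 1" and u = ?u, OF _ x_step that])
      show "?X g (j + 1) = A *v ?X g j + B *v ?u j" if "1 \<le> j" "j < int Tini + 1" for j
        using X_step[of j g] yg that k by (auto simp: feasible_def)
    qed
    have invisible: "C *v (((*v) A ^^ j) ?e) = 0" for j
    proof (rule unobservable_forever)
      fix j assume "j < CARD('n)"
      then have j: "1 \<le> int j + 1" "int j + 1 \<in> {1..int Tini}"
        using n by auto
      have "C *v (((*v) A ^^ j) ?e) = C *v ?X g (int j + 1) - C *v ?x (int j + 1)"
        using pre[of "int j + 1"] j by (simp flip: matrix_vector_mult_diff_distrib)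
      also have "\<dots> = 0"
        using yg j(2) unfolding feasible_def hankel_output unlift by simp
      finally show "C *v (((*v) A ^^ j) ?e) = 0" .
    qed
    have "?X g (int Tini + k) - x k =
        ((*v) A ^^ nat (k - 1)) (?X g (int Tini + 1) - x 1)"
    proof (rule linear_trajectory_unique[where x = "\<lambda>k. ?X g (int Tini + k)" and b = "int W" and u = v])
      show "?X g (int Tini + (j + 1)) = A *v ?X g (int Tini + j) + B *v v j" if "1 \<le> j" "j < int W" for j
        using X_step[of "int Tini + j" g] yg that by (simp add: feasible_def add.assoc)
    qed (use x_traj k in auto)
    also have "?X g (int Tini + 1) - x 1 = ((*v) A ^^ Tini) ?e"
      using pre[of "int Tini + 1"] by (simp add: x1)
    finally have "C *v ?X g (int Tini + k) - C *v x k = 0"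
      using invisible[of "nat (k - 1) + Tini"]
      by (simp add: funpow_add flip: matrix_vector_mult_diff_distrib)
    with yg k show ?thesis
      unfolding hankel_output by (simp add: feasible_def)
  qed
  \<comment> \<open>an optimal linear trajectory is feasible\<close>
  obtain xo vo where xo: "xo 1 = \<psi> (z t)" "trajectory (linear_system A B) 1 (int W) xo vo"
    "tracking_cost ?s 1 (int W) xo vo = opt_value ?s W 1 (\<psi> (z t))"
    by (rule optimal_linear_trajectory)
  \<comment> \<open>Past inputs followed by the optimal ones, to be realized from the true past lifted state.\<close>
  define w where "w k = (if k \<le> int Tini then ?u k else vo (k - int Tini))" for k
  define b where "b i = (case i of Inl (k, a) \<Rightarrow> w k $ a | Inr c \<Rightarrow> ?x 1 $ c)" for i
  have "\<exists>go. \<forall>i\<in>({1..int (Tini + W)} \<times> UNIV) <+> UNIV.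
      (\<Sum>j\<in>{1..int nd - int (Tini + W) + 1}. go j * excitation_matrix \<psi> ub zb i j) = b i"
    by (rule full_row_rank_solvable[OF _ _ rank[unfolded lifted_excitation_def]]) auto
  then obtain go where go: "\<And>i. i \<in> ({1..int (Tini + W)} \<times> UNIV) <+> UNIV \<Longrightarrow>
      (\<Sum>j\<in>{1..l}. go j * excitation_matrix \<psi> ub zb i j) = b i"
    unfolding l_def by blast
  have Uo: "?U go k = w k" if "k \<in> {1..int Tini + int W}" for k
    unfolding vec_eq_iff
  proof
    fix a :: 'm
    have "Inl (k, a) \<in> ({1..int (Tini + W)} \<times> UNIV) <+> (UNIV :: 'n set)"
      using that by (intro InlI) simp
    from go[OF this] show "?U go k $ a = w k $ a"
      by (simp add: hankel_mult_def b_def)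
  qed
  have X1: "?X go 1 = ?x 1"
    unfolding vec_eq_iff
  proof
    fix c :: 'n
    have "Inr c \<in> ({1..int (Tini + W)} \<times> (UNIV :: 'm set)) <+> UNIV"
      by (intro InrI) simp
    from go[OF this] show "?X go 1 $ c = ?x 1 $ c"
      by (simp add: hankel_mult_def b_def)
  qed
  have pre: "?X go j = ?x j" if "1 \<le> j" "j \<le> int Tini + 1" for j
  proof -
    have "?X go j - ?x j = ((*v) A ^^ nat (j - 1)) (?X go 1 - ?x 1)"
    proof (rule linear_trajectory_unique[where b = "int Tini + 1" and u = ?u, OF _ x_step that(1,2)])
      show "?X go (i + 1) = A *v ?X go i + B *v ?u i" if "1 \<le> i" "i < int Tini + 1" for i
        using X_step[of i go] Uo[of i] that W1 by (simp add: w_def)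
    qed
    also have "\<dots> = 0"
      unfolding X1 by (simp add: linear_0[OF funpow_matrix_linear])
    finally show ?thesis
      by simp
  qed
  have post: "?X go (int Tini + k) = xo k" if k: "k \<in> {1..int W}" for k
  proof -
    have "?X go (int Tini + k) - xo k =
        ((*v) A ^^ nat (k - 1)) (?X go (int Tini + 1) - xo 1)"
    proof (rule linear_trajectory_unique[where x = "\<lambda>k. ?X go (int Tini + k)" and b = "int W" and u = vo])
      show "?X go (int Tini + (j + 1)) = A *v ?X go (int Tini + j) + B *v vo j" if "1 \<le> j" "j < int W" for j
        using X_step[of "int Tini + j" go] Uo[of "int Tini + j"] that by (simp add: w_def add.assoc)
    qed (use xo(2) k in \<open>auto simp: trajectory_def\<close>)
    also have "?X go (int Tini + 1) - xo 1 = 0"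
      using pre[of "int Tini + 1"] k xo(1) by simp
    also have "((*v) A ^^ nat (k - 1)) 0 = 0"
      by (rule linear_0[OF funpow_matrix_linear])
    finally show ?thesis
      by simp
  qed
  have "feasible vo (\<lambda>k. C *v xo k) go"
    unfolding feasible_def hankel_output[symmetric]
  proof (intro conjI ballI)
    fix k assume k: "k \<in> {1..int Tini}"
    show "?U go k = ?u k"
      using Uo[of k] k by (simp add: w_def)
    show "C *v ?X go k = z (t - int Tini + k - 1)"
      using pre[of k] k by (simp add: unlift)
  next
    fix k assume k: "k \<in> {1..int W}"
    show "?U go (int Tini + k) = vo k"
      using Uo[of "int Tini + k"] k by (simp add: w_def)
    show "C *v ?X go (int Tini + k) = C *v xo k"
      using post[OF k] by simp
  qed
  then have "cost v y \<le> cost vo (\<lambda>k. C *v xo k)"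
    using le by blast
  also have "\<dots> = tracking_cost ?s 1 (int W) xo vo"
    by (rule cost_eq) simp
  finally have "tracking_cost ?s 1 (int W) x v \<le> opt_value ?s W 1 (\<psi> (z t))"
    using cost_eq[OF y] xo(3) by simp
  then show ?thesis
    using x_traj x1 by (intro optimal_plan_of_cost_le[where x = x]) (auto simp: trajectory_def)
qed

text \<open>While the last plan is executed in open loop, its predicted states are the true lifted states, so
  its inputs are optimal feedback at these states.\<close>

lemma predictive_run_feedback:
  assumes run: "predictive_run f T W plan z u" and W: "1 \<le> W" "W \<le> T"
    and plan: "\<And>t v. \<lbrakk>t \<in> {1..int T - int W + 1}; plan t v\<rbrakk> \<Longrightarrow>
      optimal_plan (\<lambda>i. s (i + (t - 1))) W (\<psi> (z t)) v"
  shows "predictive_feedback s T W (\<lambda>t. \<psi> (z t)) u"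
  unfolding predictive_feedback_def
proof (intro conjI ballI)
  show "trajectory (linear_system A B) 1 (int T) (\<lambda>t. \<psi> (z t)) u"
    using run by (intro trajectory_lifted) (simp add: predictive_run_def)
next
  fix t assume t: "t \<in> {1..int T - int W}"
  then obtain v where v: "plan t v" "u t = v 1"
    using run unfolding predictive_run_def by blast
  have "optimal_plan (\<lambda>i. s (i + (t - 1))) W (\<psi> (z t)) v"
    using t by (intro plan v) auto
  then have "v 1 = opt_input (\<lambda>i. s (i + (t - 1))) (nat (int W - 1)) 1 (\<psi> (z t))"
    using W unfolding optimal_plan_def by fastforce
  moreover have "nat (int W - 1) = W - 1"
    using W by simp
  ultimately show "u t = opt_input s (W - 1) t (\<psi> (z t))"
    using v opt_input_shift[of s "t - 1" "W - 1" 1] by simp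
next
  fix t assume t: "t \<in> {int T - int W + 1..int T}"
  define t0 where "t0 = int T - int W + 1"
  obtain v where v: "plan t0 v" "\<And>i. i \<in> {1..int W} \<Longrightarrow> u (int T - int W + i) = v i"
    using run by (auto simp: predictive_run_def t0_def)
  have "optimal_plan (\<lambda>i. s (i + (t0 - 1))) W (\<psi> (z t0)) v"
    using W by (intro plan v) (auto simp: t0_def)
  then obtain x where x: "x 1 = \<psi> (z t0)" "trajectory (linear_system A B) 1 (int W) x v"
    "\<And>i. i \<in> {1..int W} \<Longrightarrow> v i = opt_input (\<lambda>i. s (i + (t0 - 1))) (nat (int W - i)) i (x i)"
    unfolding optimal_plan_def by blast
  have xz: "x i = \<psi> (z (int T - int W + i))" if "1 \<le> i" "i \<le> int W" for i
    using that
  proof (induction i rule: int_ge_induct)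
    case base
    then show ?case
      using x by (simp add: t0_def)
  next
    case (step i)
    have "z (int T - int W + i + 1) = f (z (int T - int W + i)) (u (int T - int W + i))"
      using run step W unfolding predictive_run_def trajectory_def by auto
    moreover have "x (i + 1) = A *v x i + B *v v i"
      using x(2) step by (auto simp: trajectory_def)
    ultimately show ?case
      using step v(2)[of i] by (simp add: lift_step add.assoc)
  qed
  define i where "i = t - (int T - int W)"
  have i: "i \<in> {1..int W}" "t = int T - int W + i"
    using t by (auto simp: i_def)
  have "u t = opt_input (\<lambda>i. s (i + (t0 - 1))) (nat (int W - i)) i (\<psi> (z t))"
    using v(2)[OF i(1)] x(3)[OF i(1)] xz[of i] i by simp
  then show "u t = opt_input s (nat (int T - t)) t (\<psi> (z t))"
    unfolding opt_input_shift by (simp add: t0_def i_def)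
qed

lemma mpc_run_feedback:
  assumes run: "mpc_run f A B \<psi> Q Qz R T W r z u" and W: "1 \<le> W" "W \<le> T"
  shows "trajectory f 1 (int T) z u"
    and "predictive_feedback (\<lambda>i. \<psi> (r i)) T W (\<lambda>t. \<psi> (z t)) u"
proof -
  show traj: "trajectory f 1 (int T) z u"
    using run by (auto simp: mpc_run_def predictive_run_def)
  have "\<exists>plan. predictive_run f T W plan z u \<and> (\<forall>t v. t \<in> {1..int T - int W + 1} \<longrightarrow> plan t v \<longrightarrow>
      optimal_plan (\<lambda>i. \<psi> (r (i + (t - 1)))) W (\<psi> (z t)) v)"
    using run unfolding mpc_run_def
  proof (elim disjE exE conjE)
    assume "predictive_run f T W (nmpc_plan f Qz R W r z) z u"
    then show ?thesis
      using nmpc_plan_optimal by blast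
  next
    assume "predictive_run f T W (lmpc_plan A B \<psi> Q R W r z) z u"
    then show ?thesis
      using lmpc_plan_optimal by blast
  next
    fix Tini nd ub zb
    assume data: "ddpc_data f \<psi> Tini W nd ub zb" and pre: "trajectory f (1 - int Tini) 1 z u"
      and run: "predictive_run f T W (ddpc_plan Qz R Tini W nd ub zb r z u) z u"
    have "trajectory f (t - int Tini) t z u" if "t \<in> {1..int T - int W + 1}" for t
      unfolding trajectory_def
    proof (intro allI impI)
      fix k assume k: "t - int Tini \<le> k \<and> k < t"
      show "z (k + 1) = f (z k) (u k)"
        using pre traj k that W unfolding trajectory_def by (cases "k < 1") auto
    qed
    then show ?thesis
      using run ddpc_plan_optimal[OF W(1) data] by blast
  qed
  then obtain plan where plan: "predictive_run f T W plan z u"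
    "\<And>t v. \<lbrakk>t \<in> {1..int T - int W + 1}; plan t v\<rbrakk> \<Longrightarrow>
      optimal_plan (\<lambda>i. \<psi> (r (i + (t - 1)))) W (\<psi> (z t)) v"
    by blast
  show "predictive_feedback (\<lambda>i. \<psi> (r i)) T W (\<lambda>t. \<psi> (z t)) u"
    by (rule predictive_run_feedback[OF plan(1) W plan(2)])
qed

lemma J_cost_lifted:
  "J_cost f Qz R z1 T u r =
     tracking_cost (\<lambda>i. \<psi> (r i)) 1 (int T) (\<lambda>t. \<psi> (rollout f z1 u (nat (t - 1)))) u"
  by (simp add: J_cost_def tracking_cost_def stage_cost_lifted)

lemma rollout_trajectory: "trajectory f 1 e (\<lambda>t. rollout f z1 u (nat (t - 1))) u"
  unfolding trajectory_def
proof (intro allI impI)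
  fix t :: int assume "1 \<le> t \<and> t < e"
  then have "nat (t + 1 - 1) = Suc (nat (t - 1))" "int (nat (t - 1)) + 1 = t"
    by arith+
  then show "rollout f z1 u (nat (t + 1 - 1)) = f (rollout f z1 u (nat (t - 1))) (u t)"
    by simp
qed

lemma J_opt_ge: "opt_value (\<lambda>i. \<psi> (r i)) T 1 (\<psi> z1) \<le> J_opt f Qz R z1 T r"
  unfolding J_opt_def
proof (rule cINF_greatest)
  show "opt_value (\<lambda>i. \<psi> (r i)) T 1 (\<psi> z1) \<le> J_cost f Qz R z1 T u r" for u
    unfolding J_cost_lifted
    using tracking_cost_ge[OF trajectory_lifted[OF rollout_trajectory], where k = T]
    by fastforce
qed simp

lemma dyn_regret_le:
  assumes traj: "trajectory f 1 (int T) z u"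
  shows "dyn_regret f Qz R (z 1) T u r \<le>
    tracking_cost (\<lambda>i. \<psi> (r i)) 1 (int T) (\<lambda>t. \<psi> (z t)) u - opt_value (\<lambda>i. \<psi> (r i)) T 1 (\<psi> (z 1))"
proof -
  have "rollout f (z 1) u (nat (t - 1)) = z t" if "1 \<le> t" "t \<le> int T" for t
    using that
  proof (induction t rule: int_ge_induct)
    case (step t)
    then have "nat (t + 1 - 1) = Suc (nat (t - 1))" "int (nat (t - 1)) + 1 = t"
      by arith+
    with step traj show ?case
      by (simp add: trajectory_def)
  qed simp
  then have "J_cost f Qz R (z 1) T u r = tracking_cost (\<lambda>i. \<psi> (r i)) 1 (int T) (\<lambda>t. \<psi> (z t)) u"
    unfolding J_cost_lifted tracking_cost_def by (intro sum.cong) auto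
  then show ?thesis
    using J_opt_ge[of r T "z 1"] by (simp add: dyn_regret_def)
qed

end

theorem theorem5p1:
  shows "\<exists>a :: real \<Rightarrow> real \<Rightarrow> real.
    \<forall>(A :: real^'n^'n) (B :: real^'m^'n) (Q :: real^'n^'n) (R :: real^'m^'m) (\<rho> :: real).
      stabilizable A B \<and> detectable Q A \<and> psd Q \<and> posdef R \<and> riccati_rate A B Q R \<rho> \<longrightarrow>
      (\<exists>\<Delta>::nat.
         minimal_stabilizing_window A B Q R \<Delta> \<and>
         (\<forall>M. window_const A B Q R \<rho> M \<longrightarrow>
            real \<Delta> \<le> a \<rho> M * (1 + ln (1 / (1 - spectral_radius (A_cl A B Q R))))) \<and>
         (\<forall>D::real. \<exists>c::real.
            \<forall>(f :: real^'z \<Rightarrow> real^'m \<Rightarrow> real^'z) (C :: real^'n^'z) (\<psi> :: real^'z \<Rightarrow> real^'n)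
              (Qz :: real^'z^'z) (T :: nat) (W :: nat)
              (r :: int \<Rightarrow> real^'z) (z :: int \<Rightarrow> real^'z) (u :: int \<Rightarrow> real^'m).
              koopman_embedding f A B C \<psi> \<and>
              (\<forall>s. norm s \<le> 1 \<longrightarrow> norm (\<psi> s) \<le> D) \<and>
              psd Qz \<and> Q = transpose C ** Qz ** C \<and>
              (\<forall>t\<in>{1..int T}. norm (r t) \<le> 1) \<and>
              \<Delta> \<le> W \<and> W \<le> T \<and>
              mpc_run f A B \<psi> Q Qz R T W r z u \<longrightarrow>
              (let lam = max \<rho> (gamma_inf A B Q R);
                   c1 = c * (1 + (norm (\<psi> (z 1)))\<^sup>2)
               in dyn_regret f Qz R (z 1) T u r \<le> c1 * (real W)\<^sup>2 * lam ^ (2 * W) * real T \<and>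
                  (lam = \<rho> \<longrightarrow>
                   dyn_regret f Qz R (z 1) T u r \<le> c1 * \<rho> ^ (2 * W) * real T))))"
proof (intro exI[of _ "\<lambda>\<rho> M. 3 + (\<bar>ln (2 * M ^ 3)\<bar> + 1) / ln (1 / \<rho>)"] allI impI; elim conjE)
  fix A :: "real^'n^'n" and B :: "real^'m^'n" and Q :: "real^'n^'n" and R :: "real^'m^'m" and \<rho> :: real
  assume "detectable Q A" "psd Q" "posdef R" "riccati_rate A B Q R \<rho>"
  then interpret convergent_lq_problem A B Q R \<rho>
    by unfold_locales
  obtain \<Delta> where \<Delta>: "minimal_stabilizing_window A B Q R \<Delta>"
    using minimal_window_exists by blast
  then have \<Delta>s: "stabilizing_window A B Q R \<Delta>"
    by (simp add: minimal_stabilizing_window_def)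
  have regret: "\<exists>c::real. \<forall>(f :: real^'z \<Rightarrow> real^'m \<Rightarrow> real^'z) (C :: real^'n^'z) (\<psi> :: real^'z \<Rightarrow> real^'n)
      (Qz :: real^'z^'z) (T :: nat) (W :: nat)
      (r :: int \<Rightarrow> real^'z) (z :: int \<Rightarrow> real^'z) (u :: int \<Rightarrow> real^'m).
      koopman_embedding f A B C \<psi> \<and>
      (\<forall>s. norm s \<le> 1 \<longrightarrow> norm (\<psi> s) \<le> D) \<and>
      psd Qz \<and> Q = transpose C ** Qz ** C \<and>
      (\<forall>t\<in>{1..int T}. norm (r t) \<le> 1) \<and>
      \<Delta> \<le> W \<and> W \<le> T \<and>
      mpc_run f A B \<psi> Q Qz R T W r z u \<longrightarrow>
      (let lam = max \<rho> (gamma_inf A B Q R);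
           c1 = c * (1 + (norm (\<psi> (z 1)))\<^sup>2)
       in dyn_regret f Qz R (z 1) T u r \<le> c1 * (real W)\<^sup>2 * lam ^ (2 * W) * real T \<and>
          (lam = \<rho> \<longrightarrow>
           dyn_regret f Qz R (z 1) T u r \<le> c1 * \<rho> ^ (2 * W) * real T))" for D :: real
  proof -
    define l where "l = max \<rho> \<gamma>"
    \<comment> \<open>The bound \<open>D\<close> may be negative, in which case the premises are contradictory; \<open>max D 0\<close> covers this.\<close>
    obtain c where c: "c \<ge> 0"
      "\<forall>s T W x u. \<Delta> \<le> W \<and> W \<le> T \<and> (\<forall>i\<in>{1..int T}. norm (s i) \<le> max D 0) \<and>
         predictive_feedback s T W x u \<longrightarrow>
         tracking_cost s 1 (int T) x u - opt_value s T 1 (x 1)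
          \<le> c * (1 + (norm (x 1))\<^sup>2) * l ^ (2 * W) * real T"
      by (rule lq_regret_bound[OF \<Delta>s, of "max D 0", folded l_def]) simp
    show ?thesis
    proof (intro exI[of _ c] allI impI; elim conjE)
      fix f :: "real^'z \<Rightarrow> real^'m \<Rightarrow> real^'z" and C :: "real^'n^'z" and \<psi> :: "real^'z \<Rightarrow> real^'n"
        and Qz :: "real^'z^'z" and T W :: nat and r z :: "int \<Rightarrow> real^'z" and u :: "int \<Rightarrow> real^'m"
      assume koop: "koopman_embedding f A B C \<psi>" and D: "\<forall>s. norm s \<le> 1 \<longrightarrow> norm (\<psi> s) \<le> D"
        and Q: "Q = transpose C ** Qz ** C" and r: "\<forall>t\<in>{1..int T}. norm (r t) \<le> 1"
        and W: "\<Delta> \<le> W" "W \<le> T" and run: "mpc_run f A B \<psi> Q Qz R T W r z u"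
      interpret koopman_tracking A B Q R f C \<psi> Qz
        by unfold_locales (rule koop Q)+
      have W1: "1 \<le> W"
        using \<Delta>s W by (simp add: stabilizing_window_def)
      note feedback = mpc_run_feedback[OF run W1 W(2)]
      let ?c1 = "c * (1 + (norm (\<psi> (z 1)))\<^sup>2)"
      have "dyn_regret f Qz R (z 1) T u r \<le>
          tracking_cost (\<lambda>i. \<psi> (r i)) 1 (int T) (\<lambda>t. \<psi> (z t)) u - opt_value (\<lambda>i. \<psi> (r i)) T 1 (\<psi> (z 1))"
        by (rule dyn_regret_le[OF feedback(1)])
      also have "\<dots> \<le> ?c1 * l ^ (2 * W) * real T"
        using D r W feedback(2) by (intro c(2)[rule_format]) (auto simp: le_max_iff_disj)
      finally have bound: "dyn_regret f Qz R (z 1) T u r \<le> ?c1 * l ^ (2 * W) * real T" .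
      \<comment> \<open>As \<open>W \<ge> 1\<close>, the bound without the factor \<open>W\<^sup>2\<close> implies the one with it.\<close>
      have "?c1 * l ^ (2 * W) * real T * 1 \<le> ?c1 * l ^ (2 * W) * real T * (real W)\<^sup>2"
        using c(1) \<rho>_bounds W1
        by (intro mult_left_mono mult_nonneg_nonneg) (auto simp: l_def one_le_power le_max_iff_disj)
      with bound have "dyn_regret f Qz R (z 1) T u r \<le> ?c1 * (real W)\<^sup>2 * l ^ (2 * W) * real T"
        by (simp add: mult_ac)
      with bound show "let lam = max \<rho> (gamma_inf A B Q R);
          c1 = c * (1 + (norm (\<psi> (z 1)))\<^sup>2)
        in dyn_regret f Qz R (z 1) T u r \<le> c1 * (real W)\<^sup>2 * lam ^ (2 * W) * real T \<and>
          (lam = \<rho> \<longrightarrow> dyn_regret f Qz R (z 1) T u r \<le> c1 * \<rho> ^ (2 * W) * real T)"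
        unfolding Let_def l_def by (intro conjI impI) simp_all
    qed
  qed
  show "\<exists>\<Delta>::nat.
         minimal_stabilizing_window A B Q R \<Delta> \<and>
         (\<forall>M. window_const A B Q R \<rho> M \<longrightarrow>
            real \<Delta> \<le> (3 + (\<bar>ln (2 * M ^ 3)\<bar> + 1) / ln (1 / \<rho>)) *
              (1 + ln (1 / (1 - spectral_radius (A_cl A B Q R))))) \<and>
         (\<forall>D::real. \<exists>c::real.
            \<forall>(f :: real^'z \<Rightarrow> real^'m \<Rightarrow> real^'z) (C :: real^'n^'z) (\<psi> :: real^'z \<Rightarrow> real^'n)
              (Qz :: real^'z^'z) (T :: nat) (W :: nat)
              (r :: int \<Rightarrow> real^'z) (z :: int \<Rightarrow> real^'z) (u :: int \<Rightarrow> real^'m).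
              koopman_embedding f A B C \<psi> \<and>
              (\<forall>s. norm s \<le> 1 \<longrightarrow> norm (\<psi> s) \<le> D) \<and>
              psd Qz \<and> Q = transpose C ** Qz ** C \<and>
              (\<forall>t\<in>{1..int T}. norm (r t) \<le> 1) \<and>
              \<Delta> \<le> W \<and> W \<le> T \<and>
              mpc_run f A B \<psi> Q Qz R T W r z u \<longrightarrow>
              (let lam = max \<rho> (gamma_inf A B Q R);
                   c1 = c * (1 + (norm (\<psi> (z 1)))\<^sup>2)
               in dyn_regret f Qz R (z 1) T u r \<le> c1 * (real W)\<^sup>2 * lam ^ (2 * W) * real T \<and>
                  (lam = \<rho> \<longrightarrow>
                   dyn_regret f Qz R (z 1) T u r \<le> c1 * \<rho> ^ (2 * W) * real T)))"
    by (intro exI[of _ \<Delta>] conjI allI impI \<Delta> minimal_window_le[OF \<Delta>] regret)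
qed

end
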